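(* Let $\mathbbm k$ be an algebraically closed field with a valuation $\operatorname{val}:\mathbbm k\to\mathbb T$ satisfying $\operatorname{val}(\mathbbm k)=\mathbb T$. Then for $n\le5$ and any $0\le r_1\le\cdots\le r_k\le n$, every valuated flag matroid of rank $(r_1,\dots,r_k)$ on $[n]$ is realizable over $\mathbbm k$; equivalently, the projective tropicalization of the flag variety $Fl(r_1,\dots,r_k;n)\subseteq\prod_i\mathbb P(\mathbbm k^{\binom{[n]}{r_i}})$ (Plücker embedding) equals the flag Dressian $FlDr(r_1,\dots,r_k;n)$.
   Context: $\mathbb T=\mathbb R\cup\{\infty\}$ (min convention). A valuated matroid of rank $r$ on $[n]$ is $\mu:\binom{[n]}{r}\to\mathbb T$ such that $\{I:\mu(I)\ne\infty\}$ is the set of bases of a matroid and for bases $B,B'$ and $i\in B\setminus B'$ there is $j\in B'\setminus B$ with $\mu(B)+\mu(B')\ge\mu(B\setminus i\cup j)+\mu(B'\setminus j\cup i)$. For valuated matroids $\mu,\nu$ of ranks $r\le s$, $\mu\twoheadleftarrow\nu$ means: for all bases $I$ of $\mu$, $J$ of $\nu$, $i\in I\setminus J$ there is $j\in J\setminus I$ with $\mu(I)+\nu(J)\ge\mu(I\setminus i\cup j)+\nu(J\setminus j\cup i)$. A valuated flag matroid is $(\mu_1,\dots,\mu_k)$ with $\mu_i\twoheadleftarrow\mu_j$ for $i<j$. It is realizable over $\mathbbm k$ if there are linear subspaces $L_1\subseteq\cdots\subseteq L_k\subseteq\mathbbm k^n$ with $\dim L_i=r_i$ and constants $c_i\in\mathbb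 R$ such that $\mu_i(I)=\operatorname{val}(P_I(L_i))+c_i$ for all $I\in\binom{[n]}{r_i}$, where $(P_I(L_i))_I$ are Plücker coordinates of $L_i$. The flag Dressian $FlDr(r_1,\dots,r_k;n)$ is the set of points of $\prod_i\mathbb P(\mathbb T^{\binom{[n]}{r_i}})$ satisfying the tropical Grassmann–Plücker and incidence–Plücker relations, whose points correspond exactly to valuated flag matroids of rank $(r_1,\dots,r_k)$ on $[n]$. The projective tropicalization of the flag variety is the set of coordinatewise valuations (modulo adding constants in each factor) of points of $Fl(r_1,\dots,r_k;n)$ in its Plücker embedding, i.e. the set of realizable valuated flag matroids. *)

theory Defs
  imports
    "HOL-Library.Extended_Real"
    "HOL-Library.FuncSet"
    "HOL-Library.Ramsey"
    "Jordan_Normal_Form.DL_Rank_Submatrix"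
begin

(* The ground set [n] is {..<n}, matching the 0-based column indices of 'a mat; the family of
   r-subsets of [n] is nsets {..<n} r.  Tuples (x_1,...,x_k) are lists, so that a product of
   sets is listset. *)

definition TT :: "ereal set" where
  "TT = - {-\<infinity>}"

definition is_valuation :: "('k::field \<Rightarrow> ereal) \<Rightarrow> bool" where
  "is_valuation val \<longleftrightarrow>
     (\<forall>x. val x \<in> TT) \<and>
     (\<forall>x. val x = \<infinity> \<longleftrightarrow> x = 0) \<and>
     (\<forall>x y. val (x * y) = val x + val y) \<and>
     (\<forall>x y. val (x + y) \<ge> min (val x) (val y))"


section \<open>Valuated matroids and valuated flag matroids\<close>

definition matroid_bases :: "'a set \<Rightarrow> 'a set set \<Rightarrow> bool" where
  "matroid_bases E \<B> \<longleftrightarrow>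
     finite E \<and> \<B> \<subseteq> Pow E \<and> \<B> \<noteq> {} \<and>
     (\<forall>B\<in>\<B>. \<forall>B'\<in>\<B>. \<forall>i\<in>B - B'. \<exists>j\<in>B' - B. insert j (B - {i}) \<in> \<B>)"

definition bases_of :: "nat \<Rightarrow> nat \<Rightarrow> (nat set \<Rightarrow> ereal) \<Rightarrow> nat set set" where
  "bases_of n r \<mu> = {I \<in> nsets {..<n} r. \<mu> I \<noteq> \<infinity>}"

definition valuated_matroid :: "nat \<Rightarrow> nat \<Rightarrow> (nat set \<Rightarrow> ereal) \<Rightarrow> bool" where
  "valuated_matroid n r \<mu> \<longleftrightarrow>
     \<mu> \<in> nsets {..<n} r \<rightarrow> TT \<and>
     matroid_bases {..<n} (bases_of n r \<mu>) \<and>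
     (\<forall>B\<in>bases_of n r \<mu>. \<forall>B'\<in>bases_of n r \<mu>. \<forall>i\<in>B - B'. \<exists>j\<in>B' - B.
        \<mu> B + \<mu> B' \<ge> \<mu> (insert j (B - {i})) + \<mu> (insert i (B' - {j})))"

text \<open>\<open>valuated_quotient n r s \<mu> \<nu>\<close> is $\mu \twoheadleftarrow \nu$, where $\mu$ has rank $r$ and
  $\nu$ has rank $s \ge r$.\<close>

definition valuated_quotient ::
  "nat \<Rightarrow> nat \<Rightarrow> nat \<Rightarrow> (nat set \<Rightarrow> ereal) \<Rightarrow> (nat set \<Rightarrow> ereal) \<Rightarrow> bool" where
  "valuated_quotient n r s \<mu> \<nu> \<longleftrightarrow>
     (\<forall>I\<in>bases_of n r \<mu>. \<forall>J\<in>bases_of n s \<nu>. \<forall>i\<in>I - J. \<exists>j\<in>J - I.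
        \<mu> I + \<nu> J \<ge> \<mu> (insert j (I - {i})) + \<nu> (insert i (J - {j})))"

definition valuated_flag_matroid :: "nat \<Rightarrow> nat list \<Rightarrow> (nat set \<Rightarrow> ereal) list \<Rightarrow> bool" where
  "valuated_flag_matroid n rs \<mu>s \<longleftrightarrow>
     length \<mu>s = length rs \<and>
     (\<forall>i<length rs. valuated_matroid n (rs ! i) (\<mu>s ! i)) \<and>
     (\<forall>j<length rs. \<forall>i<j. valuated_quotient n (rs ! i) (rs ! j) (\<mu>s ! i) (\<mu>s ! j))"


section \<open>Flags of linear subspaces and Pluecker coordinates\<close>

abbreviation subspace_vs :: "nat \<Rightarrow> 'k::field vec set \<Rightarrow> ('k, 'k vec) module" where
  "subspace_vs n L \<equiv> (module_vec TYPE('k) n)\<lparr>carrier := L\<rparr>"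

definition linear_flags :: "nat \<Rightarrow> nat list \<Rightarrow> 'k::field vec set list set" where
  "linear_flags n rs = {Ls.
     length Ls = length rs \<and>
     (\<forall>i<length rs. subspace class_ring (Ls ! i) (module_vec TYPE('k) n) \<and>
        vectorspace.dim class_ring (subspace_vs n (Ls ! i)) = rs ! i) \<and>
     sorted_wrt (\<subseteq>) Ls}"

text \<open>The point of the projective space over the $r$-subsets of $[n]$ given by an $r$-dimensional
  subspace $L$, as the set of all its homogeneous coordinate vectors: the maximal minors of a
  matrix whose rows are a basis of $L$, up to a common nonzero factor.\<close>

definition plucker_point :: "nat \<Rightarrow> nat \<Rightarrow> 'k::field vec set \<Rightarrow> (nat set \<Rightarrow> 'k) set" where
  "plucker_point n r L =
     {\<lambda>I\<in>nsets {..<n} r. c * det (submatrix A UNIV I) | c A.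
        c \<noteq> 0 \<and> A \<in> carrier_mat r n \<and> distinct (rows A) \<and>
        vectorspace.basis class_ring (subspace_vs n L) (set (rows A))}"

definition realizable ::
  "('k::field \<Rightarrow> ereal) \<Rightarrow> nat \<Rightarrow> nat list \<Rightarrow> (nat set \<Rightarrow> ereal) list \<Rightarrow> bool" where
  "realizable val n rs \<mu>s \<longleftrightarrow>
     (\<exists>Ls\<in>linear_flags n rs. \<forall>i<length rs.
        \<exists>P\<in>plucker_point n (rs ! i) (Ls ! i). \<exists>c::real.
          \<forall>I\<in>nsets {..<n} (rs ! i). (\<mu>s ! i) I = val (P I) + ereal c)"

definition flag_variety :: "nat \<Rightarrow> nat list \<Rightarrow> (nat set \<Rightarrow> 'k::field) set list set" where
  "flag_variety n rs = {map2 (plucker_point n) rs Ls | Ls. Ls \<in> linear_flags n rs}"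


section \<open>Tropical projective space, tropicalization and the flag Dressian\<close>

definition trop_coords :: "nat \<Rightarrow> nat \<Rightarrow> (nat set \<Rightarrow> ereal) set" where
  "trop_coords n r = {\<mu> \<in> nsets {..<n} r \<rightarrow>\<^sub>E TT. \<exists>I\<in>nsets {..<n} r. \<mu> I \<noteq> \<infinity>}"

definition trop_rel :: "nat \<Rightarrow> nat \<Rightarrow> ((nat set \<Rightarrow> ereal) \<times> (nat set \<Rightarrow> ereal)) set" where
  "trop_rel n r = {(\<mu>, \<nu>). \<mu> \<in> trop_coords n r \<and> \<nu> \<in> trop_coords n r \<and>
     (\<exists>c::real. \<forall>I\<in>nsets {..<n} r. \<nu> I = \<mu> I + ereal c)}"

definition trop_proj :: "nat \<Rightarrow> nat \<Rightarrow> (nat set \<Rightarrow> ereal) set set" where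
  "trop_proj n r = trop_coords n r // trop_rel n r"

definition trop_point :: "nat \<Rightarrow> nat \<Rightarrow> (nat set \<Rightarrow> ereal) \<Rightarrow> (nat set \<Rightarrow> ereal) set" where
  "trop_point n r \<mu> = trop_rel n r `` {restrict \<mu> (nsets {..<n} r)}"

definition projective_tropicalization ::
  "('k::field \<Rightarrow> ereal) \<Rightarrow> nat \<Rightarrow> nat list \<Rightarrow> (nat set \<Rightarrow> 'k) set list set
     \<Rightarrow> (nat set \<Rightarrow> ereal) set list set" where
  "projective_tropicalization val n rs X =
     {map2 (\<lambda>r P. trop_point n r (\<lambda>I. val (P I))) rs Ps | Ps. \<exists>x\<in>X. Ps \<in> listset x}"

text \<open>The tropical sum of the terms $f_j$, $j \in X$, vanishes: its minimum is $\infty$ or is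
  attained at least twice.\<close>

definition trop_vanishes :: "('j \<Rightarrow> ereal) \<Rightarrow> 'j set \<Rightarrow> bool" where
  "trop_vanishes f X \<longleftrightarrow>
     (\<forall>j\<in>X. f j = \<infinity>) \<or>
     (\<exists>i\<in>X. \<exists>j\<in>X. i \<noteq> j \<and> f i = f j \<and> (\<forall>l\<in>X. f i \<le> f l))"

text \<open>Tropicalizations of
  $\sum_{j \in J \setminus I} \pm p_{I \cup j}\, q_{J \setminus j}$ with $|I| = r - 1$ and
  $|J| = s + 1$; the condition on $I$ is written so that there is no relation for $r = 0$.\<close>

definition trop_incidence_plucker ::
  "nat \<Rightarrow> nat \<Rightarrow> nat \<Rightarrow> (nat set \<Rightarrow> ereal) \<Rightarrow> (nat set \<Rightarrow> ereal) \<Rightarrow> bool" where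
  "trop_incidence_plucker n r s \<mu> \<nu> \<longleftrightarrow>
     (\<forall>I J. I \<subseteq> {..<n} \<and> Suc (card I) = r \<and> J \<in> nsets {..<n} (Suc s) \<longrightarrow>
        trop_vanishes (\<lambda>j. \<mu> (insert j I) + \<nu> (J - {j})) (J - I))"

definition trop_grassmann_plucker :: "nat \<Rightarrow> nat \<Rightarrow> (nat set \<Rightarrow> ereal) \<Rightarrow> bool" where
  "trop_grassmann_plucker n r \<mu> \<longleftrightarrow>
     (\<forall>I J. I \<subseteq> {..<n} \<and> Suc (card I) = r \<and> J \<in> nsets {..<n} (Suc r) \<longrightarrow>
        trop_vanishes (\<lambda>j. \<mu> (insert j I) + \<mu> (J - {j})) (J - I))"

text \<open>The relations are homogeneous in each factor, so whether they hold does not depend on the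
  representatives \<open>\<mu>s\<close>.\<close>

definition flag_dressian :: "nat \<Rightarrow> nat list \<Rightarrow> (nat set \<Rightarrow> ereal) set list set" where
  "flag_dressian n rs = {p \<in> listset (map (trop_proj n) rs). \<exists>\<mu>s\<in>listset p.
     (\<forall>i<length rs. trop_grassmann_plucker n (rs ! i) (\<mu>s ! i)) \<and>
     (\<forall>j<length rs. \<forall>i<j. trop_incidence_plucker n (rs ! i) (rs ! j) (\<mu>s ! i) (\<mu>s ! j))}"

end

theory Submission
  imports Defs
begin

text \<open>A point of the tropicalization of a linear space is given by the tropical circuit relations, and
  it lifts to any realization of that space, because the valuation is onto and the residue field is
  infinite. Hence a tropical point lifts into every realized subspace, and dually a tropical hyperplane
  lifts above every realized subspace, so that for $n \le 5$ only the ranks 2 and 3 have to be treated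
  by hand.

  A configuration of points in the plane is extended by a point \<open>u\<close> with prescribed valuations of all
  \<open>det(P\<^sub>i, P\<^sub>j, u)\<close> by lifting a point of the plane embedded by the lines through pairs of given
  points. All \<open>3 \<times> 3\<close> minors of these at most ten linear forms are monomials in the Pluecker coordinates
  of the configuration, and therefore every circuit relation among the forms follows from the tropical
  Pluecker relations. This yields valuated matroids of rank 3 on five elements, and also the step from
  rank 3 to rank 2 in a flag, for which \<open>u\<close> is a sixth point.\<close>

section \<open>Valuations\<close>

text \<open>Monomial minors matter because the valuation of a monomial is a tropical expression in
  the given data, whereas the valuation of a sum depends on the realization chosen so far. The
  determinant of three lines through pairs of given points is a monomial if two of the lines share a
  given point, and a binomial if the three pairs are disjoint. Three disjoint pairs need six points,
  and so the bound 5 enters. Four lines are four edges of a graph on at most five vertices. Their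
  circuit relation comes from three-term relations unless one edge is disjoint from a triangle
  formed by the others. That case is the Grassmann-Pluecker relation for \<open>{d, e}\<close> and
  \<open>{a, b, c, u}\<close> on six elements. For a flag of ranks 2 and 3 it is not itself an
  incidence relation and has to be derived by an exchange argument. Rank 1 and corank 1 come last in
  a flag, because they can be fitted to whatever is already realized.\<close>

lemma trop_vanishesI:
  assumes "\<And>i. i \<in> X \<Longrightarrow> f i \<noteq> \<infinity> \<Longrightarrow> (\<And>l. l \<in> X \<Longrightarrow> f i \<le> f l) \<Longrightarrow> \<exists>j\<in>X. j \<noteq> i \<and> f j \<le> f i"
    and "finite X"
  shows "trop_vanishes f X"
proof (cases "\<forall>j\<in>X. f j = \<infinity>")
  case False
  then obtain k where k: "k \<in> X" "f k \<noteq> \<infinity>" by auto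
  obtain i where i: "i \<in> X" "\<And>l. l \<in> X \<Longrightarrow> f i \<le> f l"
    using ex_min_if_finite[of "f ` X"] assms(2) k(1)
    by (metis empty_iff finite_imageI image_iff image_is_empty not_less)
  have "f i \<noteq> \<infinity>" using i(2)[OF k(1)] k(2) by auto
  from assms(1)[OF i(1) this i(2)] obtain j where "j \<in> X" "j \<noteq> i" "f j \<le> f i" by blast
  then show ?thesis using i unfolding trop_vanishes_def by (metis antisym)
qed (simp add: trop_vanishes_def)

lemma trop_vanishesD:
  assumes "trop_vanishes f X" "i \<in> X" "f i \<noteq> \<infinity>"
  shows "\<exists>j\<in>X. j \<noteq> i \<and> f j \<le> f i"
  using assms unfolding trop_vanishes_def by metis

lemma trop_vanishes_cong:
  assumes "\<And>j. j \<in> X \<Longrightarrow> f j = g j"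
  shows "trop_vanishes f X \<longleftrightarrow> trop_vanishes g X"
  using assms unfolding trop_vanishes_def by auto

lemma trop_vanishes_add_const:
  assumes "trop_vanishes f X"
  shows "trop_vanishes (\<lambda>j. f j + c) X"
proof (cases "\<forall>j\<in>X. f j = \<infinity>")
  case False
  then obtain i j where "i \<in> X" "j \<in> X" "i \<noteq> j" "f i = f j" "\<forall>l\<in>X. f i \<le> f l"
    using assms unfolding trop_vanishes_def by blast
  then have "f i + c = f j + c" "\<forall>l\<in>X. f i + c \<le> f l + c" by (auto intro: add_right_mono)
  with \<open>i \<in> X\<close> \<open>j \<in> X\<close> \<open>i \<noteq> j\<close> show ?thesis unfolding trop_vanishes_def by blast
qed (simp add: trop_vanishes_def)

lemma trop_vanishes_add_real_iff:
  "trop_vanishes (\<lambda>j. f j + ereal c) X \<longleftrightarrow> trop_vanishes f X"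
proof
  assume "trop_vanishes (\<lambda>j. f j + ereal c) X"
  from trop_vanishes_add_const[OF this, of "ereal (-c)"]
  show "trop_vanishes f X" by (simp add: add.assoc)
qed (rule trop_vanishes_add_const)

section \<open>Values of products, inverses and sums\<close>

locale valuation =
  fixes val :: "'k::field \<Rightarrow> ereal"
  assumes is_valuation: "is_valuation val"
begin

lemma val_not_MInf [simp]: "val x \<noteq> -\<infinity>" "-\<infinity> \<noteq> val x"
  and val_eq_PInf [simp]: "val x = \<infinity> \<longleftrightarrow> x = 0"
  and val_mult: "val (x * y) = val x + val y"
  and val_add_ge: "min (val x) (val y) \<le> val (x + y)"
  using is_valuation unfolding is_valuation_def TT_def by auto

lemma val_0 [simp]: "val 0 = \<infinity>"
  by simp

lemma val_real: "x \<noteq> 0 \<Longrightarrow> \<exists>r. val x = ereal r"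
  by (cases "val x") auto

lemma val_1 [simp]: "val 1 = 0"
proof -
  obtain r where r: "val 1 = ereal r" using val_real[of 1] by auto
  have "val 1 + val 1 = val 1" by (simp flip: val_mult)
  then show ?thesis by (simp add: r)
qed

lemma val_uminus [simp]: "val (- x) = val x"
proof -
  obtain r where r: "val (-1) = ereal r" using val_real[of "-1"] by auto
  have "val (-1) + val (-1) = val 1" by (simp flip: val_mult)
  then have "val (-1) = 0" by (simp add: r)
  then show ?thesis using val_mult[of "-1" x] by simp
qed

lemma val_diff_ge: "min (val x) (val y) \<le> val (x - y)"
  using val_add_ge[of x "-y"] by simp

lemma val_add_eq: "val x < val y \<Longrightarrow> val (x + y) = val x"
  using val_add_ge[of x y] val_diff_ge[of "x + y" y] by (auto simp: min_def split: if_splits)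

lemma val_inverse: "x \<noteq> 0 \<Longrightarrow> val (inverse x) = - val x"
proof -
  assume x: "x \<noteq> 0"
  then obtain r where r: "val x = ereal r" using val_real by auto
  have "val (inverse x) + val x = 0" using x by (simp flip: val_mult)
  then show ?thesis using r by (cases "val (inverse x)") auto
qed

lemma val_sum_gt:
  assumes "finite X" "\<And>j. j \<in> X \<Longrightarrow> b < val (g j)" "b \<noteq> \<infinity>"
  shows "b < val (sum g X)"
  using assms
proof (induction X)
  case (insert x F)
  then have "b < min (val (g x)) (val (sum g F))" by simp
  also have "\<dots> \<le> val (g x + sum g F)" by (rule val_add_ge)
  finally show ?case using insert by simp
qed auto

text \<open>A unique minimal term could not be cancelled: the rest of the sum would have a strictly
  larger value.\<close>

lemma trop_vanishes_sum:
  assumes "finite X" "(\<Sum>j\<in>X. g j) = 0"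
  shows "trop_vanishes (\<lambda>j. val (g j)) X"
proof (rule trop_vanishesI[OF _ assms(1)])
  fix i assume i: "i \<in> X" "val (g i) \<noteq> \<infinity>"
  show "\<exists>j\<in>X. j \<noteq> i \<and> val (g j) \<le> val (g i)"
  proof (rule ccontr)
    assume "\<not> ?thesis"
    then have "val (g i) < val (sum g (X - {i}))"
      using i by (intro val_sum_gt) (auto simp: assms(1))
    moreover have "sum g (X - {i}) = - g i"
      using assms i by (simp add: sum_diff1)
    ultimately show False by simp
  qed
qed

lemma val_prod: "finite R \<Longrightarrow> val (prod g R) = (\<Sum>x\<in>R. val (g x))"
  by (induction R rule: finite_induct) (auto simp: val_mult)

end

section \<open>Algebraically closed fields: surjective valuation and infinite residue field\<close>

locale alg_closed_valuation = valuation val for val :: "'k::alg_closed_field \<Rightarrow> ereal" +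
  assumes range_val: "range val = TT"
begin

lemma ex_val: "t \<noteq> -\<infinity> \<Longrightarrow> \<exists>x. val x = t"
  using range_val unfolding TT_def by (metis ComplI rangeE singletonD)

text \<open>The residue field is infinite: a root of \<open>(\<Prod>\<rho>\<in>R. x - \<rho>) = 1\<close> has a residue different from
  those of all elements of \<open>R\<close>.\<close>

lemma ex_unit_avoiding_residues:
  assumes "finite R" "\<And>\<rho>. \<rho> \<in> R \<Longrightarrow> 0 \<le> val \<rho>" "R \<noteq> {}"
  shows "\<exists>c. \<forall>\<rho>\<in>R. val (c - \<rho>) = 0"
proof -
  define p where "p = (\<Prod>\<rho>\<in>R. [:-\<rho>, 1:]) - (1 :: 'k poly)"
  have deg: "degree (\<Prod>\<rho>\<in>R. [:-\<rho>, 1:]) = card R"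
    by (subst degree_prod_eq_sum_degree) auto
  have "card R > 0" using assms by (simp add: card_gt_0_iff)
  then have "degree p > 0"
    unfolding p_def by (metis deg degree_1 degree_add_eq_left diff_conv_add_uminus degree_minus)
  then obtain c where "poly p c = 0"
    using alg_closed_imp_poly_has_root by blast
  then have prod: "(\<Prod>\<rho>\<in>R. c - \<rho>) = 1"
    by (simp add: p_def poly_prod)
  have sum: "(\<Sum>\<rho>\<in>R. val (c - \<rho>)) = 0"
    using val_prod[OF assms(1), of "\<lambda>\<rho>. c - \<rho>"] by (simp add: prod)
  \<comment> \<open>The values of the factors add up to 0. A negative \<open>val c\<close> would be
    the value of every factor; without it no factor has a negative value, and so all values are
    0.\<close>
  have c: "0 \<le> val c"
  proof (rule ccontr)
    assume neg: "\<not> 0 \<le> val c"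
    have eq: "val (c - \<rho>) = val c" if "\<rho> \<in> R" for \<rho>
      using val_add_eq[of c "-\<rho>"] neg assms(2)[OF that] by simp
    obtain r where r: "val c = ereal r" using neg by (cases "val c") auto
    have "(\<Sum>\<rho>\<in>R. val (c - \<rho>)) = ereal (card R * r)"
      by (simp add: eq r)
    then show False using sum neg \<open>card R > 0\<close> by (auto simp: r)
  qed
  have nonneg: "0 \<le> val (c - \<rho>)" if "\<rho> \<in> R" for \<rho>
    using val_diff_ge[of c \<rho>] c assms(2)[OF that] by (auto simp: min_def split: if_splits)
  have "val (c - \<rho>) = 0" if "\<rho> \<in> R" for \<rho>
    using sum nonneg that by (simp add: sum_nonneg_eq_0_iff[OF assms(1)])
  then show ?thesis by blast
qed

end

section \<open>Lifting tropical points to linear spaces\<close>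

context alg_closed_valuation
begin

text \<open>For \<open>val c = 0\<close>, the value of \<open>v f + c * v' f\<close> can exceed
  \<open>w f\<close> only where both terms attain a finite \<open>w f\<close> and cancel in the
  residue field. So \<open>c\<close> has to avoid finitely many residues, and 0 is put among them to
  make \<open>c\<close> a unit.\<close>

lemma ex_generic_combination:
  assumes "finite F"
    and v: "\<And>f. f \<in> F \<Longrightarrow> val (v f) \<ge> w f"
    and v': "\<And>f. f \<in> F \<Longrightarrow> val (v' f) \<ge> w f"
    and eq: "\<And>f. f \<in> F \<Longrightarrow> val (v f) = w f \<or> val (v' f) = w f"
  shows "\<exists>c. val c = 0 \<and> (\<forall>f\<in>F. val (v f + c * v' f) = w f)"
proof -
  define F' where "F' = {f \<in> F. val (v f) = w f \<and> val (v' f) = w f \<and> w f \<noteq> \<infinity>}"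
  define R where "R = insert 0 ((\<lambda>f. - v f * inverse (v' f)) ` F')"
  have R: "0 \<le> val \<rho>" if \<rho>: "\<rho> \<in> R" for \<rho>
  proof (cases "\<rho> = 0")
    case False
    then obtain f where f: "f \<in> F'" "\<rho> = - v f * inverse (v' f)" using \<rho> R_def by auto
    have "v' f \<noteq> 0" using f(1) unfolding F'_def by (auto simp flip: val_eq_PInf)
    then have "val \<rho> = val (v f) + - val (v' f)" using f(2) by (simp add: val_mult val_inverse)
    then show ?thesis using f(1) val_not_MInf(1)[of "v f"] unfolding F'_def
      by (cases "w f") auto
  qed simp
  have "finite R" unfolding R_def F'_def using assms(1) by simp
  moreover have "R \<noteq> {}" unfolding R_def by simp
  ultimately obtain c where "\<forall>\<rho>\<in>R. val (c - \<rho>) = 0"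
    using ex_unit_avoiding_residues[of R, OF _ R] by blast
  then have c: "\<And>\<rho>. \<rho> \<in> R \<Longrightarrow> val (c - \<rho>) = 0" by blast
  have c0: "val c = 0" using c[of 0] by (simp add: R_def)
  have "val (v f + c * v' f) = w f" if f: "f \<in> F" for f
  proof -
    have cv: "val (c * v' f) = val (v' f)" by (simp add: val_mult c0)
    consider "w f = \<infinity>" | "val (v f) < val (v' f)" "val (v f) = w f" "w f \<noteq> \<infinity>"
      | "val (v' f) < val (v f)" "val (v' f) = w f" "w f \<noteq> \<infinity>" | "f \<in> F'"
      using v[OF f] v'[OF f] eq[OF f] f unfolding F'_def by fastforce
    then show ?thesis
    proof cases
      case 1
      then show ?thesis using v[OF f] v'[OF f] by simp
    next
      case 2
      then show ?thesis using val_add_eq[of "v f" "c * v' f"] by (simp add: cv)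
    next
      case 3
      then show ?thesis using val_add_eq[of "c * v' f" "v f"] by (simp add: cv add.commute)
    next
      case 4
      then have "v' f \<noteq> 0" unfolding F'_def by (auto simp flip: val_eq_PInf)
      then have "v f + c * v' f = (c - (- v f * inverse (v' f))) * v' f"
        by (simp add: field_simps)
      then have "val (v f + c * v' f) = val (c - (- v f * inverse (v' f))) + val (v' f)"
        by (simp only: val_mult)
      also have "\<dots> = w f" using c[of "- v f * inverse (v' f)"] 4 unfolding R_def F'_def by auto
      finally show ?thesis .
    qed
  qed
  then show ?thesis using c0 by blast
qed

text \<open>\<open>W\<close> is a linear space with valuated matroid \<open>N\<close>. For each coordinate \<open>e\<close> with
  \<open>w e < \<infinity>\<close>, a basis \<open>B \<ni> e\<close> that has as many elements as possible in \<open>{f. w f = \<infinity>}\<close> and then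
  minimizes \<open>N B - \<Sum>b\<in>B. w b\<close> gives a vector of \<open>W\<close> that is exact at \<open>e\<close> and bounded below by
  \<open>w\<close>; a generic combination of these vectors is exact everywhere.\<close>

lemma tropical_point_lift:
  fixes N :: "'e set \<Rightarrow> ereal" and w :: "'e \<Rightarrow> ereal" and W :: "('e \<Rightarrow> 'k) set"
  assumes E: "finite E"
    and W0: "(\<lambda>_. 0) \<in> W"
    and W: "\<And>v v' c. v \<in> W \<Longrightarrow> v' \<in> W \<Longrightarrow> (\<lambda>f. v f + c * v' f) \<in> W"
    and ex: "\<exists>B\<subseteq>E. card B = r \<and> N B \<noteq> \<infinity>"
    and N: "\<And>B. B \<subseteq> E \<Longrightarrow> card B = r \<Longrightarrow> N B \<noteq> -\<infinity>"
    and vec: "\<And>B e. B \<subseteq> E \<Longrightarrow> card B = r \<Longrightarrow> N B \<noteq> \<infinity> \<Longrightarrow> e \<in> B \<Longrightarrow>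
      \<exists>v\<in>W. \<forall>f\<in>E. val (v f) = (if f \<in> B - {e} then \<infinity> else N (insert f (B - {e})))"
    and w: "\<And>e. e \<in> E \<Longrightarrow> w e \<noteq> -\<infinity>"
    and circ: "\<And>J. J \<subseteq> E \<Longrightarrow> card J = Suc r \<Longrightarrow> trop_vanishes (\<lambda>j. w j + N (J - {j})) J"
  shows "\<exists>v\<in>W. \<forall>e\<in>E. val (v e) = w e"
proof -
  define Z where "Z = {e \<in> E. w e = \<infinity>}"
  define \<B> where "\<B> = {B. B \<subseteq> E \<and> card B = r \<and> N B \<noteq> \<infinity>}"
  define m where "m = Max ((\<lambda>B. card (B \<inter> Z)) ` \<B>)"
  define \<M> where "\<M> = {B \<in> \<B>. card (B \<inter> Z) = m}"
  \<comment> \<open>The sum leaves out \<open>Z\<close>, where \<open>w\<close> is infinite; that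
    part of a basis is controlled by \<open>m\<close> instead.\<close>
  define \<Phi> where "\<Phi> B = real_of_ereal (N B) - (\<Sum>b\<in>B - Z. real_of_ereal (w b))" for B
  have fin\<B>: "finite \<B>" unfolding \<B>_def using E by simp
  have ne\<B>: "\<B> \<noteq> {}" using ex \<B>_def by auto
  have finB: "finite B" if "B \<in> \<B>" for B using that E finite_subset \<B>_def by auto
  have mge: "card (B \<inter> Z) \<le> m" if "B \<in> \<B>" for B unfolding m_def using fin\<B> that by auto
  have "m \<in> (\<lambda>B. card (B \<inter> Z)) ` \<B>" unfolding m_def using fin\<B> ne\<B> by (intro Max_in) auto
  then have ne\<M>: "\<M> \<noteq> {}" unfolding \<M>_def by auto
  have fin\<M>: "finite \<M>" unfolding \<M>_def using fin\<B> by simp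
  obtain B0 where B0: "B0 \<in> \<M>" "\<And>B. B \<in> \<M> \<Longrightarrow> \<Phi> B0 \<le> \<Phi> B"
    using ex_min_if_finite[of "\<Phi> ` \<M>"] fin\<M> ne\<M> by (metis (mono_tags) finite_imageI image_iff image_is_empty not_less)
  have Nreal: "N B = ereal (real_of_ereal (N B))" if "B \<in> \<B>" for B
    using that N unfolding \<B>_def by (cases "N B") auto
  have wreal: "w e = ereal (real_of_ereal (w e))" if "e \<in> E - Z" for e
    using that w unfolding Z_def by (cases "w e") auto
  \<comment> \<open>The circuit relation on \<open>insert e B0\<close> exchanges some
    \<open>j\<close> for \<open>e\<close> without loss. The term of \<open>j\<close> is finite, so
    \<open>j\<close> lies outside \<open>Z\<close> and the intersection with \<open>Z\<close> stays
    maximal.\<close>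
  have opt_containing: "\<exists>B\<in>\<M>. e \<in> B \<and> (\<forall>B'\<in>\<M>. \<Phi> B \<le> \<Phi> B')" if e: "e \<in> E - Z" for e
  proof (cases "e \<in> B0")
    case False
    define J where "J = insert e B0"
    have B0\<B>: "B0 \<in> \<B>" using B0(1) \<M>_def by simp
    have J: "J \<subseteq> E" "card J = Suc r" "J - {e} = B0"
      using e False B0\<B> finB[OF B0\<B>] unfolding J_def \<B>_def by auto
    have fin: "w e + N (J - {e}) \<noteq> \<infinity>"
      using wreal[OF e] Nreal[OF B0\<B>] J(3) by (metis PInfty_neq_ereal(2) plus_ereal.simps(1) ereal.distinct(1))
    obtain j where j: "j \<in> J" "j \<noteq> e" "w j + N (J - {j}) \<le> w e + N (J - {e})"
      using trop_vanishesD[OF circ[OF J(1,2)], of e] fin unfolding J_def by auto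
    define B where "B = J - {j}"
    have "w j + N B \<noteq> \<infinity>" using j fin B_def by auto
    then have wj: "j \<in> E - Z" and NB: "N B \<noteq> \<infinity>"
      using j J(1) unfolding Z_def by auto
    have B\<B>: "B \<in> \<B>" using J j(1) NB finite_subset[OF J(1) E] unfolding \<B>_def B_def by auto
    have jB0: "j \<in> B0" using j unfolding J_def by auto
    have "B \<inter> Z = B0 \<inter> Z" using wj e unfolding B_def J_def by auto
    then have BM: "B \<in> \<M>" using B\<B> B0(1) unfolding \<M>_def by simp
    have "B - Z = insert e (B0 - Z - {j})" using e wj jB0 False unfolding B_def J_def by auto
    moreover have "e \<notin> B0 - Z - {j}" using False by auto
    ultimately have "(\<Sum>b\<in>B - Z. real_of_ereal (w b))
        = (\<Sum>b\<in>B0 - Z. real_of_ereal (w b)) - real_of_ereal (w j) + real_of_ereal (w e)"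
      using jB0 wj finB[OF B0\<B>] by (simp add: sum_diff1)
    moreover have "real_of_ereal (w j) + real_of_ereal (N B) \<le> real_of_ereal (w e) + real_of_ereal (N B0)"
    proof -
      have "ereal (real_of_ereal (w j)) + ereal (real_of_ereal (N B))
          \<le> ereal (real_of_ereal (w e)) + ereal (real_of_ereal (N B0))"
        using j(3) unfolding J(3) B_def[symmetric]
        using wreal[OF wj] wreal[OF e] Nreal[OF B\<B>] Nreal[OF B0\<B>] by metis
      then show ?thesis by simp
    qed
    ultimately have "\<Phi> B \<le> \<Phi> B0" unfolding \<Phi>_def by simp
    moreover have "e \<in> B" using j unfolding B_def J_def by auto
    ultimately show ?thesis using BM B0(2) by (meson order_trans)
  qed (use B0 in blast)
  \<comment> \<open>The vector that vanishes on \<open>B - {e}\<close> is scaled to be exact at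
    \<open>e\<close>. It vanishes on \<open>Z\<close>, since exchanging \<open>e\<close> for an
    element of \<open>Z\<close> would enlarge the maximal intersection; elsewhere its lower bound is
    the minimality of \<open>\<Phi> B\<close>.\<close>
  have exact: "\<exists>v\<in>W. val (v e) = w e \<and> (\<forall>f\<in>E. w f \<le> val (v f))" if e: "e \<in> E - Z" for e
  proof -
    obtain B where B: "B \<in> \<M>" "e \<in> B" "\<And>B'. B' \<in> \<M> \<Longrightarrow> \<Phi> B \<le> \<Phi> B'"
      using opt_containing[OF e] by blast
    have B\<B>: "B \<in> \<B>" using B(1) \<M>_def by simp
    obtain v where v: "v \<in> W"
      "\<And>f. f \<in> E \<Longrightarrow> val (v f) = (if f \<in> B - {e} then \<infinity> else N (insert f (B - {e})))"
      using vec[of B e] B\<B> B(2) unfolding \<B>_def by auto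
    obtain c where c: "val c = w e - N B"
      using ex_val[of "w e - N B"] wreal[OF e] Nreal[OF B\<B>]
      by (metis ereal_minus(1) MInfty_neq_ereal(2))
    define t where "t = real_of_ereal (w e) - real_of_ereal (N B)"
    have c: "val c = ereal t"
      unfolding c t_def using wreal[OF e] Nreal[OF B\<B>] by (metis ereal_minus(1))
    have ve: "val (c * v e) = w e"
    proof -
      have "val (c * v e) = ereal t + N B"
        using v(2)[of e] e B(2) by (simp add: val_mult c insert_absorb)
      also have "\<dots> = w e" unfolding t_def using wreal[OF e] Nreal[OF B\<B>]
        by (metis diff_add_cancel plus_ereal.simps(1))
      finally show ?thesis .
    qed
    have "w f \<le> val (c * v f)" if f: "f \<in> E" for f
    proof (cases "f \<in> B - {e} \<or> N (insert f (B - {e})) = \<infinity>")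
      case True
      then have "val (v f) = \<infinity>" using v(2)[OF f] by auto
      then show ?thesis by simp
    next
      case fB: False
      show ?thesis
      proof (cases "f = e")
        case False
        define B' where "B' = insert f (B - {e})"
        have "card B' = card B" unfolding B'_def using fB False B(2) finB[OF B\<B>]
          by (metis Diff_iff card_Suc_Diff1 card_insert_disjoint finite_Diff singleton_iff)
        then have B'\<B>: "B' \<in> \<B>" using fB f B\<B> unfolding \<B>_def B'_def by auto
        have fZ: "f \<notin> Z"
        proof
          assume "f \<in> Z"
          then have "B' \<inter> Z = insert f (B \<inter> Z)" using e unfolding B'_def by auto
          moreover have "f \<notin> B \<inter> Z" using fB False by auto
          ultimately have "card (B' \<inter> Z) = Suc m"
            using B(1) finB[OF B\<B>] unfolding \<M>_def by simp
          then show False using mge[OF B'\<B>] by simp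
        qed
        have "B' \<inter> Z = B \<inter> Z" using fZ e unfolding B'_def by auto
        then have "B' \<in> \<M>" using B'\<B> B(1) unfolding \<M>_def by simp
        then have "\<Phi> B \<le> \<Phi> B'" using B(3) by simp
        moreover have "B' - Z = insert f (B - Z - {e})" using fZ unfolding B'_def by auto
        moreover have "f \<notin> B - Z - {e}" using fB by auto
        ultimately have le: "real_of_ereal (N B) + real_of_ereal (w f) \<le> real_of_ereal (N B') + real_of_ereal (w e)"
          using B(2) e finB[OF B\<B>] unfolding \<Phi>_def by (simp add: sum_diff1)
        have "val (c * v f) = ereal t + N B'"
          using v(2)[OF f] fB unfolding B'_def by (auto simp: val_mult c)
        also have "\<dots> = ereal (t + real_of_ereal (N B'))" using Nreal[OF B'\<B>] by (metis plus_ereal.simps(1))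
        also have "\<dots> \<ge> ereal (real_of_ereal (w f))" using le unfolding t_def by simp
        finally show ?thesis using wreal[of f] f fZ by simp
      qed (use ve in simp)
    qed
    moreover have "(\<lambda>f. c * v f) \<in> W" using W[OF W0 v(1), of c] by simp
    ultimately show ?thesis using ve by (intro bexI[of _ "\<lambda>f. c * v f"]) auto
  qed
  \<comment> \<open>The lower bound is carried along on all of \<open>E\<close>, not only on
    \<open>F\<close>: on \<open>Z\<close> it already says that the vector vanishes.\<close>
  have "\<exists>v\<in>W. (\<forall>f\<in>E. w f \<le> val (v f)) \<and> (\<forall>e\<in>F. val (v e) = w e)" if "finite F" "F \<subseteq> E - Z" for F
    using that
  proof (induction F)
    case empty
    show ?case using W0 by (intro bexI[of _ "\<lambda>_. 0"]) auto
  next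
    case (insert e F)
    then obtain v where v: "v \<in> W" "\<forall>f\<in>E. w f \<le> val (v f)" "\<forall>f\<in>F. val (v f) = w f" by auto
    obtain v' where v': "v' \<in> W" "val (v' e) = w e" "\<forall>f\<in>E. w f \<le> val (v' f)"
      using exact[of e] insert.prems by auto
    obtain c where c: "val c = 0" "\<forall>f\<in>insert e F. val (v f + c * v' f) = w f"
      using ex_generic_combination[of "insert e F" w v v'] insert v v' by blast
    have "w f \<le> val (v f + c * v' f)" if "f \<in> E" for f
      using val_add_ge[of "v f" "c * v' f"] v(2) v'(3) that c(1)
      by (fastforce simp: val_mult min_def split: if_splits)
    with W[OF v(1) v'(1), of c] c(2) show ?case by (intro bexI[of _ "\<lambda>f. v f + c * v' f"]) auto
  qed
  from this[of "E - Z"] obtain v where v: "v \<in> W" "\<forall>f\<in>E. w f \<le> val (v f)" "\<forall>e\<in>E - Z. val (v e) = w e"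
    using E by auto
  have "\<forall>e\<in>E. val (v e) = w e"
  proof
    fix e assume "e \<in> E"
    then show "val (v e) = w e" using v by (cases "e \<in> Z") (auto simp: Z_def)
  qed
  then show ?thesis using v(1) by blast
qed

end

section \<open>Maximal minors\<close>

definition minor :: "'a::comm_ring_1 mat \<Rightarrow> nat set \<Rightarrow> 'a" where
  "minor A I = det (submatrix A UNIV I)"

definition cols_mat :: "'a mat \<Rightarrow> nat list \<Rightarrow> 'a mat" where
  "cols_mat A js = mat (dim_row A) (length js) (\<lambda>(i,j). A $$ (i, js ! j))"

lemma cols_mat_carrier [simp]: "cols_mat A js \<in> carrier_mat (dim_row A) (length js)"
  by (simp add: cols_mat_def)

lemma submatrix_eq_cols_mat:
  assumes "I \<subseteq> {..<dim_col A}"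
  shows "submatrix A UNIV I = cols_mat A (map (pick I) [0..<card I])"
proof -
  have "{j. j < dim_col A \<and> j \<in> I} = I" using assms by auto
  then show ?thesis unfolding submatrix_def cols_mat_def by (intro eq_matI) (auto simp: pick_UNIV)
qed

text \<open>The sign of the permutation that sorts \<open>js\<close> is left open, since every
  valuation forgets it. Free order of the columns lets Laplace expansions put a distinguished column
  last.\<close>

lemma det_cols_mat:
  assumes js: "distinct js" "set js \<subseteq> {..<dim_col A}" "length js = dim_row A"
  shows "det (cols_mat A js) = minor A (set js) \<or> det (cols_mat A js) = - minor A (set js)"
proof -
  define r where "r = dim_row A"
  define ks where "ks = map (pick (set js)) [0..<r]"
  have card: "card (set js) = r" using js by (simp add: distinct_card r_def)
  have mono: "pick (set js) i < pick (set js) j" if "i < j" "j < r" for i j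
    using pick_mono_le[of j "set js" i] that card by simp
  have "distinct ks" unfolding ks_def distinct_conv_nth
    using mono by simp (metis nat_neq_iff)
  moreover have "set ks \<subseteq> set js" unfolding ks_def using pick_in_set_le[of _ "set js"] card by auto
  moreover have "card (set ks) = card (set js)" using distinct_card[OF \<open>distinct ks\<close>] card by (simp add: ks_def)
  ultimately have "set ks = set js" by (simp add: card_subset_eq)
  with \<open>distinct ks\<close> js(1) have "mset js = mset ks" by (simp add: set_eq_iff_mset_eq_distinct)
  then obtain p where p: "p permutes {..<length ks}" "permute_list p ks = js"
    using mset_eq_permutation by blast
  have len: "length ks = r" by (simp add: ks_def)
  have p': "p permutes {0..<r}" using p(1) by (simp add: len atLeast0LessThan)
  have pr: "p i < r" if "i < r" for i using permutes_in_image[OF p', of i] that by simp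
  let ?K = "cols_mat A ks"
  have K: "?K \<in> carrier_mat r r" using cols_mat_carrier[of A ks] by (simp add: len r_def)
  have J: "cols_mat A js \<in> carrier_mat r r" using cols_mat_carrier[of A js] js by (simp add: r_def)
  have "transpose_mat (cols_mat A js) = mat r r (\<lambda>(i,j). transpose_mat ?K $$ (p i, j))"
    using js(3) permute_list_nth[OF p(1)] p(2) pr
    by (intro eq_matI) (auto simp: cols_mat_def len r_def)
  then have "det (cols_mat A js) = signof p * det ?K"
    using det_permute_rows[of "transpose_mat ?K" r p] p' K det_transpose[OF J] det_transpose[OF K] by simp
  moreover have "det ?K = minor A (set js)"
    unfolding minor_def using submatrix_eq_cols_mat[OF js(2)] by (simp add: ks_def card)
  moreover have "signof p = (1::'a) \<or> signof p = (-1::'a)" by (simp add: sign_def)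
  ultimately show ?thesis by auto
qed

text \<open>The coefficients are the cofactors along the last column of the matrix with columns
  \<open>I\<close> followed by \<open>f\<close>; they do not involve \<open>f\<close>, and the
  combination at \<open>f\<close> is the determinant. The last coefficient is a minor of the first
  \<open>s\<close> rows, which drives the induction in
  \<open>rows_independent_imp_minor_neq_0\<close>.\<close>

lemma ex_cocircuit_vector:
  fixes A :: "'a::comm_ring_1 mat"
  assumes A: "A \<in> carrier_mat (Suc s) n" and I: "I \<subseteq> {..<n}" "card I = s"
  shows "\<exists>x. (\<forall>f\<in>I. (\<Sum>i<Suc s. x i * A $$ (i,f)) = 0) \<and>
    (\<forall>f\<in>{..<n} - I. (\<Sum>i<Suc s. x i * A $$ (i,f)) = minor A (insert f I) \<or>
       (\<Sum>i<Suc s. x i * A $$ (i,f)) = - minor A (insert f I)) \<and>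
    (x s = minor (mat s n (\<lambda>ij. A $$ ij)) I \<or> x s = - minor (mat s n (\<lambda>ij. A $$ ij)) I)"
proof -
  define js where "js = sorted_list_of_set I"
  have finI: "finite I" using I finite_subset by blast
  have js: "distinct js" "set js = I" "length js = s" using finI I by (auto simp: js_def)
  define M where "M f = cols_mat A (js @ [f])" for f
  have M: "M f \<in> carrier_mat (Suc s) (Suc s)" for f
    using cols_mat_carrier[of A "js @ [f]"] A js by (simp add: M_def)
  \<comment> \<open>The column 0 is a placeholder: these cofactors delete it.\<close>
  define x where "x i = cofactor (M 0) i s" for i
  have del: "mat_delete (M f) i s = mat_delete (M 0) i s" if "i < Suc s" for f i
    using that A js by (intro eq_matI) (auto simp: mat_delete_def M_def cols_mat_def nth_append)
  have sum: "(\<Sum>i<Suc s. x i * A $$ (i,f)) = det (M f)" for f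
  proof -
    have "det (M f) = (\<Sum>i<Suc s. M f $$ (i,s) * cofactor (M f) i s)"
      by (rule laplace_expansion_column[OF M]) simp
    also have "\<dots> = (\<Sum>i<Suc s. x i * A $$ (i,f))"
    proof (rule sum.cong[OF refl])
      fix i assume i: "i \<in> {..<Suc s}"
      then have "M f $$ (i,s) = A $$ (i,f)" using A js by (simp add: M_def cols_mat_def nth_append)
      moreover have "cofactor (M f) i s = x i" using del[of i f] i by (simp add: x_def cofactor_def)
      ultimately show "M f $$ (i,s) * cofactor (M f) i s = x i * A $$ (i,f)" by simp
    qed
    finally show ?thesis by simp
  qed
  have zero: "det (M f) = 0" if f: "f \<in> I" for f
  proof -
    obtain k where k: "k < s" "js ! k = f" using f js by (metis in_set_conv_nth)
    have "col (M f) k = col (M f) s"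
      using k A js by (intro eq_vecI) (auto simp: M_def cols_mat_def nth_append)
    then show ?thesis using det_identical_columns[OF M, of k s f] k by simp
  qed
  have mnr: "det (M f) = minor A (insert f I) \<or> det (M f) = - minor A (insert f I)" if "f \<in> {..<n} - I" for f
    using det_cols_mat[of "js @ [f]" A] that js A I by (auto simp: M_def)
  let ?A = "mat s n (\<lambda>ij. A $$ ij)"
  have "mat_delete (M 0) s s = cols_mat ?A js"
    using A js I by (intro eq_matI) (auto simp: mat_delete_def M_def cols_mat_def nth_append subset_iff)
  then have "x s = det (cols_mat ?A js)" by (simp add: x_def cofactor_def)
  then have "x s = minor ?A I \<or> x s = - minor ?A I"
    using det_cols_mat[of js ?A] js I by simp
  then show ?thesis using sum zero mnr by (intro exI[of _ x]) simp
qed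

text \<open>Cramer's rule: appending a copy of row \<open>i\<close> below the columns
  \<open>J\<close> gives a singular square matrix, and expansion along the copy is the required
  relation.\<close>

lemma ex_circuit_vector:
  fixes A :: "'a::comm_ring_1 mat"
  assumes A: "A \<in> carrier_mat s n" and J: "J \<subseteq> {..<n}" "card J = Suc s"
  shows "\<exists>y. (\<forall>i<s. (\<Sum>j\<in>J. A $$ (i,j) * y j) = 0) \<and>
    (\<forall>j\<in>J. y j = minor A (J - {j}) \<or> y j = - minor A (J - {j}))"
proof -
  define js where "js = sorted_list_of_set J"
  have finJ: "finite J" using J finite_subset by blast
  have js: "distinct js" "set js = J" "length js = Suc s" using finJ J by (auto simp: js_def)
  define D where "D k = det (cols_mat A (take k js @ drop (Suc k) js))" for k
  have bij: "bij_betw ((!) js) {..<Suc s} J" using bij_betw_nth[of js] js by simp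
  define y where "y j = (-1) ^ (s + inv_into {..<Suc s} ((!) js) j) * D (inv_into {..<Suc s} ((!) js) j)" for j
  have y: "y (js ! k) = (-1) ^ (s + k) * D k" if "k < Suc s" for k
    using bij_betw_inv_into_left[OF bij, of k] that by (simp add: y_def)
  have "(\<Sum>j\<in>J. A $$ (i,j) * y j) = 0" if i: "i < s" for i
  proof -
    define M where "M = mat (Suc s) (Suc s) (\<lambda>(i',j). A $$ (if i' < s then i' else i, js ! j))"
    have M: "M \<in> carrier_mat (Suc s) (Suc s)" by (simp add: M_def)
    have "row M i = row M s" using i by (intro eq_vecI) (auto simp: M_def)
    then have "det M = 0" using det_identical_rows[OF M, of i s] i by simp
    moreover have "det M = (\<Sum>k<Suc s. M $$ (s,k) * cofactor M s k)"
      by (rule laplace_expansion_row[OF M]) simp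
    moreover have "\<dots> = (\<Sum>k<Suc s. A $$ (i, js ! k) * y (js ! k))"
    proof (rule sum.cong[OF refl])
      fix k assume k: "k \<in> {..<Suc s}"
      have "mat_delete M s k = cols_mat A (take k js @ drop (Suc k) js)"
        using k A js by (intro eq_matI) (auto simp: mat_delete_def M_def cols_mat_def nth_append)
      then have "cofactor M s k = y (js ! k)" using k y[of k] by (simp add: cofactor_def D_def)
      then show "M $$ (s,k) * cofactor M s k = A $$ (i, js ! k) * y (js ! k)" using k by (simp add: M_def)
    qed
    moreover have "\<dots> = (\<Sum>j\<in>J. A $$ (i,j) * y j)"
      using sum.reindex_bij_betw[OF bij, of "\<lambda>j. A $$ (i,j) * y j"] by simp
    ultimately show ?thesis by simp
  qed
  moreover have "y j = minor A (J - {j}) \<or> y j = - minor A (J - {j})" if j: "j \<in> J" for j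
  proof -
    obtain k where k: "k < Suc s" "js ! k = j" using j js by (metis in_set_conv_nth)
    let ?ks = "take k js @ drop (Suc k) js"
    have split: "js = take k js @ j # drop (Suc k) js" using k js(3) id_take_nth_drop by metis
    then have "distinct (take k js @ j # drop (Suc k) js)" using js(1) by simp
    then have ks: "distinct ?ks" "j \<notin> set ?ks" by auto
    have "J = set (take k js @ j # drop (Suc k) js)" using js(2) split by simp
    then have "set ?ks = J - {j}" using ks by auto
    then have "D k = minor A (J - {j}) \<or> D k = - minor A (J - {j})"
      using det_cols_mat[of ?ks A] ks A J k js(3) unfolding D_def by auto
    moreover have "y j = D k \<or> y j = - D k"
      using y[OF k(1)] k(2) by (cases "even (s + k)") auto
    ultimately show ?thesis by auto
  qed
  ultimately show ?thesis by blast
qed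

lemma minor_neq_0_imp_rows_independent:
  fixes A :: "'a::field mat"
  assumes A: "A \<in> carrier_mat r n" and I: "I \<subseteq> {..<n}" "card I = r" "minor A I \<noteq> 0"
    and x: "\<And>f. f < n \<Longrightarrow> (\<Sum>i<r. x i * A $$ (i,f)) = 0" and i: "i < r"
  shows "x i = 0"
proof (rule ccontr)
  assume nz: "x i \<noteq> 0"
  let ?S = "submatrix A UNIV I"
  have S: "?S = cols_mat A (map (pick I) [0..<r])"
    using submatrix_eq_cols_mat[of I A] A I by simp
  have Sc: "?S \<in> carrier_mat r r" unfolding S using A by (simp add: cols_mat_def)
  have "transpose_mat ?S *\<^sub>v vec r x = 0\<^sub>v r"
  proof (rule eq_vecI)
    fix j assume "j < dim_vec (0\<^sub>v r :: 'a vec)"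
    then have j: "j < r" by simp
    have "pick I j \<in> I" using pick_in_set_le[of j I] j I by simp
    then have "pick I j < n" using I by auto
    from x[OF this] show "(transpose_mat ?S *\<^sub>v vec r x) $ j = 0\<^sub>v r $ j"
      using j A Sc by (simp add: S cols_mat_def scalar_prod_def atLeast0LessThan mult.commute)
  qed (use Sc in simp)
  moreover have "vec r x \<noteq> 0\<^sub>v r" using nz i by (metis index_vec index_zero_vec(1))
  ultimately have "det (transpose_mat ?S) = 0"
    using det_0_iff_vec_prod_zero_field[of "transpose_mat ?S" r] Sc by (metis transpose_carrier_mat vec_carrier)
  then show False using I(3) det_transpose[OF Sc] by (simp add: minor_def)
qed

text \<open>Induction on the number of rows. A nonzero minor of the first \<open>s\<close> rows on
  \<open>I\<close> is, up to sign, the last coefficient of a cocircuit vector. By independence the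
  combination is nonzero at some \<open>f\<close>, which must lie outside \<open>I\<close>, and
  there its entry is the larger minor.\<close>

lemma rows_independent_imp_minor_neq_0:
  fixes A :: "'a::field mat"
  assumes "A \<in> carrier_mat r n"
    and "\<And>x i. (\<And>f. f < n \<Longrightarrow> (\<Sum>i<r. x i * A $$ (i,f)) = 0) \<Longrightarrow> i < r \<Longrightarrow> x i = 0"
  shows "\<exists>I\<in>nsets {..<n} r. minor A I \<noteq> 0"
  using assms
proof (induction r arbitrary: A)
  case 0
  have "submatrix A UNIV {} \<in> carrier_mat 0 0"
    using carrier_matD(1)[OF 0(1)] by (intro carrier_matI) (simp_all add: dim_submatrix)
  then have "minor A {} = 1" by (simp add: minor_def)
  then show ?case by (auto simp: nsets_def)
next
  case (Suc s)
  let ?A = "mat s n (\<lambda>ij. A $$ ij)"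
  have indep: "x i = 0" if x: "\<And>f. f < n \<Longrightarrow> (\<Sum>i<s. x i * ?A $$ (i,f)) = 0" and i: "i < s" for x i
  proof -
    have ext: "(\<Sum>i<Suc s. (if i = s then 0 else x i) * A $$ (i,f)) = 0" if "f < n" for f
    proof -
      have "(\<Sum>i<s. (if i = s then 0 else x i) * A $$ (i,f)) = (\<Sum>i<s. x i * ?A $$ (i,f))"
        using that by (intro sum.cong) auto
      then show ?thesis using x[OF that] by simp
    qed
    have "(\<lambda>i. if i = s then 0 else x i) i = 0"
      by (rule Suc.prems(2)[OF ext]) (use i in simp_all)
    then show ?thesis using i by simp
  qed
  have "\<exists>I\<in>nsets {..<n} s. minor ?A I \<noteq> 0"
  proof (rule Suc.IH)
    fix x i assume "\<And>f. f < n \<Longrightarrow> (\<Sum>i<s. x i * ?A $$ (i,f)) = 0" "i < s"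
    then show "x i = 0" by (rule indep)
  qed simp
  then obtain I where I: "I \<in> nsets {..<n} s" "minor ?A I \<noteq> 0" by blast
  then have I': "I \<subseteq> {..<n}" "card I = s" "finite I" by (auto simp: nsets_def)
  obtain x where x: "\<forall>f\<in>I. (\<Sum>i<Suc s. x i * A $$ (i,f)) = 0"
    "\<forall>f\<in>{..<n} - I. (\<Sum>i<Suc s. x i * A $$ (i,f)) = minor A (insert f I) \<or>
       (\<Sum>i<Suc s. x i * A $$ (i,f)) = - minor A (insert f I)"
    "x s = minor ?A I \<or> x s = - minor ?A I"
    using ex_cocircuit_vector[OF Suc.prems(1) I'(1,2)] by blast
  have "x s \<noteq> 0" using x(3) I(2) by auto
  then obtain f where f: "f < n" "(\<Sum>i<Suc s. x i * A $$ (i,f)) \<noteq> 0"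
    using Suc.prems(2)[OF _ lessI, of x] by blast
  then have "f \<notin> I" using x(1) by blast
  then have "minor A (insert f I) \<noteq> 0" using bspec[OF x(2), of f] f by auto
  moreover have "insert f I \<in> nsets {..<n} (Suc s)"
    using I' f \<open>f \<notin> I\<close> by (simp add: nsets_def)
  ultimately show ?case by blast
qed

section \<open>Points in row spaces and in kernels\<close>

text \<open>Among two or more terms an infinite one always has a partner, so the test need not
  distinguish finite terms.\<close>

lemma trop_vanishes_iff:
  assumes "finite X" "card X \<ge> 2"
  shows "trop_vanishes f X \<longleftrightarrow> (\<forall>i\<in>X. \<exists>j\<in>X. j \<noteq> i \<and> f j \<le> f i)"
proof
  assume v: "trop_vanishes f X"
  show "\<forall>i\<in>X. \<exists>j\<in>X. j \<noteq> i \<and> f j \<le> f i"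
  proof
    fix i assume i: "i \<in> X"
    show "\<exists>j\<in>X. j \<noteq> i \<and> f j \<le> f i"
    proof (cases "f i = \<infinity>")
      case True
      have "\<not> X \<subseteq> {i}" using card_mono[of "{i}" X] assms by auto
      then show ?thesis using True by auto
    qed (use trop_vanishesD[OF v i] in simp)
  qed
qed (use trop_vanishesI[OF _ assms(1)] in blast)

context valuation
begin

definition realizes :: "'k mat \<Rightarrow> nat \<Rightarrow> nat \<Rightarrow> (nat set \<Rightarrow> ereal) \<Rightarrow> bool" where
  "realizes A r n \<mu> \<longleftrightarrow> A \<in> carrier_mat r n \<and>
     (\<exists>c::real. \<forall>I\<in>nsets {..<n} r. \<mu> I = val (minor A I) + ereal c)"

lemma val_minor_set:
  assumes "A \<in> carrier_mat r n" "distinct js" "set js \<subseteq> {..<n}" "length js = r"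
  shows "val (minor A (set js)) = val (det (cols_mat A js))"
  using det_cols_mat[of js A] assms by auto

lemma realizes_imp_minor_neq_0:
  assumes "realizes A r n \<mu>" "I \<in> nsets {..<n} r" "\<mu> I \<noteq> \<infinity>"
  shows "minor A I \<noteq> 0"
  using assms unfolding realizes_def by auto

end

context alg_closed_valuation
begin

text \<open>The vectors that \<open>tropical_point_lift\<close> asks for are the cocircuit vectors
  of \<open>A\<close> for the sets \<open>B - {e}\<close>.\<close>

lemma row_space_lift:
  assumes A: "A \<in> carrier_mat s n" and ex: "\<exists>I\<in>nsets {..<n} s. minor A I \<noteq> 0"
    and w: "\<And>j. j < n \<Longrightarrow> w j \<noteq> -\<infinity>"
    and circ: "\<And>J. J \<in> nsets {..<n} (Suc s) \<Longrightarrow> trop_vanishes (\<lambda>j. w j + val (minor A (J - {j}))) J"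
  shows "\<exists>x. \<forall>j<n. val (\<Sum>i<s. x i * A $$ (i,j)) = w j"
proof -
  define W where "W = range (\<lambda>x j. \<Sum>i<s. x i * A $$ (i,j))"
  have "\<exists>v\<in>W. \<forall>e\<in>{..<n}. val (v e) = w e"
  proof (rule tropical_point_lift[where r = s and N = "\<lambda>I. val (minor A I)"])
    show "(\<lambda>_. 0) \<in> W" unfolding W_def by (rule range_eqI[of _ _ "\<lambda>_. 0"]) simp
    fix v v' c assume "v \<in> W" "v' \<in> W"
    then obtain x x' where "v = (\<lambda>j. \<Sum>i<s. x i * A $$ (i,j))" "v' = (\<lambda>j. \<Sum>i<s. x' i * A $$ (i,j))"
      unfolding W_def by auto
    then have "(\<lambda>f. v f + c * v' f) = (\<lambda>j. \<Sum>i<s. (x i + c * x' i) * A $$ (i,j))"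
      by (simp add: sum.distrib sum_distrib_left algebra_simps)
    then show "(\<lambda>f. v f + c * v' f) \<in> W" unfolding W_def
      using range_eqI[where f = "\<lambda>x j. \<Sum>i<s. x i * A $$ (i,j)" and x = "\<lambda>i. x i + c * x' i"] by simp
  next
    fix B e assume B: "B \<subseteq> {..<n}" "card B = s" "val (minor A B) \<noteq> \<infinity>" "e \<in> B"
    have finB: "finite B" using B finite_subset by blast
    define I where "I = B - {e}"
    obtain s' where s: "s = Suc s'" using B finB by (cases s) auto
    have I: "I \<subseteq> {..<n}" "card I = s'" unfolding I_def using B s by auto
    obtain x where x: "\<forall>f\<in>I. (\<Sum>i<s. x i * A $$ (i,f)) = 0"
      "\<forall>f\<in>{..<n} - I. (\<Sum>i<s. x i * A $$ (i,f)) = minor A (insert f I) \<or>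
       (\<Sum>i<s. x i * A $$ (i,f)) = - minor A (insert f I)"
      using ex_cocircuit_vector[OF A[unfolded s] I] unfolding s by blast
    have "val (\<Sum>i<s. x i * A $$ (i,f)) = (if f \<in> B - {e} then \<infinity> else val (minor A (insert f (B - {e}))))"
      if "f \<in> {..<n}" for f
    proof (cases "f \<in> I")
      case True
      then show ?thesis using x(1) unfolding I_def by simp
    next
      case False
      then have "f \<in> {..<n} - I" using that by simp
      from bspec[OF x(2) this] have "val (\<Sum>i<s. x i * A $$ (i,f)) = val (minor A (insert f I))"
        by (elim disjE) simp_all
      then show ?thesis using False by (simp only: I_def if_False)
    qed
    moreover have "(\<lambda>f. \<Sum>i<s. x i * A $$ (i,f)) \<in> W" unfolding W_def by (rule rangeI)
    ultimately show "\<exists>v\<in>W. \<forall>f\<in>{..<n}. val (v f) = (if f \<in> B - {e} then \<infinity> else val (minor A (insert f (B - {e}))))"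
      by (intro bexI ballI)
  next
    fix J assume "J \<subseteq> {..<n}" "card J = Suc s"
    then show "trop_vanishes (\<lambda>j. w j + val (minor A (J - {j}))) J"
      by (intro circ) (auto simp: nsets_def intro: finite_subset)
  qed (use ex w in \<open>auto simp: nsets_def\<close>)
  then show ?thesis unfolding W_def by auto
qed

text \<open>The kernel carries the dual valuated matroid, whose value on \<open>C\<close> is the
  minor on the complement of \<open>C\<close>. Its vectors are the circuit vectors of
  \<open>A\<close>, and its circuit relations are the cocircuit relations of \<open>A\<close>,
  indexed by complements.\<close>

lemma kernel_lift:
  assumes A: "A \<in> carrier_mat s n" and ex: "\<exists>I\<in>nsets {..<n} s. minor A I \<noteq> 0"
    and w: "\<And>j. j < n \<Longrightarrow> w j \<noteq> -\<infinity>"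
    and cocirc: "\<And>I. I \<subseteq> {..<n} \<Longrightarrow> Suc (card I) = s \<Longrightarrow>
      trop_vanishes (\<lambda>j. val (minor A (insert j I)) + w j) ({..<n} - I)"
  shows "\<exists>y. (\<forall>i<s. (\<Sum>j<n. A $$ (i,j) * y j) = 0) \<and> (\<forall>j<n. val (y j) = w j)"
proof -
  define W where "W = {y. \<forall>i<s. (\<Sum>j<n. A $$ (i,j) * y j) = 0}"
  let ?E = "{..<n}"
  obtain I0 where I0: "I0 \<subseteq> ?E" "card I0 = s" "minor A I0 \<noteq> 0" using ex by (auto simp: nsets_def)
  have sn: "s \<le> n" using card_mono[OF _ I0(1)] I0(2) by simp
  have compl: "card (?E - B) = n - card B" if "B \<subseteq> ?E" for B
    using that by (simp add: card_Diff_subset finite_subset)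
  have "\<exists>v\<in>W. \<forall>e\<in>?E. val (v e) = w e"
  proof (rule tropical_point_lift[where r = "n - s" and N = "\<lambda>C. val (minor A (?E - C))"])
    show "(\<lambda>_. 0) \<in> W" unfolding W_def by simp
    show "\<exists>B\<subseteq>?E. card B = n - s \<and> val (minor A (?E - B)) \<noteq> \<infinity>"
      using I0 compl[OF I0(1)] by (intro exI[of _ "?E - I0"]) (simp add: double_diff)
    fix v v' c assume v: "v \<in> W" "v' \<in> W"
    show "(\<lambda>f. v f + c * v' f) \<in> W" unfolding W_def
    proof (intro CollectI allI impI)
      fix i assume i: "i < s"
      have "(\<Sum>j<n. A $$ (i,j) * (v j + c * v' j))
          = (\<Sum>j<n. A $$ (i,j) * v j) + c * (\<Sum>j<n. A $$ (i,j) * v' j)"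
        by (simp add: sum.distrib sum_distrib_left algebra_simps)
      then show "(\<Sum>j<n. A $$ (i,j) * (v j + c * v' j)) = 0" using v i unfolding W_def by simp
    qed
  next
    fix C e assume C: "C \<subseteq> ?E" "card C = n - s" "val (minor A (?E - C)) \<noteq> \<infinity>" "e \<in> C"
    define J where "J = insert e (?E - C)"
    have J: "J \<subseteq> ?E" "card J = Suc s" unfolding J_def using C compl[OF C(1)] sn by auto
    obtain y where y: "\<forall>i<s. (\<Sum>j\<in>J. A $$ (i,j) * y j) = 0"
      "\<forall>j\<in>J. y j = minor A (J - {j}) \<or> y j = - minor A (J - {j})"
      using ex_circuit_vector[OF A J] by blast
    let ?y = "\<lambda>j. if j \<in> J then y j else 0"
    have "(\<Sum>j<n. A $$ (i,j) * ?y j) = (\<Sum>j\<in>J. A $$ (i,j) * y j)" for i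
      using J(1) by (intro sum.mono_neutral_cong_right) auto
    then have "?y \<in> W" unfolding W_def using y(1) by simp
    moreover have "val (?y f) = (if f \<in> C - {e} then \<infinity> else val (minor A (?E - insert f (C - {e}))))"
      if f: "f \<in> ?E" for f
    proof (cases "f \<in> C - {e}")
      case True
      then show ?thesis unfolding J_def by auto
    next
      case False
      then have fJ: "f \<in> J" using f unfolding J_def by auto
      have eq: "?E - insert f (C - {e}) = J - {f}" using C f False unfolding J_def by auto
      have "val (y f) = val (minor A (J - {f}))" using bspec[OF y(2) fJ] by (elim disjE) simp_all
      then show ?thesis by (simp only: eq fJ False if_True if_False)
    qed
    ultimately show "\<exists>v\<in>W. \<forall>f\<in>?E. val (v f) = (if f \<in> C - {e} then \<infinity> else val (minor A (?E - insert f (C - {e}))))"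
      by (intro bexI[of _ ?y]) auto
  next
    fix J assume J: "J \<subseteq> ?E" "card J = Suc (n - s)"
    have "card J \<le> n" using card_mono[OF _ J(1)] by simp
    then have "trop_vanishes (\<lambda>j. val (minor A (insert j (?E - J))) + w j) (?E - (?E - J))"
      using J compl[OF J(1)] sn by (intro cocirc) auto
    moreover have "?E - (?E - J) = J" using J by auto
    moreover have "insert j (?E - J) = ?E - (J - {j})" if "j \<in> J" for j using that J by auto
    ultimately show "trop_vanishes (\<lambda>j. w j + val (minor A (?E - (J - {j})))) J"
      by (subst trop_vanishes_cong[of _ _ "\<lambda>j. val (minor A (insert j (?E - J))) + w j"]) (simp_all add: add.commute)
  qed (use w in auto)
  then show ?thesis unfolding W_def by auto
qed

text \<open>In rank 1 the set \<open>I\<close> of an incidence relation is empty, and what remains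
  are the circuit relations of the row space of \<open>B\<close> for the tropical point
  \<open>\<mu>\<close>.\<close>

lemma realize_rank_1_below:
  assumes B: "realizes B s n \<nu>" and \<nu>: "\<exists>I\<in>nsets {..<n} s. \<nu> I \<noteq> \<infinity>"
    and \<mu>: "\<mu> \<in> nsets {..<n} 1 \<rightarrow> TT" and inc: "trop_incidence_plucker n 1 s \<mu> \<nu>"
  shows "\<exists>A. realizes A 1 n \<mu> \<and> (\<exists>X\<in>carrier_mat 1 s. A = X * B)"
proof -
  obtain c where Bc: "B \<in> carrier_mat s n" and c: "\<And>I. I \<in> nsets {..<n} s \<Longrightarrow> \<nu> I = val (minor B I) + ereal c"
    using B unfolding realizes_def by blast
  have sing: "{j} \<in> nsets {..<n} 1" if "j < n" for j using that by (simp add: nsets_def)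
  have "\<exists>x. \<forall>j<n. val (\<Sum>i<s. x i * B $$ (i,j)) = \<mu> {j}"
  proof (rule row_space_lift[OF Bc])
    show "\<exists>I\<in>nsets {..<n} s. minor B I \<noteq> 0" using \<nu> realizes_imp_minor_neq_0[OF B] by blast
    show "\<mu> {j} \<noteq> -\<infinity>" if "j < n" for j using \<mu> sing[OF that] unfolding TT_def by blast
    fix J assume J: "J \<in> nsets {..<n} (Suc s)"
    then have "trop_vanishes (\<lambda>j. \<mu> {j} + \<nu> (J - {j})) J"
      using inc[unfolded trop_incidence_plucker_def, rule_format, of "{}" J] by simp
    moreover have "\<nu> (J - {j}) = val (minor B (J - {j})) + ereal c" if "j \<in> J" for j
      using J that by (intro c) (auto simp: nsets_def)
    ultimately have "trop_vanishes (\<lambda>j. (\<mu> {j} + val (minor B (J - {j}))) + ereal c) J"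
      by (subst (asm) trop_vanishes_cong[of J _ "\<lambda>j. (\<mu> {j} + val (minor B (J - {j}))) + ereal c"])
         (simp_all add: add.assoc)
    then show "trop_vanishes (\<lambda>j. \<mu> {j} + val (minor B (J - {j}))) J"
      by (simp only: trop_vanishes_add_real_iff)
  qed
  then obtain x where x: "\<And>j. j < n \<Longrightarrow> val (\<Sum>i<s. x i * B $$ (i,j)) = \<mu> {j}" by blast
  define X where "X = mat 1 s (\<lambda>(_,i). x i)"
  have X: "X \<in> carrier_mat 1 s" by (simp add: X_def)
  have XB: "X * B \<in> carrier_mat 1 n" using X Bc by simp
  have "val (minor (X * B) I) = \<mu> I" if I: "I \<in> nsets {..<n} 1" for I
  proof -
    obtain j where j: "I = {j}" "j < n" using I unfolding nsets_def by (auto simp: card_1_singleton_iff)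
    have "val (minor (X * B) (set [j])) = val (det (cols_mat (X * B) [j]))"
      using j by (intro val_minor_set[OF XB]) auto
    also have "det (cols_mat (X * B) [j]) = (\<Sum>i<s. x i * B $$ (i,j))"
      using j X Bc by (subst det_single) (auto simp: cols_mat_def X_def scalar_prod_def atLeast0LessThan)
    finally show ?thesis using x j by simp
  qed
  then have "realizes (X * B) 1 n \<mu>" unfolding realizes_def using XB by (intro conjI exI[of _ 0]) auto
  then show ?thesis using X by blast
qed

text \<open>The hyperplane \<open>{v. \<Sum>j<n. v j * y j = 0}\<close> has the basis \<open>e\<^sub>k - (y k / y p) e\<^sub>p\<close>, \<open>k \<noteq> p\<close>.\<close>

lemma realize_corank_1_above:
  assumes A: "realizes A s n \<mu>" and \<mu>: "\<exists>I\<in>nsets {..<n} s. \<mu> I \<noteq> \<infinity>" and n: "n = Suc m"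
    and \<eta>: "\<eta> \<in> nsets {..<n} m \<rightarrow> TT" "\<exists>I\<in>nsets {..<n} m. \<eta> I \<noteq> \<infinity>"
    and inc: "trop_incidence_plucker n s m \<mu> \<eta>"
  shows "\<exists>B. realizes B m n \<eta> \<and> (\<exists>X\<in>carrier_mat s m. A = X * B)"
proof -
  obtain c where Ac: "A \<in> carrier_mat s n" and c: "\<And>I. I \<in> nsets {..<n} s \<Longrightarrow> \<mu> I = val (minor A I) + ereal c"
    using A unfolding realizes_def by blast
  let ?E = "{..<n}"
  have del: "?E - {j} \<in> nsets ?E m" if "j < n" for j using that n by (auto simp: nsets_def)
  \<comment> \<open>\<open>y\<close> is to be the normal vector of the hyperplane. The incidence
    relations with the full set \<open>?E\<close> as \<open>J\<close> place its prescribed values in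
    the tropicalized kernel of \<open>A\<close>.\<close>
  have "\<exists>y. (\<forall>i<s. (\<Sum>j<n. A $$ (i,j) * y j) = 0) \<and> (\<forall>j<n. val (y j) = \<eta> (?E - {j}))"
  proof (rule kernel_lift[OF Ac])
    show "\<exists>I\<in>nsets ?E s. minor A I \<noteq> 0" using \<mu> realizes_imp_minor_neq_0[OF A] by blast
    show "\<eta> (?E - {j}) \<noteq> -\<infinity>" if "j < n" for j using \<eta>(1) del[OF that] unfolding TT_def by blast
    fix I assume I: "I \<subseteq> ?E" "Suc (card I) = s"
    have "trop_vanishes (\<lambda>j. \<mu> (insert j I) + \<eta> (?E - {j})) (?E - I)"
      using inc[unfolded trop_incidence_plucker_def, rule_format, of I ?E] I n by (simp add: nsets_def)
    moreover have "\<mu> (insert j I) = val (minor A (insert j I)) + ereal c" if "j \<in> ?E - I" for j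
      using I that finite_subset[OF I(1)] by (intro c) (auto simp: nsets_def)
    ultimately have "trop_vanishes (\<lambda>j. (val (minor A (insert j I)) + \<eta> (?E - {j})) + ereal c) (?E - I)"
      by (subst (asm) trop_vanishes_cong[of _ _ "\<lambda>j. (val (minor A (insert j I)) + \<eta> (?E - {j})) + ereal c"])
         (simp_all add: ac_simps)
    then show "trop_vanishes (\<lambda>j. val (minor A (insert j I)) + \<eta> (?E - {j})) (?E - I)"
      by (simp only: trop_vanishes_add_real_iff)
  qed
  then obtain y where y: "\<And>i. i < s \<Longrightarrow> (\<Sum>j<n. A $$ (i,j) * y j) = 0" "\<And>j. j < n \<Longrightarrow> val (y j) = \<eta> (?E - {j})"
    by blast
  obtain K where K: "K \<subseteq> ?E" "card K = m" "\<eta> K \<noteq> \<infinity>" using \<eta>(2) by (auto simp: nsets_def)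
  have "card (?E - K) = 1" using K n by (simp add: card_Diff_subset finite_subset)
  then obtain p where p: "?E - K = {p}" by (auto simp: card_1_singleton_iff)
  then have pn: "p < n" "K = ?E - {p}" using K by auto
  have yp: "y p \<noteq> 0" using y(2)[OF pn(1)] K(3) pn(2) by (metis val_0)
  define g where "g i = (if i < p then i else Suc i)" for i
  have g: "g i < n" "g i \<noteq> p" if "i < m" for i using that n by (auto simp: g_def)
  have ginj: "inj_on g {..<m}" by (auto simp: inj_on_def g_def split: if_splits)
  have "g ` {..<m} \<subseteq> ?E - {p}" using g by auto
  moreover have "card (g ` {..<m}) = card (?E - {p})" using ginj pn n by (simp add: card_image)
  ultimately have gim: "g ` {..<m} = ?E - {p}" by (simp add: card_subset_eq)
  then have gbij: "bij_betw g {..<m} (?E - {p})" using ginj by (simp add: bij_betw_def)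
  define B where "B = mat m n (\<lambda>(i,j). if j = g i then 1 else if j = p then - y (g i) / y p else 0)"
  have Bc: "B \<in> carrier_mat m n" by (simp add: B_def)
  have Bz: "(\<Sum>j<n. B $$ (i,j) * z j) = z (g i) - y (g i) / y p * z p" if i: "i < m" for i z
  proof -
    have "(\<Sum>j<n. B $$ (i,j) * z j) = (\<Sum>j\<in>{g i, p}. B $$ (i,j) * z j)"
      using i g[OF i] pn by (intro sum.mono_neutral_right) (auto simp: B_def)
    then show ?thesis using i g[OF i] pn by (simp add: B_def)
  qed
  \<comment> \<open>Up to sign the maximal minors of \<open>B\<close> are the entries of a kernel
    vector \<open>z\<close>. The rows of \<open>B\<close> make \<open>z\<close> a multiple of
    \<open>y\<close>, and the identity block away from column \<open>p\<close> gives
    \<open>val (z p) = 0\<close>.\<close>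
  obtain z where z: "\<And>i. i < m \<Longrightarrow> (\<Sum>j<n. B $$ (i,j) * z j) = 0"
    "\<And>j. j < n \<Longrightarrow> z j = minor B (?E - {j}) \<or> z j = - minor B (?E - {j})"
    using ex_circuit_vector[OF Bc, of ?E] n by auto
  have "val (minor B (set (map g [0..<m]))) = val (det (cols_mat B (map g [0..<m])))"
    using g ginj by (intro val_minor_set[OF Bc]) (auto simp: distinct_map atLeast0LessThan)
  also have "cols_mat B (map g [0..<m]) = 1\<^sub>m m"
    using g ginj by (intro eq_matI) (auto simp: cols_mat_def B_def inj_on_def)
  finally have "val (minor B (?E - {p})) = 0" using gim by (simp add: atLeast0LessThan)
  then have vzp: "val (z p) = 0" using z(2)[OF pn(1)] by auto
  obtain t where t: "val (y p) = ereal t" using val_real[OF yp] by blast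
  have zy: "z j = y j * inverse (y p) * z p" if j: "j < n" for j
  proof (cases "j = p")
    case False
    then obtain i where i: "i < m" "g i = j" using gim j by (metis Diff_iff imageE lessThan_iff singletonD)
    then show ?thesis using z(1)[OF i(1)] Bz[OF i(1), of z] by (simp add: divide_inverse)
  qed (use yp in simp)
  have "\<eta> I = val (minor B I) + ereal t" if I: "I \<in> nsets ?E m" for I
  proof -
    have I': "I \<subseteq> ?E" "card I = m" using I by (auto simp: nsets_def)
    then have "card (?E - I) = 1" using n by (simp add: card_Diff_subset finite_subset)
    then obtain j where "?E - I = {j}" by (auto simp: card_1_singleton_iff)
    then have j: "j < n" "I = ?E - {j}" using I' by auto
    have "val (minor B I) = val (z j)" using z(2)[OF j(1)] j(2) by auto
    also have "\<dots> = val (y j) + ereal (- t)"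
      unfolding zy[OF j(1)] using yp by (simp add: val_mult val_inverse t vzp)
    finally show ?thesis using y(2)[OF j(1)] j(2) by (simp add: add.assoc)
  qed
  then have "realizes B m n \<eta>" unfolding realizes_def using Bc by blast
  \<comment> \<open>Away from column \<open>p\<close> the rows of \<open>B\<close> are unit vectors,
    so the coefficients have to be the entries of \<open>A\<close> there. Column \<open>p\<close>
    then agrees because \<open>A\<close> annihilates \<open>y\<close>.\<close>
  moreover define X where "X = mat s m (\<lambda>(i,k). A $$ (i, g k))"
  have "A = X * B"
  proof (rule eq_matI)
    fix i j assume "i < dim_row (X * B)" "j < dim_col (X * B)"
    then have ij: "i < s" "j < n" using Bc by (auto simp: X_def)
    have *: "(X * B) $$ (i,j) = (\<Sum>k<m. A $$ (i, g k) * B $$ (k,j))"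
      using ij Bc by (simp add: X_def scalar_prod_def atLeast0LessThan)
    show "A $$ (i,j) = (X * B) $$ (i,j)"
    proof (cases "j = p")
      case True
      have "(\<Sum>k<m. A $$ (i, g k) * B $$ (k,j)) = (\<Sum>k<m. - (A $$ (i, g k) * y (g k)) * inverse (y p))"
        using True g pn by (intro sum.cong) (auto simp: B_def divide_inverse)
      also have "\<dots> = - (\<Sum>k<m. A $$ (i, g k) * y (g k)) * inverse (y p)"
        by (simp add: sum_distrib_right sum_negf)
      also have "(\<Sum>k<m. A $$ (i, g k) * y (g k)) = (\<Sum>j\<in>?E - {p}. A $$ (i,j) * y j)"
        by (rule sum.reindex_bij_betw[OF gbij])
      also have "\<dots> = - (A $$ (i,p) * y p)"
        using y(1)[OF ij(1)] pn(1) by (simp add: sum_diff1)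
      finally show ?thesis using * yp True by simp
    next
      case False
      then obtain k where k: "k < m" "g k = j" using gim ij(2) by (metis Diff_iff imageE lessThan_iff singletonD)
      have "(\<Sum>k'<m. A $$ (i, g k') * B $$ (k',j)) = (\<Sum>k'\<in>{k}. A $$ (i, g k') * B $$ (k',j))"
        using k ij False ginj by (intro sum.mono_neutral_right) (auto simp: B_def inj_on_def)
      also have "\<dots> = A $$ (i,j)" using k ij by (simp add: B_def)
      finally show ?thesis using * by simp
    qed
  qed (use Ac Bc in \<open>auto simp: X_def\<close>)
  moreover have "X \<in> carrier_mat s m" by (simp add: X_def)
  ultimately show ?thesis by blast
qed

end

section \<open>Tropical relations with three and four terms\<close>

text \<open>The test of \<open>trop_vanishes_iff\<close> on terms instead of indices, so that
  permuting the terms is a propositional matter.\<close>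

definition trop_vanishes3 :: "ereal \<Rightarrow> ereal \<Rightarrow> ereal \<Rightarrow> bool" where
  "trop_vanishes3 x y z \<longleftrightarrow> (y \<le> x \<or> z \<le> x) \<and> (x \<le> y \<or> z \<le> y) \<and> (x \<le> z \<or> y \<le> z)"

definition trop_vanishes4 :: "ereal \<Rightarrow> ereal \<Rightarrow> ereal \<Rightarrow> ereal \<Rightarrow> bool" where
  "trop_vanishes4 x y z t \<longleftrightarrow> (y \<le> x \<or> z \<le> x \<or> t \<le> x) \<and> (x \<le> y \<or> z \<le> y \<or> t \<le> y) \<and>
     (x \<le> z \<or> y \<le> z \<or> t \<le> z) \<and> (x \<le> t \<or> y \<le> t \<or> z \<le> t)"

lemma trop_vanishes_3:
  assumes "a \<noteq> b" "a \<noteq> c" "b \<noteq> c"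
  shows "trop_vanishes f {a,b,c} \<longleftrightarrow> trop_vanishes3 (f a) (f b) (f c)"
proof -
  have "trop_vanishes f {a,b,c} \<longleftrightarrow> (\<forall>i\<in>{a,b,c}. \<exists>j\<in>{a,b,c}. j \<noteq> i \<and> f j \<le> f i)"
    using assms by (intro trop_vanishes_iff) auto
  also have "\<dots> \<longleftrightarrow> trop_vanishes3 (f a) (f b) (f c)"
    unfolding trop_vanishes3_def using assms by simp
  finally show ?thesis .
qed

lemma trop_vanishes_4:
  assumes "a \<noteq> b" "a \<noteq> c" "a \<noteq> d" "b \<noteq> c" "b \<noteq> d" "c \<noteq> d"
  shows "trop_vanishes f {a,b,c,d} \<longleftrightarrow> trop_vanishes4 (f a) (f b) (f c) (f d)"
proof -
  have "trop_vanishes f {a,b,c,d} \<longleftrightarrow> (\<forall>i\<in>{a,b,c,d}. \<exists>j\<in>{a,b,c,d}. j \<noteq> i \<and> f j \<le> f i)"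
    using assms by (intro trop_vanishes_iff) auto
  also have "\<dots> \<longleftrightarrow> trop_vanishes4 (f a) (f b) (f c) (f d)"
    unfolding trop_vanishes4_def using assms by simp
  finally show ?thesis .
qed

text \<open>The summand \<open>c\<close> may be infinite; it will be the value of a bracket that may
  be 0. Cancelling a summand needs it to be real.\<close>

lemma trop_vanishes3_add: "trop_vanishes3 x y z \<Longrightarrow> trop_vanishes3 (x + c) (y + c) (z + c)"
  unfolding trop_vanishes3_def by (auto intro: add_right_mono)

lemma trop_vanishes4_add: "trop_vanishes4 x y z t \<Longrightarrow> trop_vanishes4 (x + c) (y + c) (z + c) (t + c)"
  unfolding trop_vanishes4_def using add_right_mono[of _ _ c] by blast

lemma trop_vanishes3_add_real_iff:
  "trop_vanishes3 (x + ereal c) (y + ereal c) (z + ereal c) \<longleftrightarrow> trop_vanishes3 x y z"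
  using trop_vanishes3_add[of "x + ereal c" "y + ereal c" "z + ereal c" "ereal (-c)"]
    trop_vanishes3_add[of x y z "ereal c"] by (auto simp: add.assoc)

lemma trop_vanishes4_add_real_iff:
  "trop_vanishes4 (x + ereal c) (y + ereal c) (z + ereal c) (t + ereal c) \<longleftrightarrow> trop_vanishes4 x y z t"
  using trop_vanishes4_add[of "x + ereal c" "y + ereal c" "z + ereal c" "t + ereal c" "ereal (-c)"]
    trop_vanishes4_add[of x y z t "ereal c"] by (auto simp: add.assoc)

lemma trop_vanishes4_of_3: "trop_vanishes3 x y z \<Longrightarrow> trop_vanishes4 x y z \<infinity>"
  unfolding trop_vanishes3_def trop_vanishes4_def by auto

text \<open>Tropical circuit elimination: if \<open>s\<close> is the partner of a term in one
  relation, then the partner of \<open>s\<close> in the other relation takes its place.\<close>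

lemma trop_vanishes3_eliminate:
  assumes "trop_vanishes3 x y s" "trop_vanishes3 z t s"
  shows "trop_vanishes4 x y z t"
  using assms unfolding trop_vanishes3_def trop_vanishes4_def by (meson order_trans linear)

lemma grassmann_plucker_rank_2:
  assumes "trop_grassmann_plucker n 2 \<mu>" "{x,a,b,c} \<subseteq> {..<n}" "distinct [x,a,b,c]"
  shows "trop_vanishes3 (\<mu> {x,a} + \<mu> {b,c}) (\<mu> {x,b} + \<mu> {a,c}) (\<mu> {x,c} + \<mu> {a,b})"
proof -
  have "trop_vanishes (\<lambda>j. \<mu> (insert j {x}) + \<mu> ({a,b,c} - {j})) ({a,b,c} - {x})"
    using assms by (intro assms(1)[unfolded trop_grassmann_plucker_def, rule_format]) (auto simp: nsets_def)
  moreover have "{a,b,c} - {x} = {a,b,c}" "{a,b,c} - {a} = {b,c}" "{a,b,c} - {b} = {a,c}" "{a,b,c} - {c} = {a,b}"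
    using assms by auto
  ultimately show ?thesis using assms(3) by (simp add: trop_vanishes_3 insert_commute)
qed

lemma grassmann_plucker_rank_3:
  assumes "trop_grassmann_plucker n 3 \<nu>" "{v,x,a,b,c} \<subseteq> {..<n}" "distinct [v,x,a,b,c]"
  shows "trop_vanishes3 (\<nu> {v,x,a} + \<nu> {v,b,c}) (\<nu> {v,x,b} + \<nu> {v,a,c}) (\<nu> {v,x,c} + \<nu> {v,a,b})"
proof -
  have "trop_vanishes (\<lambda>j. \<nu> (insert j {v,x}) + \<nu> ({v,a,b,c} - {j})) ({v,a,b,c} - {v,x})"
    using assms by (intro assms(1)[unfolded trop_grassmann_plucker_def, rule_format]) (auto simp: nsets_def)
  moreover have "{v,a,b,c} - {v,x} = {a,b,c}" "{v,a,b,c} - {a} = {v,b,c}" "{v,a,b,c} - {b} = {v,a,c}"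
    "{v,a,b,c} - {c} = {v,a,b}" "insert a {v,x} = {v,x,a}" "insert b {v,x} = {v,x,b}" "insert c {v,x} = {v,x,c}"
    using assms by auto
  ultimately show ?thesis using assms(3) by (simp add: trop_vanishes_3)
qed

lemma incidence_plucker_2_3_three_terms:
  assumes "trop_incidence_plucker n 2 3 \<mu> \<nu>" "{v,a,b,c} \<subseteq> {..<n}" "distinct [v,a,b,c]"
  shows "trop_vanishes3 (\<mu> {v,a} + \<nu> {v,b,c}) (\<mu> {v,b} + \<nu> {v,a,c}) (\<mu> {v,c} + \<nu> {v,a,b})"
proof -
  have "trop_vanishes (\<lambda>j. \<mu> (insert j {v}) + \<nu> ({v,a,b,c} - {j})) ({v,a,b,c} - {v})"
    using assms by (intro assms(1)[unfolded trop_incidence_plucker_def, rule_format]) (auto simp: nsets_def)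
  moreover have "{v,a,b,c} - {v} = {a,b,c}" "{v,a,b,c} - {a} = {v,b,c}" "{v,a,b,c} - {b} = {v,a,c}"
    "{v,a,b,c} - {c} = {v,a,b}"
    using assms by auto
  ultimately show ?thesis using assms(3) by (simp add: trop_vanishes_3 insert_commute)
qed

lemma incidence_plucker_2_3_four_terms:
  assumes "trop_incidence_plucker n 2 3 \<mu> \<nu>" "{v,a,b,c,d} \<subseteq> {..<n}" "distinct [v,a,b,c,d]"
  shows "trop_vanishes4 (\<mu> {v,a} + \<nu> {b,c,d}) (\<mu> {v,b} + \<nu> {a,c,d}) (\<mu> {v,c} + \<nu> {a,b,d}) (\<mu> {v,d} + \<nu> {a,b,c})"
proof -
  have "trop_vanishes (\<lambda>j. \<mu> (insert j {v}) + \<nu> ({a,b,c,d} - {j})) ({a,b,c,d} - {v})"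
    using assms by (intro assms(1)[unfolded trop_incidence_plucker_def, rule_format]) (auto simp: nsets_def)
  moreover have "{a,b,c,d} - {v} = {a,b,c,d}" "{a,b,c,d} - {a} = {b,c,d}" "{a,b,c,d} - {b} = {a,c,d}"
    "{a,b,c,d} - {c} = {a,b,d}" "{a,b,c,d} - {d} = {a,b,c}"
    using assms by auto
  ultimately show ?thesis using assms(3) by (simp add: trop_vanishes_4 insert_commute)
qed

section \<open>The exchange relation between complementary triples\<close>

text \<open>The numerical core of \<open>triple_exchange\<close>. In each case of the disjunction,
  adding the inequalities cancels everything and leaves a strict inequality between equal sums; the
  work lies in showing first that the cancelled values are finite.\<close>

lemma exchange_arithmetic:
  fixes A B C D F G H K L :: ereal
  assumes "A \<noteq> \<infinity>" "B \<noteq> \<infinity>" "C \<noteq> \<infinity>" "A \<noteq> -\<infinity>" "B \<noteq> -\<infinity>" "C \<noteq> -\<infinity>" "D \<noteq> -\<infinity>" "F \<noteq> -\<infinity>" "G \<noteq> -\<infinity>"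
    "H \<noteq> -\<infinity>" "K \<noteq> -\<infinity>" "L \<noteq> -\<infinity>"
    and "D + F \<le> A + C" and "G + H \<le> B + D \<or> K + C \<le> B + D"
    and "A + B < F + K" and "A + B < L + H" and "G \<noteq> \<infinity> \<Longrightarrow> L + C \<le> F + G"
  shows False
proof -
  obtain a b c where abc: "A = ereal a" "B = ereal b" "C = ereal c"
    using assms(1-6) by (cases A; cases B; cases C) auto
  have "D + F \<noteq> \<infinity>" using assms(13) abc by auto
  then obtain d f where df: "D = ereal d" "F = ereal f" using assms(7,8) by (cases D; cases F) auto
  show False
    using assms(14)
  proof
    assume le: "G + H \<le> B + D"
    then have "G + H \<noteq> \<infinity>" using abc df by auto
    then obtain g h where gh: "G = ereal g" "H = ereal h" using assms(9,10) by (cases G; cases H) auto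
    have "L + C \<le> F + G" using assms(17) gh by simp
    then obtain l where l: "L = ereal l" using assms(12) abc df gh by (cases L) auto
    show False using assms(13,16) le \<open>L + C \<le> F + G\<close> unfolding abc df gh l by simp
  next
    assume le: "K + C \<le> B + D"
    then obtain k where k: "K = ereal k" using assms(11) abc df by (cases K) auto
    show False using assms(13,15) le unfolding abc df k by simp
  qed
qed

text \<open>The triples \<open>{u, d, e}\<close> and \<open>{a, b, c}\<close> are disjoint. If the exchange of \<open>u\<close> failed for them,
  then replacing the best possible element of \<open>{a, b, c}\<close> by \<open>e\<close> would give a pair of triples which
  violates a three-term relation.\<close>

lemma triple_exchange:
  fixes p :: "'a set \<Rightarrow> ereal"
  assumes S: "distinct [a,b,c,d,e,u]" "{a,b,c,d,e,u} \<subseteq> S"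
    and p: "\<And>x y z. {x,y,z} \<subseteq> S \<Longrightarrow> distinct [x,y,z] \<Longrightarrow> p {x,y,z} \<noteq> -\<infinity>"
    and rel: "\<And>z x y s t. {z,x,y,s,t} \<subseteq> S \<Longrightarrow> distinct [z,x,y,s,t] \<Longrightarrow>
      trop_vanishes3 (p {z,x,y} + p {z,s,t}) (p {z,x,s} + p {z,y,t}) (p {z,x,t} + p {z,y,s})"
    and fin: "p {u,d,e} \<noteq> \<infinity>" "p {a,b,c} \<noteq> \<infinity>"
    and ex: "p {b,c,e} \<noteq> \<infinity> \<or> p {a,c,e} \<noteq> \<infinity> \<or> p {a,b,e} \<noteq> \<infinity>"
  shows "p {a,d,e} + p {b,c,u} \<le> p {u,d,e} + p {a,b,c} \<or> p {b,d,e} + p {a,c,u} \<le> p {u,d,e} + p {a,b,c} \<or>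
    p {c,d,e} + p {a,b,u} \<le> p {u,d,e} + p {a,b,c}"
proof (rule ccontr)
  assume no: "\<not> ?thesis"
  define g where "g v = p (insert e ({a,b,c} - {v}))" for v
  \<comment> \<open>The value of exchanging \<open>u\<close> for \<open>v\<close>, except that the
    second triple receives \<open>e\<close> in place of \<open>u\<close>.\<close>
  define f where "f v = p {v,d,e} + g v" for v
  have no': "p {u,d,e} + p {a,b,c} < p {v,d,e} + p (insert u ({a,b,c} - {v}))" if v: "v \<in> {a,b,c}" for v
  proof -
    have eqs: "insert u ({a,b,c} - {a}) = {b,c,u}" "insert u ({a,b,c} - {b}) = {a,c,u}"
      "insert u ({a,b,c} - {c}) = {a,b,u}" using S(1) by auto
    have lts: "p {u,d,e} + p {a,b,c} < p {a,d,e} + p {b,c,u}" "p {u,d,e} + p {a,b,c} < p {b,d,e} + p {a,c,u}"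
      "p {u,d,e} + p {a,b,c} < p {c,d,e} + p {a,b,u}"
      using no by (simp_all only: de_Morgan_disj not_le)
    consider "v = a" | "v = b" | "v = c" using v by blast
    then show ?thesis by cases (simp_all only: eqs lts)
  qed
  have gs: "g a = p {b,c,e}" "g b = p {a,c,e}" "g c = p {a,b,e}"
  proof -
    have "insert e ({a,b,c} - {a}) = {b,c,e}" "insert e ({a,b,c} - {b}) = {a,c,e}"
      "insert e ({a,b,c} - {c}) = {a,b,e}" using S(1) by auto
    then show "g a = p {b,c,e}" "g b = p {a,c,e}" "g c = p {a,b,e}" unfolding g_def by presburger+
  qed
  define V where "V = {v \<in> {a,b,c}. g v \<noteq> \<infinity>}"
  define v0 where "v0 = arg_min_on f V"
  have V: "finite V" "V \<noteq> {}" using ex unfolding V_def gs[symmetric] by auto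
  have v0: "v0 \<in> V" "\<And>v. v \<in> V \<Longrightarrow> f v0 \<le> f v"
    unfolding v0_def using arg_min_if_finite(1)[OF V] arg_min_least[OF V] by blast+
  obtain z v where zv: "{a,b,c} = {v0,z,v}" "distinct [v0,z,v,d,e,u]"
  proof -
    have "v0 = a \<or> v0 = b \<or> v0 = c" using v0(1) V_def by auto
    then show ?thesis
    proof (elim disjE)
      assume "v0 = a" then show ?thesis using that[of b c] S(1) by auto
    next
      assume "v0 = b" then show ?thesis using that[of a c] S(1) by auto
    next
      assume "v0 = c" then show ?thesis using that[of a b] S(1) by auto
    qed
  qed
  have sub: "{v0,z,v,d,e,u} \<subseteq> S" using S(2) zv(1) by auto
  \<comment> \<open>The relation at \<open>e\<close> used below bounds one of two sums that differ
    by swapping \<open>z\<close> and \<open>v\<close>; hence this step is stated for both orders.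
    Inside it, the relation at \<open>z\<close> meets the minimality of \<open>v0\<close>.\<close>
  have main: False if zv: "{a,b,c} = {v0,z,v}" "distinct [v0,z,v,d,e,u]"
    and h: "p {e,u,z} + p {e,d,v} \<le> p {u,d,e} + p {z,v,e}" for z v
  proof -
    have sub: "{v0,z,v,d,e,u} \<subseteq> S" using S(2) zv(1) by auto
    have eqs: "insert x ({v0,z,v} - {v0}) = {z,v,x}" "insert x ({v0,z,v} - {v}) = {z,v0,x}" for x
      using zv(2) by auto
    have gz: "g v0 = p {z,v,e}" "g v = p {z,v0,e}" unfolding g_def zv(1) by (simp_all only: eqs)
    have no1: "p {u,d,e} + p {v0,z,v} < p {v0,d,e} + p {z,v,u}"
      and no2: "p {u,d,e} + p {v0,z,v} < p {v,d,e} + p {z,v0,u}"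
      using no'[of v0] no'[of v] unfolding zv(1) eqs by blast+
    have comm: "{e,u,z} = {z,e,u}" "{e,d,v} = {v,d,e}" "{v0,z,v} = {z,v0,v}" by auto
    have r: "trop_vanishes3 (p {z,v0,v} + p {z,e,u}) (p {z,v0,e} + p {z,v,u}) (p {z,v0,u} + p {z,v,e})"
      using rel[of z v0 v e u] sub zv(2) by auto
    show False
    proof (rule exchange_arithmetic[of "p {u,d,e}" "p {v0,z,v}" "p {z,v,e}" "p {e,u,z}" "p {e,d,v}"
          "p {z,v0,e}" "p {z,v,u}" "p {z,v0,u}" "p {v0,d,e}"])
      show "p {z,v0,e} + p {z,v,u} \<le> p {v0,z,v} + p {e,u,z} \<or> p {z,v0,u} + p {z,v,e} \<le> p {v0,z,v} + p {e,u,z}"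
        using r unfolding trop_vanishes3_def comm by blast
      show "p {u,d,e} + p {v0,z,v} < p {e,d,v} + p {z,v0,u}" using no2 unfolding comm .
      show "p {v0,d,e} + p {z,v,e} \<le> p {e,d,v} + p {z,v0,e}" if "p {z,v0,e} \<noteq> \<infinity>"
        using v0(2)[of v] that unfolding V_def f_def gz zv(1) comm by (simp add: gz)
      show "p {z,v,e} \<noteq> \<infinity>" using v0(1) unfolding V_def gz(1)[symmetric] by simp
      show "p {v0,z,v} \<noteq> \<infinity>" using fin(2) unfolding zv(1) .
      show "p {u,d,e} \<noteq> \<infinity>" by (rule fin(1))
      show "p {e,u,z} + p {e,d,v} \<le> p {u,d,e} + p {z,v,e}" by (rule h)
      show "p {u,d,e} + p {v0,z,v} < p {v0,d,e} + p {z,v,u}" by (rule no1)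
    qed (rule p; use sub zv(2) in auto)+
  qed
  have "trop_vanishes3 (p {e,u,d} + p {e,z,v}) (p {e,u,z} + p {e,d,v}) (p {e,u,v} + p {e,d,z})"
    using rel[of e u d z v] sub zv(2) by auto
  moreover have "{e,u,d} = {u,d,e}" "{e,z,v} = {z,v,e}" "{v,z,e} = {z,v,e}" by auto
  ultimately have "p {e,u,z} + p {e,d,v} \<le> p {u,d,e} + p {z,v,e} \<or> p {e,u,v} + p {e,d,z} \<le> p {u,d,e} + p {v,z,e}"
    unfolding trop_vanishes3_def by metis
  then show False
  proof
    assume "p {e,u,z} + p {e,d,v} \<le> p {u,d,e} + p {z,v,e}"
    then show False using main[of z v] zv by auto
  next
    assume "p {e,u,v} + p {e,d,z} \<le> p {u,d,e} + p {v,z,e}"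
    moreover have "{a,b,c} = {v0,v,z}" using zv(1) by auto
    ultimately show False using main[of v z] zv(2) by auto
  qed
qed

text \<open>An incident pair of ranks 2 and 3 is a valuated matroid of rank 3 on one more element \<open>n\<close>.\<close>

lemma incidence_plucker_2_3_dual_four_terms:
  assumes \<mu>: "\<mu> \<in> nsets {..<n} 2 \<rightarrow> TT" and \<nu>: "\<nu> \<in> nsets {..<n} 3 \<rightarrow> TT"
    and gp: "trop_grassmann_plucker n 2 \<mu>" "trop_grassmann_plucker n 3 \<nu>"
    and inc: "trop_incidence_plucker n 2 3 \<mu> \<nu>"
    and S: "{a,b,c,d,e} \<subseteq> {..<n}" "distinct [a,b,c,d,e]"
  shows "trop_vanishes4 (\<mu> {d,e} + \<nu> {a,b,c}) (\<mu> {b,c} + \<nu> {a,d,e}) (\<mu> {a,c} + \<nu> {b,d,e}) (\<mu> {a,b} + \<nu> {c,d,e})"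
proof -
  \<comment> \<open>In terms of \<open>p\<close> the claim is the Grassmann-Pluecker relation for
    \<open>{d, e}\<close> and \<open>{a, b, c, n}\<close>, while the incidence relations are those
    whose smaller set contains \<open>n\<close>.\<close>
  define p where "p T = (if n \<in> T then \<mu> (T - {n}) else \<nu> T)" for T
  have pn: "p {n,x,y} = \<mu> {x,y}" "p {x,n,y} = \<mu> {x,y}" "p {x,y,n} = \<mu> {x,y}" if "x < n" "y < n" for x y
  proof -
    have eqs: "{n,x,y} - {n} = {x,y}" "{x,n,y} - {n} = {x,y}" "{x,y,n} - {n} = {x,y}" using that by auto
    show "p {n,x,y} = \<mu> {x,y}" "p {x,n,y} = \<mu> {x,y}" "p {x,y,n} = \<mu> {x,y}"
      unfolding p_def eqs by simp_all
  qed
  have pv: "p {x,y,z} = \<nu> {x,y,z}" if "x < n" "y < n" "z < n" for x y z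
    unfolding p_def using that by auto
  have muMI: "\<mu> {s,t} \<noteq> -\<infinity>" if "s < n" "t < n" "s \<noteq> t" for s t
    using funcset_mem[OF \<mu>, of "{s,t}"] that by (auto simp: TT_def nsets_def)
  have nuMI: "\<nu> {x,y,z} \<noteq> -\<infinity>" if "x < n" "y < n" "z < n" "distinct [x,y,z]" for x y z
    using funcset_mem[OF \<nu>, of "{x,y,z}"] that by (auto simp: TT_def nsets_def)
  have pMI: "p {x,y,z} \<noteq> -\<infinity>" if m: "{x,y,z} \<subseteq> {..n}" "distinct [x,y,z]" for x y z
  proof -
    have le: "x \<le> n" "y \<le> n" "z \<le> n" using m(1) by auto
    have ne: "x \<noteq> y" "x \<noteq> z" "y \<noteq> z" using m(2) by auto
    consider "x = n" | "y = n" | "z = n" | "n \<notin> {x,y,z}" by blast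
    then show ?thesis
    proof cases
      case 1
      have lt: "y < n" "z < n" using le ne unfolding 1 by linarith+
      show ?thesis unfolding 1 pn(1)[OF lt] by (rule muMI[OF lt ne(3)])
    next
      case 2
      have lt: "x < n" "z < n" using le ne unfolding 2 by linarith+
      show ?thesis unfolding 2 pn(2)[OF lt] by (rule muMI[OF lt ne(2)])
    next
      case 3
      have lt: "x < n" "y < n" using le ne unfolding 3 by linarith+
      show ?thesis unfolding 3 pn(3)[OF lt] by (rule muMI[OF lt ne(1)])
    next
      case 4
      then have lt: "x < n" "y < n" "z < n" using le by auto
      show ?thesis unfolding pv[OF lt] by (rule nuMI[OF lt m(2)])
    qed
  qed
  \<comment> \<open>The position of \<open>n\<close> decides the source: as the common element it
    gives a rank 2 relation, in any other position an incidence relation, and without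
    \<open>n\<close> the relation has rank 3.\<close>
  have rel: "trop_vanishes3 (p {z,x,y} + p {z,s,t}) (p {z,x,s} + p {z,y,t}) (p {z,x,t} + p {z,y,s})"
    if m: "{z,x,y,s,t} \<subseteq> {..n}" "distinct [z,x,y,s,t]" for z x y s t
  proof -
    have inc': "trop_vanishes3 (\<mu> {z,y} + \<nu> {z,s,t}) (\<mu> {z,s} + \<nu> {z,y,t}) (\<mu> {z,t} + \<nu> {z,y,s})"
      if "{z,y,s,t} \<subseteq> {..<n}" "distinct [z,y,s,t]" for y s t
      using incidence_plucker_2_3_three_terms[OF inc that] .
    have le: "z \<le> n" "x \<le> n" "y \<le> n" "s \<le> n" "t \<le> n" using m(1) by auto
    have ne: "z \<noteq> x" "z \<noteq> y" "z \<noteq> s" "z \<noteq> t" "x \<noteq> y" "x \<noteq> s" "x \<noteq> t" "y \<noteq> s" "y \<noteq> t" "s \<noteq> t"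
      using m(2) by auto
    consider "z = n" | "x = n" | "y = n" | "s = n" | "t = n" | "n \<notin> {z,x,y,s,t}" by blast
    then show ?thesis
    proof cases
      case 1
      have lt: "x < n" "y < n" "s < n" "t < n"
        using le ne unfolding 1 by (simp_all add: less_le)
      then have sub: "{x,y,s,t} \<subseteq> {..<n}" by auto
      show ?thesis unfolding 1 pn(1)[OF lt(1,2)] pn(1)[OF lt(3,4)] pn(1)[OF lt(1,3)] pn(1)[OF lt(2,4)]
          pn(1)[OF lt(1,4)] pn(1)[OF lt(2,3)]
        by (rule grassmann_plucker_rank_2[OF gp(1) sub]) (use ne in auto)
    next
      case 2
      have lt: "z < n" "y < n" "s < n" "t < n"
        using le ne unfolding 2 by (simp_all add: less_le)
      then have sub: "{z,y,s,t} \<subseteq> {..<n}" by auto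
      show ?thesis unfolding 2 pn(2)[OF lt(1,2)] pn(2)[OF lt(1,3)] pn(2)[OF lt(1,4)]
          pv[OF lt(1,3,4)] pv[OF lt(1,2,4)] pv[OF lt(1,2,3)]
        by (rule inc'[OF sub]) (use ne in auto)
    next
      case 3
      have lt: "z < n" "x < n" "s < n" "t < n"
        using le ne unfolding 3 by (simp_all add: less_le)
      then have sub: "{z,x,s,t} \<subseteq> {..<n}" by auto
      have "trop_vanishes3 (\<mu> {z,x} + \<nu> {z,s,t}) (\<mu> {z,s} + \<nu> {z,x,t}) (\<mu> {z,t} + \<nu> {z,x,s})"
        by (rule inc'[OF sub]) (use ne in auto)
      then show ?thesis unfolding 3 pn(2)[OF lt(1,3)] pn(3)[OF lt(1,2)] pn(2)[OF lt(1,4)]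
          pv[OF lt(1,3,4)] pv[OF lt(1,2,4)] pv[OF lt(1,2,3)] add.commute[of "\<nu> _"]
        unfolding trop_vanishes3_def by blast
    next
      case 4
      have lt: "z < n" "x < n" "y < n" "t < n"
        using le ne unfolding 4 by (simp_all add: less_le)
      then have sub: "{z,x,y,t} \<subseteq> {..<n}" by auto
      have "trop_vanishes3 (\<mu> {z,x} + \<nu> {z,y,t}) (\<mu> {z,y} + \<nu> {z,x,t}) (\<mu> {z,t} + \<nu> {z,x,y})"
        by (rule inc'[OF sub]) (use ne in auto)
      then show ?thesis unfolding 4 pn(3)[OF lt(1,2)] pn(3)[OF lt(1,3)] pn(2)[OF lt(1,4)]
          pv[OF lt(1,3,4)] pv[OF lt(1,2,4)] pv[OF lt(1,2,3)] add.commute[of "\<nu> _"]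
        unfolding trop_vanishes3_def by blast
    next
      case 5
      have lt: "z < n" "x < n" "y < n" "s < n"
        using le ne unfolding 5 by (simp_all add: less_le)
      then have sub: "{z,x,y,s} \<subseteq> {..<n}" by auto
      have "trop_vanishes3 (\<mu> {z,x} + \<nu> {z,y,s}) (\<mu> {z,y} + \<nu> {z,x,s}) (\<mu> {z,s} + \<nu> {z,x,y})"
        by (rule inc'[OF sub]) (use ne in auto)
      then show ?thesis unfolding 5 pn(3)[OF lt(1,2)] pn(3)[OF lt(1,3)] pn(3)[OF lt(1,4)]
          pv[OF lt(1,3,4)] pv[OF lt(1,2,4)] pv[OF lt(1,2,3)] add.commute[of "\<nu> _"]
        unfolding trop_vanishes3_def by blast
    next
      case 6
      have lt: "z < n" "x < n" "y < n" "s < n" "t < n"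
        using le 6 by auto
      then have sub: "{z,x,y,s,t} \<subseteq> {..<n}" by auto
      show ?thesis unfolding pv[OF lt(1,2,3)] pv[OF lt(1,4,5)] pv[OF lt(1,2,4)] pv[OF lt(1,3,5)]
          pv[OF lt(1,2,5)] pv[OF lt(1,3,4)]
        by (rule grassmann_plucker_rank_3[OF gp(2) sub m(2)])
    qed
  qed
  \<comment> \<open>Here \<open>n\<close> is exchanged between \<open>{n, d, e}\<close> and
    \<open>{a, b, c}\<close>. That \<open>e\<close> can enter \<open>{a, b, c}\<close> comes from
    the four-term incidence relation at \<open>d\<close>.\<close>
  have new: "\<mu> {b,c} + \<nu> {a,d,e} \<le> \<mu> {d,e} + \<nu> {a,b,c} \<or> \<mu> {a,c} + \<nu> {b,d,e} \<le> \<mu> {d,e} + \<nu> {a,b,c} \<or>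
      \<mu> {a,b} + \<nu> {c,d,e} \<le> \<mu> {d,e} + \<nu> {a,b,c}"
  proof (cases "\<mu> {d,e} + \<nu> {a,b,c} = \<infinity>")
    case False
    then have fin: "\<mu> {d,e} \<noteq> \<infinity>" "\<nu> {a,b,c} \<noteq> \<infinity>" by auto
    have "trop_vanishes4 (\<mu> {d,a} + \<nu> {b,c,e}) (\<mu> {d,b} + \<nu> {a,c,e}) (\<mu> {d,c} + \<nu> {a,b,e}) (\<mu> {d,e} + \<nu> {a,b,c})"
      using incidence_plucker_2_3_four_terms[OF inc, of d a b c e] S by auto
    then have "\<nu> {b,c,e} \<noteq> \<infinity> \<or> \<nu> {a,c,e} \<noteq> \<infinity> \<or> \<nu> {a,b,e} \<noteq> \<infinity>"
      using False unfolding trop_vanishes4_def by auto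
    note ex = this
    have lt: "a < n" "b < n" "c < n" "d < n" "e < n" using S(1) by auto
    have "p {a,d,e} + p {b,c,n} \<le> p {n,d,e} + p {a,b,c} \<or>
      p {b,d,e} + p {a,c,n} \<le> p {n,d,e} + p {a,b,c} \<or> p {c,d,e} + p {a,b,n} \<le> p {n,d,e} + p {a,b,c}"
    proof (rule triple_exchange[of a b c d e n "{..n}" p, OF _ _ pMI rel])
      show "distinct [a,b,c,d,e,n]" "{a,b,c,d,e,n} \<subseteq> {..n}" using S lt by auto
      show "p {n,d,e} \<noteq> \<infinity>" unfolding pn(1)[OF lt(4,5)] by (rule fin)
      show "p {a,b,c} \<noteq> \<infinity>" unfolding pv[OF lt(1,2,3)] by (rule fin)
      show "p {b,c,e} \<noteq> \<infinity> \<or> p {a,c,e} \<noteq> \<infinity> \<or> p {a,b,e} \<noteq> \<infinity>"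
        unfolding pv[OF lt(2,3,5)] pv[OF lt(1,3,5)] pv[OF lt(1,2,5)] by (rule ex)
    qed
    then show ?thesis
      unfolding pv[OF lt(1,4,5)] pv[OF lt(2,4,5)] pv[OF lt(3,4,5)] pv[OF lt(1,2,3)]
        pn(1)[OF lt(4,5)] pn(3)[OF lt(2,3)] pn(3)[OF lt(1,3)] pn(3)[OF lt(1,2)] add.commute[of "\<nu> _"] .
  qed auto
  \<comment> \<open>Here \<open>a\<close> is exchanged between \<open>{a, d, e}\<close> and
    \<open>{b, c, n}\<close>. It is stated for all names, because renaming \<open>a\<close>,
    \<open>b\<close>, \<open>c\<close> also covers the last two terms.\<close>
  have old: "\<mu> {d,e} + \<nu> {a,b,c} \<le> \<mu> {b,c} + \<nu> {a,d,e} \<or> \<mu> {a,c} + \<nu> {b,d,e} \<le> \<mu> {b,c} + \<nu> {a,d,e} \<or>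
      \<mu> {a,b} + \<nu> {c,d,e} \<le> \<mu> {b,c} + \<nu> {a,d,e}"
    if S: "{a,b,c,d,e} \<subseteq> {..<n}" "distinct [a,b,c,d,e]" for a b c d e
  proof (cases "\<mu> {b,c} + \<nu> {a,d,e} = \<infinity>")
    case False
    then have fin: "\<mu> {b,c} \<noteq> \<infinity>" "\<nu> {a,d,e} \<noteq> \<infinity>" by auto
    \<comment> \<open>Otherwise \<open>e\<close> could replace no element of
      \<open>{b, c, n}\<close>. The four-term relation at \<open>b\<close> would yield
      \<open>x\<close> with \<open>\<nu> {c, e, x}\<close> finite, and in the three-term relation at
      \<open>c\<close> the term of \<open>b\<close> would be the only finite one.\<close>
    have "\<mu> {c,e} \<noteq> \<infinity> \<or> \<mu> {b,e} \<noteq> \<infinity> \<or> \<nu> {b,c,e} \<noteq> \<infinity>"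
    proof (rule ccontr)
      assume "\<not> ?thesis"
      then have inf: "\<mu> {c,e} = \<infinity>" "\<mu> {b,e} = \<infinity>" "\<nu> {b,c,e} = \<infinity>" by auto
      have "trop_vanishes4 (\<mu> {b,c} + \<nu> {a,d,e}) (\<mu> {b,a} + \<nu> {c,d,e}) (\<mu> {b,d} + \<nu> {c,a,e}) (\<mu> {b,e} + \<nu> {c,a,d})"
        using incidence_plucker_2_3_four_terms[OF inc, of b c a d e] S by auto
      then have "\<nu> {c,d,e} \<noteq> \<infinity> \<or> \<nu> {c,a,e} \<noteq> \<infinity>"
        using False inf(2) unfolding trop_vanishes4_def by auto
      moreover have "{c,d,e} = {c,e,d}" "{c,a,e} = {c,e,a}" by auto
      ultimately obtain x where x: "x \<in> {a,d}" "\<nu> {c,e,x} \<noteq> \<infinity>" by auto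
      have "trop_vanishes3 (\<mu> {c,b} + \<nu> {c,e,x}) (\<mu> {c,e} + \<nu> {c,b,x}) (\<mu> {c,x} + \<nu> {c,b,e})"
        using incidence_plucker_2_3_three_terms[OF inc, of c b e x] S x(1) by auto
      moreover have "{c,b,e} = {b,c,e}" "{c,b} = {b,c}" by auto
      ultimately have "\<mu> {b,c} + \<nu> {c,e,x} = \<infinity>"
        using inf unfolding trop_vanishes3_def by auto
      then show False using fin(1) x(2) by auto
    qed
    note ex = this
    have lt: "a < n" "b < n" "c < n" "d < n" "e < n" using S(1) by auto
    have "p {b,d,e} + p {c,n,a} \<le> p {a,d,e} + p {b,c,n} \<or>
      p {c,d,e} + p {b,n,a} \<le> p {a,d,e} + p {b,c,n} \<or> p {n,d,e} + p {b,c,a} \<le> p {a,d,e} + p {b,c,n}"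
    proof (rule triple_exchange[of b c n d e a "{..n}" p, OF _ _ pMI rel])
      show "distinct [b,c,n,d,e,a]" "{b,c,n,d,e,a} \<subseteq> {..n}" using S lt by auto
      show "p {a,d,e} \<noteq> \<infinity>" unfolding pv[OF lt(1,4,5)] by (rule fin)
      show "p {b,c,n} \<noteq> \<infinity>" unfolding pn(3)[OF lt(2,3)] by (rule fin)
      show "p {c,n,e} \<noteq> \<infinity> \<or> p {b,n,e} \<noteq> \<infinity> \<or> p {b,c,e} \<noteq> \<infinity>"
        unfolding pn(2)[OF lt(3,5)] pn(2)[OF lt(2,5)] pv[OF lt(2,3,5)] by (rule ex)
    qed
    then show ?thesis
      unfolding pv[OF lt(1,4,5)] pv[OF lt(2,4,5)] pv[OF lt(3,4,5)] pv[OF lt(2,3,1)]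
        pn(1)[OF lt(4,5)] pn(3)[OF lt(2,3)] pn(2)[OF lt(3,1)] pn(2)[OF lt(2,1)]
      unfolding insert_commute[of c a] insert_commute[of b a] add.commute[of "\<nu> _"] by blast
  qed auto
  have eqs: "{b,a,c} = {a,b,c}" "{b,a} = {a,b}" "{c,a,b} = {a,b,c}" "{c,b} = {b,c}" "{c,a} = {a,c}" by auto
  have S': "{b,a,c,d,e} \<subseteq> {..<n}" "distinct [b,a,c,d,e]" "{c,a,b,d,e} \<subseteq> {..<n}" "distinct [c,a,b,d,e]"
    using S by auto
  show ?thesis unfolding trop_vanishes4_def
    using new old[OF S] old[OF S'(1,2), unfolded eqs] old[OF S'(3,4), unfolded eqs] by blast
qed

section \<open>Adding a point to a configuration in the plane or on the line\<close>

type_synonym 'a vec3 = "'a \<times> 'a \<times> 'a"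

fun vcross :: "'a::comm_ring_1 vec3 \<Rightarrow> 'a vec3 \<Rightarrow> 'a vec3" where
  "vcross (a1,a2,a3) (b1,b2,b3) = (a2 * b3 - a3 * b2, a3 * b1 - a1 * b3, a1 * b2 - a2 * b1)"

fun vdot :: "'a::comm_ring_1 vec3 \<Rightarrow> 'a vec3 \<Rightarrow> 'a" where
  "vdot (a1,a2,a3) (b1,b2,b3) = a1 * b1 + a2 * b2 + a3 * b3"

definition vdet :: "'a::comm_ring_1 vec3 \<Rightarrow> 'a vec3 \<Rightarrow> 'a vec3 \<Rightarrow> 'a" where
  "vdet a b c = vdot a (vcross b c)"

lemma vdet_swap: "vdet b a c = - vdet a b c" "vdet a c b = - vdet a b c"
  by (cases a; cases b; cases c; simp add: vdet_def algebra_simps)+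

lemma vdet_same: "vdet a a b = 0" "vdet a b a = 0" "vdet a b b = 0"
  by (cases a; cases b; simp add: vdet_def algebra_simps)+

lemma vdet_vcross_swap: "vdet (vcross b a) x y = - vdet (vcross a b) x y"
  by (cases a; cases b; cases x; cases y; simp add: vdet_def algebra_simps)

lemma vdot_vcross: "vdot (vcross a b) u = vdet a b u"
  by (cases a; cases b; cases u; simp add: vdet_def algebra_simps)

text \<open>Projectively, \<open>vcross\<close> joins two points and also intersects two lines. The
  lines \<open>v a\<close> and \<open>v b\<close> meet in \<open>v\<close>, so the determinant with
  a third line splits off the test whether \<open>v\<close> lies on it.\<close>

lemma vdet_vcross: "vdet (vcross v a) (vcross v b) (vcross x y) = vdet v x y * vdet v a b"
  by (cases v; cases a; cases b; cases x; cases y; simp add: vdet_def algebra_simps)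

lemma vdot_linear: "\<exists>u''. \<forall>x. vdot x u + c * vdot x u' = vdot x u''"
proof -
  obtain p q r p' q' r' where u: "u = (p,q,r)" "u' = (p',q',r')" by (cases u; cases u') auto
  have "vdot x u + c * vdot x u' = vdot x (p + c * p', q + c * q', r + c * r')" for x
    unfolding u by (cases x) (simp add: algebra_simps)
  then show ?thesis by blast
qed

lemma nsets_2_containing:
  assumes "e \<in> nsets S 2" "v \<in> e"
  shows "\<exists>a\<in>S. a \<noteq> v \<and> e = {v,a} \<and> v \<in> S"
proof -
  obtain x y where xy: "e = {x,y}" "x \<noteq> y" "{x,y} \<subseteq> S" using assms(1) by (auto simp: nsets_def card_2_iff)
  then show ?thesis using assms(2) by (auto simp: insert_commute)
qed

lemma set_3_eq_perm:
  assumes "{x,y,z} = {x',y',z'}" "x \<noteq> y" "x \<noteq> z" "y \<noteq> z"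
  shows "(x' = x \<and> y' = y \<and> z' = z) \<or> (x' = x \<and> y' = z \<and> z' = y) \<or> (x' = y \<and> y' = x \<and> z' = z) \<or>
    (x' = y \<and> y' = z \<and> z' = x) \<or> (x' = z \<and> y' = x \<and> z' = y) \<or> (x' = z \<and> y' = y \<and> z' = x)"
proof -
  have "x' \<in> {x,y,z}" "y' \<in> {x,y,z}" "z' \<in> {x,y,z}" "x \<in> {x',y',z'}" "y \<in> {x',y',z'}" "z \<in> {x',y',z'}"
    using assms(1) by blast+
  then show ?thesis using assms(2-4) by (simp only: insert_iff empty_iff simp_thms) metis
qed

text \<open>The sets are the edges of a graph. In the last four cases, three of the edges form a triangle on
  the vertices outside the fourth one.\<close>

lemma four_edges_cases:
  assumes S: "finite S" "card S \<le> 5"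
    and e: "e1 \<in> nsets S 2" "e2 \<in> nsets S 2" "e3 \<in> nsets S 2" "e4 \<in> nsets S 2"
  shows "(e1 \<inter> e2 \<noteq> {} \<and> e3 \<inter> e4 \<noteq> {}) \<or> (e1 \<inter> e3 \<noteq> {} \<and> e2 \<inter> e4 \<noteq> {}) \<or> (e1 \<inter> e4 \<noteq> {} \<and> e2 \<inter> e3 \<noteq> {}) \<or>
    (e1 \<inter> e2 = {} \<and> e1 \<inter> e3 = {} \<and> e1 \<inter> e4 = {}) \<or> (e2 \<inter> e1 = {} \<and> e2 \<inter> e3 = {} \<and> e2 \<inter> e4 = {}) \<or>
    (e3 \<inter> e1 = {} \<and> e3 \<inter> e2 = {} \<and> e3 \<inter> e4 = {}) \<or> (e4 \<inter> e1 = {} \<and> e4 \<inter> e2 = {} \<and> e4 \<inter> e3 = {})"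
proof -
  \<comment> \<open>The bound 5 enters here: three disjoint edges need six vertices.\<close>
  have no3: "\<not> (x \<inter> y = {} \<and> x \<inter> z = {} \<and> y \<inter> z = {})"
    if m: "x \<in> nsets S 2" "y \<in> nsets S 2" "z \<in> nsets S 2" for x y z
  proof
    assume d: "x \<inter> y = {} \<and> x \<inter> z = {} \<and> y \<inter> z = {}"
    have "card (x \<union> y \<union> z) = card x + card y + card z"
      using d m by (subst card_Un_disjoint; (subst card_Un_disjoint)?) (auto simp: nsets_def)
    also have "\<dots> = 6" using m by (simp add: nsets_def)
    finally have "6 \<le> card S" using card_mono[of S "x \<union> y \<union> z"] m S(1) by (auto simp: nsets_def)
    then show False using S(2) by simp
  qed
  \<comment> \<open>Disjointness is thus a triangle-free graph on the four edges. If none of them is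
    disjoint from the three others, this graph sits inside a 4-cycle, whose two diagonals are pairs
    of meeting edges.\<close>
  show ?thesis
    using no3[OF e(1,2,3)] no3[OF e(1,2,4)] no3[OF e(1,3,4)] no3[OF e(2,3,4)]
    by (simp only: Int_commute[of e2 e1] Int_commute[of e3 e1] Int_commute[of e4 e1] Int_commute[of e3 e2]
        Int_commute[of e4 e2] Int_commute[of e4 e3]) blast
qed

context alg_closed_valuation
begin

text \<open>Each edge of the complete graph on \<open>S\<close> is a line, and the values of these
  lines at \<open>u\<close> form a vector of a three-dimensional space, to which
  \<open>tropical_point_lift\<close> applies. Its circuit relations are sorted by
  \<open>four_edges_cases\<close>: \<open>rel3\<close> settles two pairs of meeting edges, and
  \<open>rel4\<close> an edge disjoint from a triangle.\<close>

lemma plane_point_extension: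
  fixes P :: "nat \<Rightarrow> 'k vec3" and w :: "nat set \<Rightarrow> ereal"
  defines "br \<equiv> \<lambda>i j k. val (vdet (P i) (P j) (P k))"
  assumes S: "finite S" "card S \<le> 5"
    and basis: "\<exists>a\<in>S. \<exists>b\<in>S. \<exists>c\<in>S. vdet (P a) (P b) (P c) \<noteq> 0"
    and w: "\<And>e. e \<in> nsets S 2 \<Longrightarrow> w e \<noteq> -\<infinity>"
    and rel3: "\<And>v a b c. {v,a,b,c} \<subseteq> S \<Longrightarrow> distinct [v,a,b,c] \<Longrightarrow>
      trop_vanishes3 (w {v,a} + br v b c) (w {v,b} + br v a c) (w {v,c} + br v a b)"
    and rel4: "\<And>a b c d e. {a,b,c,d,e} \<subseteq> S \<Longrightarrow> distinct [a,b,c,d,e] \<Longrightarrow>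
      trop_vanishes4 (w {d,e} + br a b c) (w {b,c} + br a d e) (w {a,c} + br b d e) (w {a,b} + br c d e)"
  shows "\<exists>u. \<forall>a\<in>S. \<forall>b\<in>S. a \<noteq> b \<longrightarrow> val (vdet (P a) (P b) u) = w {a,b}"
proof -
  define C where "C e = vcross (P (Min e)) (P (Max e))" for e
  define N3 where "N3 e f g = val (vdet (C e) (C f) (C g))" for e f g
  \<comment> \<open>For a set of three elements the infimum is over a single value, because
    \<open>N3\<close> is symmetric; it only turns \<open>N3\<close> into a function of a
    set.\<close>
  define N where "N T = Inf {N3 x y z | x y z. T = {x,y,z}}" for T
  have br_sym: "br j i k = br i j k" "br i k j = br i j k" for i j k
    unfolding br_def using vdet_swap[of "P i" "P j" "P k"] by simp_all
  have br_same: "br i i j = \<infinity>" "br i j i = \<infinity>" "br i j j = \<infinity>" for i j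
    unfolding br_def by (simp_all add: vdet_same)
  have N3_sym: "N3 f e g = N3 e f g" "N3 e g f = N3 e f g" for e f g
    unfolding N3_def using vdet_swap[of "C e" "C f" "C g"] by simp_all
  have N3_rot: "N3 g e f = N3 e f g" for e f g by (simp only: N3_sym)
  have br_rot: "br k i j = br i j k" and br_rev: "br k j i = br i j k" for i j k by (simp_all only: br_sym)
  have N3_same: "N3 e e f = \<infinity>" "N3 e f e = \<infinity>" "N3 e f f = \<infinity>" for e f
    unfolding N3_def by (simp_all add: vdet_same)
  have C1: "val (vdet (C {a,b}) x y) = val (vdet (vcross (P a) (P b)) x y)" if "a \<noteq> b" for a b x y
  proof (cases "a < b")
    case True
    then have "Min {a,b} = a" "Max {a,b} = b" by auto
    then show ?thesis unfolding C_def by simp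
  next
    case False
    then have "Min {a,b} = b" "Max {a,b} = a" using that by auto
    then show ?thesis unfolding C_def using vdet_vcross_swap[of "P b" "P a" x y] by simp
  qed
  have N3_adj: "N3 {v,a} {v,b} {x,y} = br v x y + br v a b" if "a \<noteq> v" "b \<noteq> v" "x \<noteq> y" for v a b x y
  proof -
    have C2: "val (vdet z (C {a,b}) y') = val (vdet z (vcross (P a) (P b)) y')" if "a \<noteq> b" for a b z y'
      using C1[OF that, of z y'] vdet_swap(1)[of z "C {a,b}" y'] vdet_swap(1)[of z "vcross (P a) (P b)" y'] by simp
    have C3: "val (vdet z y' (C {a,b})) = val (vdet z y' (vcross (P a) (P b)))" if "a \<noteq> b" for a b z y'
      using C2[OF that, of z y'] vdet_swap(2)[of z "C {a,b}" y'] vdet_swap(2)[of z "vcross (P a) (P b)" y'] by simp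
    have "N3 {v,a} {v,b} {x,y} = val (vdet (vcross (P v) (P a)) (vcross (P v) (P b)) (vcross (P x) (P y)))"
      unfolding N3_def
      by (simp only: C1[OF that(1)[symmetric]] C2[OF that(2)[symmetric]] C3[OF that(3)])
    then show ?thesis unfolding br_def by (simp only: vdet_vcross val_mult)
  qed
  have N_eq: "N {x,y,z} = N3 x y z" if "x \<noteq> y" "x \<noteq> z" "y \<noteq> z" for x y z
  proof -
    have "N3 x' y' z' = N3 x y z" if eq: "{x,y,z} = {x',y',z'}" for x' y' z'
      using set_3_eq_perm[OF eq \<open>x \<noteq> y\<close> \<open>x \<noteq> z\<close> \<open>y \<noteq> z\<close>] by (elim disjE conjE) (simp_all only: N3_sym)
    note perm = this
    have "{N3 x' y' z' | x' y' z'. {x,y,z} = {x',y',z'}} = {N3 x y z}"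
    proof (intro equalityI subsetI)
      fix t assume "t \<in> {N3 x' y' z' | x' y' z'. {x,y,z} = {x',y',z'}}"
      then have "\<exists>x' y' z'. t = N3 x' y' z' \<and> {x,y,z} = {x',y',z'}" by (rule CollectD)
      then obtain x' y' z' where t: "t = N3 x' y' z'" "{x,y,z} = {x',y',z'}" by (elim exE conjE)
      show "t \<in> {N3 x y z}" unfolding t(1) perm[OF t(2)] by (rule singletonI)
    next
      fix t assume "t \<in> {N3 x y z}"
      then have t: "t = N3 x y z" by (rule singletonD)
      show "t \<in> {N3 x' y' z' | x' y' z'. {x,y,z} = {x',y',z'}}"
        unfolding t by (intro CollectI exI[of _ x] exI[of _ y] exI[of _ z] conjI refl)
    qed
    then show ?thesis unfolding N_def by simp
  qed
  define T where "T e1 e2 e3 e4 \<longleftrightarrow> trop_vanishes4 (w e1 + N3 e2 e3 e4) (w e2 + N3 e1 e3 e4)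
    (w e3 + N3 e1 e2 e4) (w e4 + N3 e1 e2 e3)" for e1 e2 e3 e4
  have T_sym: "T e1 e2 e3 e4" if "T e2 e1 e3 e4" for e1 e2 e3 e4
    using that unfolding T_def trop_vanishes4_def N3_sym(1)[of e2 e1] by blast
  have T_sym2: "T e1 e2 e3 e4" if "T e1 e3 e2 e4" for e1 e2 e3 e4
    using that unfolding T_def trop_vanishes4_def N3_sym(1)[of e3 e2] N3_sym(2)[of _ e3 e2] by blast
  have T_sym3: "T e1 e2 e3 e4" if "T e1 e2 e4 e3" for e1 e2 e3 e4
    using that unfolding T_def trop_vanishes4_def N3_sym(2)[of _ e4 e3] by blast
  \<comment> \<open>Three concurrent lines have minor 0, so the term of \<open>e4\<close> is
    infinite. The rest is the three-term relation at \<open>v\<close> with the bracket of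
    \<open>v\<close> and \<open>e4\<close> added.\<close>
  have star: "T e1 e2 e3 e4" if m: "e1 \<in> nsets S 2" "e2 \<in> nsets S 2" "e3 \<in> nsets S 2" "e4 \<in> nsets S 2"
    "distinct [e1,e2,e3]" "v \<in> e1" "v \<in> e2" "v \<in> e3" for e1 e2 e3 e4 v
  proof -
    obtain a b c where e: "e1 = {v,a}" "e2 = {v,b}" "e3 = {v,c}" "a \<noteq> v" "b \<noteq> v" "c \<noteq> v" "{v,a,b,c} \<subseteq> S"
      using nsets_2_containing[OF m(1,6)] nsets_2_containing[OF m(2,7)] nsets_2_containing[OF m(3,8)]
      by (metis empty_subsetI insert_subset)
    have d: "distinct [v,a,b,c]" using e(4-6) m(5) unfolding e(1-3) by auto
    obtain x y where e4: "e4 = {x,y}" "x \<noteq> y" using m(4) by (auto simp: nsets_def card_2_iff)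
    have "trop_vanishes3 (w {v,a} + br v b c + br v x y) (w {v,b} + br v a c + br v x y) (w {v,c} + br v a b + br v x y)"
      by (rule trop_vanishes3_add[OF rel3[OF e(7) d]])
    then have "trop_vanishes4 (w {v,a} + br v b c + br v x y) (w {v,b} + br v a c + br v x y)
        (w {v,c} + br v a b + br v x y) \<infinity>"
      by (rule trop_vanishes4_of_3)
    moreover have "w {x,y} + N3 {v,a} {v,b} {v,c} = \<infinity>"
      using e(4-6) by (simp add: N3_adj br_same)
    ultimately show ?thesis
      unfolding T_def e(1-3) e4(1) N3_adj[OF e(5,6) e4(2)] N3_adj[OF e(4,6) e4(2)] N3_adj[OF e(4,5) e4(2)]
      by (simp only: add.assoc add.commute[of "br v x y"])
  qed
  have T_rot: "T e1 e2 e3 e4" if "T e1 e3 e4 e2" for e1 e2 e3 e4 by (rule T_sym2[OF T_sym3[OF that]])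
  have T_rot': "T e1 e2 e3 e4" if "T e2 e3 e4 e1" for e1 e2 e3 e4 by (rule T_sym[OF T_rot[OF that]])
  \<comment> \<open>Unless three of the edges are concurrent, the meeting points \<open>p\<close>
    and \<open>q\<close> differ. Then the relation at \<open>p\<close> on \<open>a, c, q\<close> and
    the one at \<open>q\<close> on \<open>x, y, p\<close>, suitably shifted, share the term of the
    edge \<open>{p, q}\<close>, which is eliminated.\<close>
  have pairs: "T e1 e2 e3 e4" if m: "e1 \<in> nsets S 2" "e2 \<in> nsets S 2" "e3 \<in> nsets S 2" "e4 \<in> nsets S 2"
    "distinct [e1,e2,e3,e4]" "e1 \<inter> e2 \<noteq> {}" "e3 \<inter> e4 \<noteq> {}" for e1 e2 e3 e4
  proof (cases "\<exists>v. (v \<in> e1 \<and> v \<in> e2 \<and> v \<in> e3) \<or> (v \<in> e1 \<and> v \<in> e2 \<and> v \<in> e4) \<or> (v \<in> e1 \<and> v \<in> e3 \<and> v \<in> e4) \<or>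
      (v \<in> e2 \<and> v \<in> e3 \<and> v \<in> e4)")
    case True
    have d: "distinct [e1,e2,e3]" "distinct [e1,e2,e4]" "distinct [e1,e3,e4]" "distinct [e2,e3,e4]" using m(5) by auto
    from True show ?thesis
      using star[OF m(1,2,3,4) d(1)] T_sym3[OF star[OF m(1,2,4,3) d(2)]]
        T_rot[OF star[OF m(1,3,4,2) d(3)]] T_rot'[OF star[OF m(2,3,4,1) d(4)]] by blast
  next
    case False
    obtain p q where p: "p \<in> e1" "p \<in> e2" and q: "q \<in> e3" "q \<in> e4" using m(6,7) by blast
    obtain a c where ac: "e1 = {p,a}" "e2 = {p,c}" "a \<noteq> p" "c \<noteq> p" "{p,a,c} \<subseteq> S"
      using nsets_2_containing[OF m(1) p(1)] nsets_2_containing[OF m(2) p(2)] by (metis empty_subsetI insert_subset)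
    obtain x y where xy: "e3 = {q,x}" "e4 = {q,y}" "x \<noteq> q" "y \<noteq> q" "{q,x,y} \<subseteq> S"
      using nsets_2_containing[OF m(3) q(1)] nsets_2_containing[OF m(4) q(2)] by (metis empty_subsetI insert_subset)
    have "p \<noteq> q" "p \<noteq> x" "p \<noteq> y" using False p q unfolding xy(1,2) by auto
    moreover have "q \<noteq> a" "q \<noteq> c" using False p q unfolding ac(1,2) by auto
    moreover have "a \<noteq> c" "x \<noteq> y" using m(5) unfolding ac(1,2) xy(1,2) by auto
    ultimately have ne: "p \<noteq> q" "p \<noteq> x" "p \<noteq> y" "q \<noteq> a" "q \<noteq> c" "a \<noteq> c" "x \<noteq> y" by auto
    have d: "distinct [p,a,c,q]" "distinct [q,x,y,p]" using ne ac(3,4) xy(3,4) by auto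
    have "{p,a,c,q} \<subseteq> S" "{q,x,y,p} \<subseteq> S" using ac(5) xy(5) by auto
    then have r1: "trop_vanishes3 (w {p,a} + br p c q + br q x y) (w {p,c} + br p a q + br q x y) (w {p,q} + br p a c + br q x y)"
      and r2: "trop_vanishes3 (w {q,x} + br q y p + br p a c) (w {q,y} + br q x p + br p a c) (w {q,p} + br q x y + br p a c)"
      using trop_vanishes3_add[OF rel3[OF _ d(1)], of "br q x y"] trop_vanishes3_add[OF rel3[OF _ d(2)], of "br p a c"] by auto
    have "w {q,p} + br q x y + br p a c = w {p,q} + br p a c + br q x y"
      by (simp only: insert_commute[of q p "{}"] add.assoc add.commute[of "br q x y"])
    with r2 have r2': "trop_vanishes3 (w {q,x} + br q y p + br p a c) (w {q,y} + br q x p + br p a c) (w {p,q} + br p a c + br q x y)"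
      by (simp only:)
    have e1: "N3 e2 e3 e4 = br p c q + br q x y" unfolding ac(2) xy(1,2)
      by (simp only: N3_rot[of "{p,c}"] N3_adj[OF xy(3,4) ac(4)[symmetric]] br_rot[of q p c])
    have e2: "N3 e1 e3 e4 = br p a q + br q x y" unfolding ac(1) xy(1,2)
      by (simp only: N3_rot[of "{p,a}"] N3_adj[OF xy(3,4) ac(3)[symmetric]] br_rot[of q p a])
    have e3: "N3 e1 e2 e4 = br q y p + br p a c" unfolding ac(1,2) xy(2)
      by (simp only: N3_adj[OF ac(3,4) xy(4)[symmetric]] br_rot[of p q y])
    have e4: "N3 e1 e2 e3 = br q x p + br p a c" unfolding ac(1,2) xy(1)
      by (simp only: N3_adj[OF ac(3,4) xy(3)[symmetric]] br_rot[of p q x])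
    show ?thesis unfolding T_def e1 e2 e3 e4 unfolding ac(1,2) xy(1,2)
      using trop_vanishes3_eliminate[OF r1 r2'] by (simp only: add.assoc)
  qed
  \<comment> \<open>The other three edges form a triangle on the remaining vertices
    \<open>a\<close>, \<open>b\<close>, \<open>c\<close>. Every minor contains their bracket, and
    the relation is \<open>rel4\<close> with this bracket added.\<close>
  have triangle: "T e1 e2 e3 e4" if m: "e1 \<in> nsets S 2" "e2 \<in> nsets S 2" "e3 \<in> nsets S 2" "e4 \<in> nsets S 2"
    "distinct [e1,e2,e3,e4]" "e1 \<inter> e2 = {}" "e1 \<inter> e3 = {}" "e1 \<inter> e4 = {}" for e1 e2 e3 e4
  proof -
    obtain d e where de: "e1 = {d,e}" "d \<noteq> e" using m(1) by (auto simp: nsets_def card_2_iff)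
    let ?R = "S - e1"
    have eS: "e1 \<subseteq> S" "e2 \<subseteq> S" "e3 \<subseteq> S" "e4 \<subseteq> S" and c2: "card e1 = 2" "card e2 = 2" "card e3 = 2" "card e4 = 2"
      using m(1-4) by (simp_all add: nsets_def)
    have R: "e2 \<subseteq> ?R" "e3 \<subseteq> ?R" "e4 \<subseteq> ?R" using eS m(6-8) by blast+
    have Rfin: "finite ?R" "card ?R \<le> 3"
      using card_Diff_subset[OF finite_subset[OF eS(1) S(1)] eS(1)] S c2(1) by auto
    obtain a b where ab: "e2 = {a,b}" "a \<noteq> b" using c2(2) by (auto simp: card_2_iff)
    have "\<not> e3 \<subseteq> e2"
    proof
      assume "e3 \<subseteq> e2"
      from card_subset_eq[OF finite_subset[OF eS(2) S(1)] this] have "e3 = e2" using c2(2,3) by simp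
      then show False using m(5) by simp
    qed
    then obtain c where c: "c \<in> e3" "c \<notin> e2" by blast
    have abc: "distinct [a,b,c]" "{a,b,c} \<subseteq> ?R" using ab c R(1,2) by auto
    then have "card {a,b,c} = 3" by simp
    then have Req: "?R = {a,b,c}" using card_seteq[OF Rfin(1) abc(2)] Rfin(2) by simp
    have sub: "f = {a,b} \<or> f = {b,c} \<or> f = {a,c}" if f: "f \<subseteq> {a,b,c}" "card f = 2" for f
    proof -
      obtain s t where "f = {s,t}" "s \<noteq> t" using f(2) by (auto simp: card_2_iff)
      then show ?thesis using f(1) abc(1) by auto
    qed
    have e34: "(e3 = {b,c} \<and> e4 = {a,c}) \<or> (e3 = {a,c} \<and> e4 = {b,c})"
    proof -
      have "e2 \<noteq> e3" "e2 \<noteq> e4" "e3 \<noteq> e4" using m(5) by simp_all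
      then show ?thesis
        using sub[OF R(2)[unfolded Req] c2(3)] sub[OF R(3)[unfolded Req] c2(4)] ab(1) by metis
    qed
    have S5: "{a,b,c,d,e} \<subseteq> S" "distinct [a,b,c,d,e]"
      using abc eS(1) unfolding de(1) using de(2) by auto
    have ne: "b \<noteq> a" "c \<noteq> b" "c \<noteq> a" "a \<noteq> c" "b \<noteq> c" "a \<noteq> b" using abc by auto
    have n1: "N3 {a,b} {b,c} {a,c} = br a b c + br a b c"
      by (simp only: N3_sym(2)[of "{a,b}" "{b,c}" "{a,c}"] N3_adj[OF ne(1,3,5)])
    have n2: "N3 {d,e} {b,c} {a,c} = br c d e + br a b c"
      by (simp only: N3_rot[of "{d,e}"] insert_commute[of b c "{}"] insert_commute[of a c "{}"]
          N3_adj[OF ne(5,4) de(2)] br_rev[of c b a])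
    have n3: "N3 {d,e} {a,b} {a,c} = br a d e + br a b c"
      by (simp only: N3_rot[of "{d,e}"] N3_adj[OF ne(1,3) de(2)])
    have n4: "N3 {d,e} {a,b} {b,c} = br b d e + br a b c"
      by (simp only: N3_rot[of "{d,e}"] insert_commute[of a b "{}"] N3_adj[OF ne(6,2) de(2)] br_sym(1)[of b a c])
    have "trop_vanishes4 (w {d,e} + br a b c + br a b c) (w {b,c} + br a d e + br a b c)
        (w {a,c} + br b d e + br a b c) (w {a,b} + br c d e + br a b c)"
      by (rule trop_vanishes4_add[OF rel4[OF S5]])
    then have "T {d,e} {a,b} {b,c} {a,c}"
      unfolding T_def n1 n2 n3 n4 trop_vanishes4_def add.assoc by blast
    then show ?thesis using e34 T_sym3 unfolding de ab by blast
  qed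
  define W where "W = range (\<lambda>u e. vdot (C e) u)"
  have inW: "(\<lambda>e. vdot (C e) u) \<in> W" for u unfolding W_def by (rule rangeI)
  have "\<exists>v\<in>W. \<forall>e\<in>nsets S 2. val (v e) = w e"
  proof (rule tropical_point_lift[where r = 3 and N = N])
    show "finite (nsets S 2)" using S(1) by (rule finite_imp_finite_nsets)
    have "(\<lambda>e. vdot (C e) (0,0,0)) = (\<lambda>_. 0)"
    proof
      fix e show "vdot (C e) (0,0,0) = 0" by (cases "C e") simp
    qed
    then show "(\<lambda>_. 0) \<in> W" using inW[of "(0,0,0)"] by (simp only:)
  next
    fix v v' c assume "v \<in> W" "v' \<in> W"
    then obtain u u' where u: "v = (\<lambda>e. vdot (C e) u)" "v' = (\<lambda>e. vdot (C e) u')" unfolding W_def by blast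
    obtain u'' where lin: "\<And>x. vdot x u + c * vdot x u' = vdot x u''" using vdot_linear by blast
    show "(\<lambda>f. v f + c * v' f) \<in> W" unfolding u lin by (rule inW)
  next
    \<comment> \<open>The sides of a nondegenerate triangle are independent lines: their minor is
      the square of the bracket, up to sign.\<close>
    obtain a b c where abc: "a \<in> S" "b \<in> S" "c \<in> S" "vdet (P a) (P b) (P c) \<noteq> 0" using basis by blast
    have d: "b \<noteq> a" "c \<noteq> a" "b \<noteq> c" using abc(4) by (auto simp: vdet_same)
    have ne: "{a,b} \<noteq> {a,c}" "{a,b} \<noteq> {b,c}" "{a,c} \<noteq> {b,c}" using d by auto
    have "N {{a,b},{a,c},{b,c}} = br a b c + br a b c"
      unfolding N_eq[OF ne] by (rule N3_adj[OF d])
    then have "N {{a,b},{a,c},{b,c}} \<noteq> \<infinity>" using abc(4) unfolding br_def by simp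
    moreover have "{{a,b},{a,c},{b,c}} \<subseteq> nsets S 2" using abc(1-3) d by (auto simp: nsets_def)
    moreover have "card {{a,b},{a,c},{b,c}} = 3" using ne by simp
    ultimately show "\<exists>B\<subseteq>nsets S 2. card B = 3 \<and> N B \<noteq> \<infinity>" by blast
  next
    fix B :: "nat set set" assume "card B = 3"
    then obtain x y z where B: "B = {x,y,z}" "x \<noteq> y" "x \<noteq> z" "y \<noteq> z" by (auto simp: card_3_iff)
    show "N B \<noteq> -\<infinity>" unfolding B(1) N_eq[OF B(2-4)] N3_def by simp
  next
    fix B e assume m: "B \<subseteq> nsets S 2" "card B = 3" "N B \<noteq> \<infinity>" "e \<in> B"
    have "card (B - {e}) = 2" using m(2,4) by simp
    then obtain x y where xy: "B - {e} = {x,y}" "x \<noteq> y" by (auto simp: card_2_iff)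
    \<comment> \<open>The required vector is evaluation at the point in which the two remaining
      lines meet.\<close>
    have vf: "val (vdot (C f) (vcross (C x) (C y))) = (if f \<in> {x,y} then \<infinity> else N (insert f {x,y}))" for f
    proof (cases "f \<in> {x,y}")
      case True
      then show ?thesis using N3_same unfolding N3_def vdet_def by auto
    next
      case False
      then show ?thesis using N_eq[of f x y] xy(2) unfolding N3_def vdet_def by auto
    qed
    show "\<exists>v\<in>W. \<forall>f\<in>nsets S 2. val (v f) = (if f \<in> B - {e} then \<infinity> else N (insert f (B - {e})))"
      unfolding xy(1) by (rule bexI[OF _ inW[of "vcross (C x) (C y)"]]) (intro ballI vf)
  next
    fix J assume J: "J \<subseteq> nsets S 2" "card J = Suc 3"
    obtain e1 J' where J': "J = insert e1 J'" "e1 \<notin> J'" "card J' = 3" using J(2) card_Suc_eq[of J 3] by blast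
    obtain e2 e3 e4 where e: "J' = {e2,e3,e4}" "e2 \<noteq> e3" "e2 \<noteq> e4" "e3 \<noteq> e4" using J'(3) by (auto simp: card_3_iff)
    have m: "e1 \<in> nsets S 2" "e2 \<in> nsets S 2" "e3 \<in> nsets S 2" "e4 \<in> nsets S 2" using J(1) J'(1) e(1) by auto
    have ne: "e1 \<noteq> e2" "e1 \<noteq> e3" "e1 \<noteq> e4" using J'(2) e(1) by auto
    have ds: "distinct [e1,e2,e3,e4]" "distinct [e1,e3,e2,e4]" "distinct [e1,e4,e2,e3]"
      "distinct [e2,e1,e3,e4]" "distinct [e3,e1,e2,e4]" "distinct [e4,e1,e2,e3]" using ne e by auto
    have T: "T e1 e2 e3 e4"
      using four_edges_cases[OF S m]
    proof (elim disjE conjE)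
      assume "e1 \<inter> e2 \<noteq> {}" "e3 \<inter> e4 \<noteq> {}"
      then show ?thesis by (rule pairs[OF m ds(1)])
    next
      assume "e1 \<inter> e3 \<noteq> {}" "e2 \<inter> e4 \<noteq> {}"
      then have "T e1 e3 e2 e4" by (rule pairs[OF m(1,3,2,4) ds(2)])
      then show ?thesis by (rule T_sym2)
    next
      assume "e1 \<inter> e4 \<noteq> {}" "e2 \<inter> e3 \<noteq> {}"
      then have "T e1 e4 e2 e3" by (rule pairs[OF m(1,4,2,3) ds(3)])
      then have "T e1 e2 e4 e3" by (rule T_sym2)
      then show ?thesis by (rule T_sym3)
    next
      assume "e1 \<inter> e2 = {}" "e1 \<inter> e3 = {}" "e1 \<inter> e4 = {}"
      then show ?thesis by (rule triangle[OF m ds(1)])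
    next
      assume "e2 \<inter> e1 = {}" "e2 \<inter> e3 = {}" "e2 \<inter> e4 = {}"
      then have "T e2 e1 e3 e4" by (rule triangle[OF m(2,1,3,4) ds(4)])
      then show ?thesis by (rule T_sym)
    next
      assume "e3 \<inter> e1 = {}" "e3 \<inter> e2 = {}" "e3 \<inter> e4 = {}"
      then have "T e3 e1 e2 e4" by (rule triangle[OF m(3,1,2,4) ds(5)])
      then have "T e1 e3 e2 e4" by (rule T_sym)
      then show ?thesis by (rule T_sym2)
    next
      assume "e4 \<inter> e1 = {}" "e4 \<inter> e2 = {}" "e4 \<inter> e3 = {}"
      then have "T e4 e1 e2 e3" by (rule triangle[OF m(4,1,2,3) ds(6)])
      then have "T e1 e4 e2 e3" by (rule T_sym)
      then have "T e1 e2 e4 e3" by (rule T_sym2)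
      then show ?thesis by (rule T_sym3)
    qed
    have Jeq: "J = {e1,e2,e3,e4}" using J'(1) e(1) by simp
    have del: "J - {e1} = {e2,e3,e4}" "J - {e2} = {e1,e3,e4}" "J - {e3} = {e1,e2,e4}" "J - {e4} = {e1,e2,e3}"
      unfolding Jeq using ne e by auto
    have "trop_vanishes4 (w e1 + N (J - {e1})) (w e2 + N (J - {e2})) (w e3 + N (J - {e3})) (w e4 + N (J - {e4}))"
      using T unfolding T_def del N_eq[OF e(2-4)] N_eq[OF ne(2,3) e(4)] N_eq[OF ne(1,3) e(3)] N_eq[OF ne(1,2) e(2)] .
    then show "trop_vanishes (\<lambda>j. w j + N (J - {j})) J"
      using trop_vanishes_4[of e1 e2 e3 e4 "\<lambda>j. w j + N (J - {j})"] ne e(2-4) unfolding Jeq[symmetric] by blast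
  qed (rule w)
  then obtain u where u: "\<forall>e\<in>nsets S 2. val (vdot (C e) u) = w e" unfolding W_def by blast
  have "val (vdet (P a) (P b) u) = w {a,b}" if ab: "a \<in> S" "b \<in> S" "a \<noteq> b" for a b
  proof -
    have "{a,b} \<in> nsets S 2" using ab by (simp add: nsets_def)
    then have "val (vdot (C {a,b}) u) = w {a,b}" using u by blast
    moreover have "val (vdot (C {a,b}) u) = val (vdet (P a) (P b) u)"
    proof (cases "a < b")
      case True
      then have "Min {a,b} = a" "Max {a,b} = b" by auto
      then show ?thesis unfolding C_def by (simp add: vdot_vcross)
    next
      case False
      then have "Min {a,b} = b" "Max {a,b} = a" using ab by auto
      then show ?thesis unfolding C_def using vdet_swap(1)[of "P a" "P b" u] by (simp add: vdot_vcross)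
    qed
    ultimately show ?thesis by simp
  qed
  then show ?thesis by blast
qed

end

section \<open>Adding a point to a configuration on the line\<close>

fun pdet :: "'a::comm_ring_1 \<times> 'a \<Rightarrow> 'a \<times> 'a \<Rightarrow> 'a" where
  "pdet (a1,a2) (b1,b2) = a1 * b2 - a2 * b1"

lemma pdet_swap: "pdet b a = - pdet a b" and pdet_same: "pdet a a = 0"
  by (cases a; cases b; simp add: algebra_simps)+

lemma pdet_linear: "\<exists>u''. \<forall>x. pdet x u + c * pdet x u' = pdet x u''"
proof -
  obtain p q p' q' where u: "u = (p,q)" "u' = (p',q')" by (cases u; cases u') auto
  have "pdet x u + c * pdet x u' = pdet x (p + c * p', q + c * q')" for x
    unfolding u by (cases x) (simp add: algebra_simps)
  then show ?thesis by blast
qed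

context alg_closed_valuation
begin

text \<open>On the line the forms \<open>pdet (P a)\<close> correspond to the points themselves.
  Their minors are the brackets, and each circuit relation is one of the given three-term relations,
  for sets \<open>S\<close> of any finite size.\<close>

lemma line_point_extension:
  fixes P :: "nat \<Rightarrow> 'k \<times> 'k" and w :: "nat \<Rightarrow> ereal"
  defines "br \<equiv> \<lambda>i j. val (pdet (P i) (P j))"
  assumes S: "finite S"
    and basis: "\<exists>a\<in>S. \<exists>b\<in>S. pdet (P a) (P b) \<noteq> 0"
    and w: "\<And>a. a \<in> S \<Longrightarrow> w a \<noteq> -\<infinity>"
    and rel: "\<And>a b c. {a,b,c} \<subseteq> S \<Longrightarrow> distinct [a,b,c] \<Longrightarrow>
      trop_vanishes3 (w a + br b c) (w b + br a c) (w c + br a b)"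
  shows "\<exists>u. \<forall>a\<in>S. val (pdet (P a) u) = w a"
proof -
  \<comment> \<open>Minimum and maximum recover the two elements of a pair; their order is
    immaterial as \<open>br\<close> is symmetric.\<close>
  define N where "N T = br (Min T) (Max T)" for T
  have br_sym: "br j i = br i j" for i j
    unfolding br_def using pdet_swap[of "P i" "P j"] by simp
  have br_same: "br i i = \<infinity>" for i
    unfolding br_def by (simp add: pdet_same)
  have N_eq: "N {a,b} = br a b" if "a \<noteq> b" for a b
  proof (cases "a < b")
    case True
    then have "Min {a,b} = a" "Max {a,b} = b" by auto
    then show ?thesis unfolding N_def by simp
  next
    case False
    then have "Min {a,b} = b" "Max {a,b} = a" using that by auto
    then show ?thesis unfolding N_def using br_sym by simp
  qed
  define W where "W = range (\<lambda>u a. pdet (P a) u)"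
  have inW: "(\<lambda>a. pdet (P a) u) \<in> W" for u unfolding W_def by (rule rangeI)
  have "\<exists>v\<in>W. \<forall>e\<in>S. val (v e) = w e"
  proof (rule tropical_point_lift[where r = 2 and N = N])
    have "(\<lambda>a. pdet (P a) (0,0)) = (\<lambda>_. 0)"
    proof
      fix a show "pdet (P a) (0,0) = 0" by (cases "P a") simp
    qed
    then show "(\<lambda>_. 0) \<in> W" using inW[of "(0,0)"] by (simp only:)
  next
    fix v v' c assume "v \<in> W" "v' \<in> W"
    then obtain u u' where u: "v = (\<lambda>a. pdet (P a) u)" "v' = (\<lambda>a. pdet (P a) u')" unfolding W_def by blast
    obtain u'' where lin: "\<And>x. pdet x u + c * pdet x u' = pdet x u''" using pdet_linear by blast
    show "(\<lambda>f. v f + c * v' f) \<in> W" unfolding u lin by (rule inW)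
  next
    obtain a b where ab: "a \<in> S" "b \<in> S" "pdet (P a) (P b) \<noteq> 0" using basis by blast
    have ne: "a \<noteq> b" using ab(3) pdet_same[of "P a"] by metis
    have "N {a,b} \<noteq> \<infinity>" unfolding N_eq[OF ne] br_def using ab(3) by simp
    then show "\<exists>B\<subseteq>S. card B = 2 \<and> N B \<noteq> \<infinity>" using ab ne by (intro exI[of _ "{a,b}"]) simp
  next
    fix B show "N B \<noteq> -\<infinity>" unfolding N_def br_def by simp
  next
    fix B e assume m: "B \<subseteq> S" "card B = 2" "N B \<noteq> \<infinity>" "e \<in> B"
    have "card (B - {e}) = 1" using m(2,4) by simp
    then obtain x where x: "B - {e} = {x}" by (auto simp: card_1_singleton_iff)
    have vf: "val (pdet (P f) (P x)) = (if f \<in> {x} then \<infinity> else N (insert f {x}))" for f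
      using br_same[of x] N_eq[of f x] unfolding br_def by (cases "f = x") simp_all
    show "\<exists>v\<in>W. \<forall>f\<in>S. val (v f) = (if f \<in> B - {e} then \<infinity> else N (insert f (B - {e})))"
      unfolding x by (rule bexI[OF _ inW[of "P x"]]) (intro ballI vf)
  next
    fix J assume J: "J \<subseteq> S" "card J = Suc 2"
    then have "card J = 3" by simp
    then obtain a b c where e: "J = {a,b,c}" "a \<noteq> b" "a \<noteq> c" "b \<noteq> c" by (auto simp: card_3_iff)
    have del: "J - {a} = {b,c}" "J - {b} = {a,c}" "J - {c} = {a,b}" unfolding e(1) using e(2-4) by auto
    have "trop_vanishes3 (w a + N (J - {a})) (w b + N (J - {b})) (w c + N (J - {c}))"
      unfolding del N_eq[OF e(2)] N_eq[OF e(3)] N_eq[OF e(4)]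
      using rel[of a b c] J(1) e by simp
    then show "trop_vanishes (\<lambda>j. w j + N (J - {j})) J"
      using trop_vanishes_3[OF e(2-4), of "\<lambda>j. w j + N (J - {j})"] unfolding e(1)[symmetric] by blast
  qed (use S w in auto)
  then show ?thesis unfolding W_def by blast
qed

section \<open>Realizations of ranks 2 and 3\<close>

lemma det_cols_mat_2:
  assumes "A \<in> carrier_mat 2 n"
  shows "det (cols_mat A [i,j]) = pdet (A $$ (0,i), A $$ (1,i)) (A $$ (0,j), A $$ (1,j))"
proof -
  let ?M = "cols_mat A [i,j]"
  have M: "?M \<in> carrier_mat 2 2" using cols_mat_carrier[of A "[i,j]"] assms by (simp add: numeral_2_eq_2)
  have "det ?M = (\<Sum>k<2. ?M $$ (k,0) * cofactor ?M k 0)" by (rule laplace_expansion_column[OF M]) simp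
  moreover have "det (mat_delete ?M k 0) = A $$ (1 - k, j)" if "k < 2" for k
  proof -
    have "mat_delete ?M k 0 \<in> carrier_mat 1 1" using mat_delete_carrier[OF M, of k 0] by simp
    then have "det (mat_delete ?M k 0) = mat_delete ?M k 0 $$ (0,0)" by (rule det_single)
    also have "\<dots> = A $$ (1 - k, j)" using that assms by (cases "k = 0") (auto simp: mat_delete_def cols_mat_def less_2_cases_iff)
    finally show ?thesis .
  qed
  ultimately show ?thesis using assms
    by (simp add: cofactor_def cols_mat_def numeral_2_eq_2 algebra_simps)
qed

lemma det_cols_mat_3:
  assumes "A \<in> carrier_mat 3 n"
  defines "P \<equiv> \<lambda>j. (A $$ (0,j), A $$ (1,j), A $$ (2,j))"
  shows "det (cols_mat A [i,j,k]) = vdet (P i) (P j) (P k)"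
proof -
  let ?M = "cols_mat A [i,j,k]"
  have M: "?M \<in> carrier_mat 3 3" using cols_mat_carrier[of A "[i,j,k]"] assms(1) by (simp add: numeral_3_eq_3)
  have "det ?M = (\<Sum>l<3. ?M $$ (l,0) * cofactor ?M l 0)" by (rule laplace_expansion_column[OF M]) simp
  also have "\<dots> = ?M $$ (0,0) * cofactor ?M 0 0 + ?M $$ (1,0) * cofactor ?M 1 0 + ?M $$ (2,0) * cofactor ?M 2 0"
    by (simp add: numeral_3_eq_3 numeral_2_eq_2)
  finally have det: "det ?M = ?M $$ (0,0) * cofactor ?M 0 0 + ?M $$ (1,0) * cofactor ?M 1 0 + ?M $$ (2,0) * cofactor ?M 2 0" .
  define D where "D l = mat_delete ?M l 0" for l
  have D: "D l \<in> carrier_mat 2 2" for l unfolding D_def using mat_delete_carrier[OF M, of l 0] by simp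
  have "det (D l) = pdet (D l $$ (0,0), D l $$ (1,0)) (D l $$ (0,1), D l $$ (1,1))" for l
  proof -
    have "cols_mat (D l) [0,1] = D l"
      using D[of l] by (intro eq_matI) (auto simp: cols_mat_def less_2_cases_iff)
    then show ?thesis using det_cols_mat_2[OF D, of l 0 1] by simp
  qed
  moreover have "D l $$ (r,s) = A $$ (if r < l then r else Suc r, [j,k] ! s)" if "r < 2" "s < 2" for l r s
    using that M assms(1) by (auto simp: D_def mat_delete_def cols_mat_def)
  ultimately have dD: "det (D l) = pdet (A $$ (if 0 < l then 0 else 1, j), A $$ (if 1 < l then 1 else 2, j))
      (A $$ (if 0 < l then 0 else 1, k), A $$ (if 1 < l then 1 else 2, k))" for l
    by (simp add: numeral_2_eq_2)
  have "?M $$ (l,0) = A $$ (l,i)" if "l < 3" for l using that assms(1) by (simp add: cols_mat_def)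
  then show ?thesis unfolding det cofactor_def D_def[symmetric] dD P_def vdet_def
    by (simp add: algebra_simps)
qed

text \<open>The columns are points of the line, added one at a time to a pair with finite
  \<open>\<mu> {a, b}\<close>. The brackets among the old points already have the values of
  \<open>\<mu>\<close>, so the condition on a new point is a three-term Pluecker relation.\<close>

lemma realize_rank_2:
  assumes \<mu>: "\<mu> \<in> nsets {..<n} 2 \<rightarrow> TT" "\<exists>I\<in>nsets {..<n} 2. \<mu> I \<noteq> \<infinity>"
    and gp: "trop_grassmann_plucker n 2 \<mu>"
  shows "\<exists>A. realizes A 2 n \<mu>"
proof -
  obtain a b where ab: "a < n" "b < n" "a \<noteq> b" "\<mu> {a,b} \<noteq> \<infinity>"
    using \<mu>(2) by (auto simp: nsets_def card_2_iff)
  have pair: "{i,j} \<in> nsets {..<n} 2" if "i < n" "j < n" "i \<noteq> j" for i j using that by (simp add: nsets_def)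
  have MI: "\<mu> {i,j} \<noteq> -\<infinity>" if "i < n" "j < n" "i \<noteq> j" for i j
    using funcset_mem[OF \<mu>(1) pair[OF that]] by (simp add: TT_def)
  have ind: "\<exists>P. \<forall>i\<in>F \<union> {a,b}. \<forall>j\<in>F \<union> {a,b}. i \<noteq> j \<longrightarrow> val (pdet (P i) (P j)) = \<mu> {i,j}"
    if "finite F" "F \<subseteq> {..<n} - {a,b}" for F
    using that
  proof (induction F)
    case empty
    obtain t where t: "val t = \<mu> {a,b}" using ex_val[OF MI[OF ab(1-3)]] by blast
    let ?P = "\<lambda>i. if i = a then (t,0) else (0,1)"
    have "val (pdet (?P i) (?P j)) = \<mu> {i,j}" if ij: "i \<in> {a,b}" "j \<in> {a,b}" "i \<noteq> j" for i j
    proof -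
      consider "i = a" "j = b" | "i = b" "j = a" using ij by blast
      then show ?thesis
      proof cases
        case 1
        then show ?thesis using ab(3) t by simp
      next
        case 2
        then show ?thesis using ab(3) t insert_commute[of b a "{}"] by simp
      qed
    qed
    then show ?case by (intro exI[of _ ?P]) simp
  next
    case (insert x F)
    let ?S = "F \<union> {a,b}"
    obtain P where P: "\<And>i j. i \<in> ?S \<Longrightarrow> j \<in> ?S \<Longrightarrow> i \<noteq> j \<Longrightarrow> val (pdet (P i) (P j)) = \<mu> {i,j}"
      using insert.IH insert.prems by blast
    have xS: "x \<notin> ?S" "x < n" using insert by auto
    have Sn: "?S \<subseteq> {..<n}" using insert.prems ab(1,2) by auto
    have "\<exists>u. \<forall>i\<in>?S. val (pdet (P i) u) = \<mu> {x,i}"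
    proof (rule line_point_extension)
      show "\<exists>i\<in>?S. \<exists>j\<in>?S. pdet (P i) (P j) \<noteq> 0"
        using P[of a b] ab(3,4) by (intro bexI[of _ a] bexI[of _ b]) (auto simp flip: val_eq_PInf)
      show "\<mu> {x,i} \<noteq> -\<infinity>" if "i \<in> ?S" for i
        using MI[of x i] that xS Sn by blast
      fix i j k assume ijk: "{i,j,k} \<subseteq> ?S" "distinct [i,j,k]"
      have d: "distinct [x,i,j,k]" using ijk xS(1) by auto
      have sub: "{x,i,j,k} \<subseteq> {..<n}" using ijk xS(2) Sn by auto
      have "trop_vanishes3 (\<mu> {x,i} + \<mu> {j,k}) (\<mu> {x,j} + \<mu> {i,k}) (\<mu> {x,k} + \<mu> {i,j})"
        by (rule grassmann_plucker_rank_2[OF gp sub d])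
      moreover have "val (pdet (P j) (P k)) = \<mu> {j,k}" "val (pdet (P i) (P k)) = \<mu> {i,k}" "val (pdet (P i) (P j)) = \<mu> {i,j}"
        using ijk by (auto intro!: P)
      ultimately show "trop_vanishes3 (\<mu> {x,i} + val (pdet (P j) (P k))) (\<mu> {x,j} + val (pdet (P i) (P k)))
          (\<mu> {x,k} + val (pdet (P i) (P j)))" by simp
    qed (use insert in simp)
    then obtain u where u: "\<And>i. i \<in> ?S \<Longrightarrow> val (pdet (P i) u) = \<mu> {x,i}" by blast
    let ?Q = "P(x := u)"
    have "val (pdet (?Q i) (?Q j)) = \<mu> {i,j}" if ij: "i \<in> insert x ?S" "j \<in> insert x ?S" "i \<noteq> j" for i j
    proof -
      consider "i \<in> ?S" "j \<in> ?S" | "i \<in> ?S" "j = x" | "i = x" "j \<in> ?S" using ij by blast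
      then show ?thesis
      proof cases
        case 1
        then have "i \<noteq> x" "j \<noteq> x" using xS(1) by blast+
        then show ?thesis using P[OF 1 ij(3)] by simp
      next
        case 2
        then have "i \<noteq> x" using xS(1) by blast
        then show ?thesis using u[OF 2(1)] 2 insert_commute[of x i "{}"] by simp
      next
        case 3
        then have "j \<noteq> x" using xS(1) by blast
        then show ?thesis using u[OF 3(2)] 3 pdet_swap[of u "P j"] by simp
      qed
    qed
    then show ?case unfolding Un_insert_left by blast
  qed
  have eq: "({..<n} - {a,b}) \<union> {a,b} = {..<n}" using ab by auto
  obtain P where "\<forall>i\<in>{..<n}. \<forall>j\<in>{..<n}. i \<noteq> j \<longrightarrow> val (pdet (P i) (P j)) = \<mu> {i,j}"
    using ind[OF finite_Diff[OF finite_lessThan] subset_refl] unfolding eq by blast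
  then have P: "\<And>i j. i < n \<Longrightarrow> j < n \<Longrightarrow> i \<noteq> j \<Longrightarrow> val (pdet (P i) (P j)) = \<mu> {i,j}" by simp
  define A where "A = mat 2 n (\<lambda>(i,j). if i = 0 then fst (P j) else snd (P j))"
  have A: "A \<in> carrier_mat 2 n" by (simp add: A_def)
  have "\<mu> I = val (minor A I) + ereal 0" if I: "I \<in> nsets {..<n} 2" for I
  proof -
    obtain i j where ij: "I = {i,j}" "i \<noteq> j" "i < n" "j < n" using I by (auto simp: nsets_def card_2_iff)
    have "val (minor A (set [i,j])) = val (det (cols_mat A [i,j]))"
      using ij by (intro val_minor_set[OF A]) auto
    also have "\<dots> = \<mu> I" unfolding det_cols_mat_2[OF A] using P[OF ij(3,4,2)] ij by (simp add: A_def)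
    finally show ?thesis using ij(1) by simp
  qed
  then have "realizes A 2 n \<mu>" unfolding realizes_def using A by blast
  then show ?thesis by blast
qed

text \<open>As in rank 2 the points are placed one by one. Before the last of five points at most
  four are present, so \<open>plane_point_extension\<close> only asks for three-term relations,
  which are the Pluecker relations with a common element \<open>v\<close>.\<close>

lemma realize_rank_3:
  assumes n: "n \<le> 5" and \<nu>: "\<nu> \<in> nsets {..<n} 3 \<rightarrow> TT" "\<exists>I\<in>nsets {..<n} 3. \<nu> I \<noteq> \<infinity>"
    and gp: "trop_grassmann_plucker n 3 \<nu>"
  shows "\<exists>A. realizes A 3 n \<nu>"
proof -
  obtain a b c where abc: "a < n" "b < n" "c < n" "a \<noteq> b" "a \<noteq> c" "b \<noteq> c" "\<nu> {a,b,c} \<noteq> \<infinity>"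
    using \<nu>(2) by (auto simp: nsets_def card_3_iff)
  have MI: "\<nu> {i,j,k} \<noteq> -\<infinity>" if "i < n" "j < n" "k < n" "i \<noteq> j" "i \<noteq> k" "j \<noteq> k" for i j k
    using funcset_mem[OF \<nu>(1), of "{i,j,k}"] that by (simp add: nsets_def TT_def)
  define good where "good P S \<longleftrightarrow> (\<forall>i\<in>S. \<forall>j\<in>S. \<forall>k\<in>S. i \<noteq> j \<longrightarrow> i \<noteq> k \<longrightarrow> j \<noteq> k \<longrightarrow>
    val (vdet (P i) (P j) (P k)) = \<nu> {i,j,k})" for P :: "nat \<Rightarrow> 'k vec3" and S
  have ind: "\<exists>P. good P (F \<union> {a,b,c})" if "finite F" "F \<subseteq> {..<n} - {a,b,c}" for F
    using that
  proof (induction F)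
    case empty
    obtain t where t: "val t = \<nu> {a,b,c}" using ex_val[OF MI[OF abc(1-6)]] by blast
    define Q :: "nat \<Rightarrow> 'k vec3" where "Q i = (if i = a then (t,0,0) else if i = b then (0,1,0) else (0,0,1))" for i
    have det: "vdet (Q a) (Q b) (Q c) = t" using abc(4-6) by (simp add: vdet_def Q_def)
    have sym: "val (vdet v u x) = val (vdet u v x)" "val (vdet u x v) = val (vdet u v x)" for u v x
      using vdet_swap[of u v x] by simp_all
    have "val (vdet (Q i) (Q j) (Q k)) = \<nu> {i,j,k}"
      if ijk: "i \<in> {a,b,c}" "j \<in> {a,b,c}" "k \<in> {a,b,c}" "i \<noteq> j" "i \<noteq> k" "j \<noteq> k" for i j k
    proof -
      have eq: "{a,b,c} = {i,j,k}"
        using card_seteq[of "{a,b,c}" "{i,j,k}"] ijk abc(4-6) by simp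
      have "val (vdet (Q i) (Q j) (Q k)) = val (vdet (Q a) (Q b) (Q c))"
        using set_3_eq_perm[OF eq abc(4-6)] by (elim disjE conjE) (simp_all only: sym)
      then show ?thesis using t eq det by simp
    qed
    then show ?case unfolding good_def by (intro exI[of _ Q]) simp
  next
    case (insert x F)
    let ?S = "F \<union> {a,b,c}"
    obtain P where "good P ?S" using insert.IH insert.prems by blast
    then have P: "\<And>i j k. i \<in> ?S \<Longrightarrow> j \<in> ?S \<Longrightarrow> k \<in> ?S \<Longrightarrow> i \<noteq> j \<Longrightarrow> i \<noteq> k \<Longrightarrow> j \<noteq> k \<Longrightarrow>
        val (vdet (P i) (P j) (P k)) = \<nu> {i,j,k}" unfolding good_def by blast
    have xS: "x \<notin> ?S" "x < n" using insert by auto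
    have Sn: "?S \<subseteq> {..<n}" using insert.prems abc(1-3) by auto
    have finS: "finite ?S" using insert by simp
    have "insert x ?S \<subseteq> {..<n}" using Sn xS(2) by simp
    then have "card (insert x ?S) \<le> n" using card_mono[of "{..<n}"] by force
    then have cardS: "card ?S \<le> 4" using xS(1) finS n by simp
    have "\<exists>u. \<forall>i\<in>?S. \<forall>j\<in>?S. i \<noteq> j \<longrightarrow> val (vdet (P i) (P j) u) = \<nu> (insert x {i,j})"
    proof (rule plane_point_extension[where w = "\<lambda>e. \<nu> (insert x e)", OF finS])
      show "card ?S \<le> 5" using cardS by simp
      have "vdet (P a) (P b) (P c) \<noteq> 0" using P[of a b c] abc(4-7) by (simp flip: val_eq_PInf)
      then show "\<exists>i\<in>?S. \<exists>j\<in>?S. \<exists>k\<in>?S. vdet (P i) (P j) (P k) \<noteq> 0" by blast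
      show "\<nu> (insert x e) \<noteq> -\<infinity>" if e: "e \<in> nsets ?S 2" for e
      proof -
        obtain i j where ij: "e = {i,j}" "i \<noteq> j" "i \<in> ?S" "j \<in> ?S" using e by (auto simp: nsets_def card_2_iff)
        show ?thesis unfolding ij(1) using ij(2-4) xS Sn by (intro MI) blast+
      qed
      fix v i j k assume ijk: "{v,i,j,k} \<subseteq> ?S" "distinct [v,i,j,k]"
      have ne: "v \<noteq> i" "v \<noteq> j" "v \<noteq> k" "i \<noteq> j" "i \<noteq> k" "j \<noteq> k" using ijk(2) by auto
      have d: "distinct [v,x,i,j,k]" using ijk xS(1) by auto
      have sub: "{v,x,i,j,k} \<subseteq> {..<n}" using ijk xS(2) Sn by auto
      have m: "v \<in> ?S" "i \<in> ?S" "j \<in> ?S" "k \<in> ?S" using ijk(1) by auto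
      show "trop_vanishes3 (\<nu> (insert x {v,i}) + val (vdet (P v) (P j) (P k)))
          (\<nu> (insert x {v,j}) + val (vdet (P v) (P i) (P k))) (\<nu> (insert x {v,k}) + val (vdet (P v) (P i) (P j)))"
        unfolding P[OF m(1,3,4) ne(2,3,6)] P[OF m(1,2,4) ne(1,3,5)] P[OF m(1,2,3) ne(1,2,4)] insert_commute[of x v]
        by (rule grassmann_plucker_rank_3[OF gp sub d])
    next
      fix a' b' c' d' e' assume *: "{a',b',c',d',e'} \<subseteq> ?S" "distinct [a',b',c',d',e']"
      have "card {a',b',c',d',e'} = 5" using *(2) by simp
      then have False using card_mono[OF finS *(1)] cardS by simp
      then show "trop_vanishes4 (\<nu> (insert x {d',e'}) + val (vdet (P a') (P b') (P c')))
          (\<nu> (insert x {b',c'}) + val (vdet (P a') (P d') (P e'))) (\<nu> (insert x {a',c'}) + val (vdet (P b') (P d') (P e')))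
          (\<nu> (insert x {a',b'}) + val (vdet (P c') (P d') (P e')))" ..
    qed
    then obtain u where u: "\<And>i j. i \<in> ?S \<Longrightarrow> j \<in> ?S \<Longrightarrow> i \<noteq> j \<Longrightarrow> val (vdet (P i) (P j) u) = \<nu> {x,i,j}"
      by blast
    let ?Q = "P(x := u)"
    have "val (vdet (?Q i) (?Q j) (?Q k)) = \<nu> {i,j,k}"
      if ijk: "i \<in> insert x ?S" "j \<in> insert x ?S" "k \<in> insert x ?S" "i \<noteq> j" "i \<noteq> k" "j \<noteq> k" for i j k
    proof -
      have Q: "?Q l = P l" if "l \<in> ?S" for l using that xS(1) by auto
      have Qx: "?Q x = u" by simp
      consider "i \<in> ?S" "j \<in> ?S" "k \<in> ?S" | "i \<in> ?S" "j \<in> ?S" "k = x" | "i \<in> ?S" "j = x" "k \<in> ?S" | "i = x" "j \<in> ?S" "k \<in> ?S"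
        using ijk by blast
      then show ?thesis
      proof cases
        case 1
        show ?thesis unfolding Q[OF 1(1)] Q[OF 1(2)] Q[OF 1(3)] by (rule P[OF 1 ijk(4-6)])
      next
        case 2
        have "{i,j,k} = {x,i,j}" unfolding 2(3) by auto
        then show ?thesis unfolding Q[OF 2(1)] Q[OF 2(2)] 2(3) Qx using u[OF 2(1,2) ijk(4)] by simp
      next
        case 3
        have "{i,j,k} = {x,i,k}" unfolding 3(2) by auto
        then show ?thesis unfolding Q[OF 3(1)] Q[OF 3(3)] 3(2) Qx
          using u[OF 3(1,3) ijk(5)] vdet_swap(2)[of "P i" u "P k"] by simp
      next
        case 4
        have "vdet u (P j) (P k) = vdet (P j) (P k) u"
          using vdet_swap(1)[of u "P j" "P k"] vdet_swap(2)[of "P j" "P k" u] by simp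
        then show ?thesis unfolding Q[OF 4(2)] Q[OF 4(3)] 4(1) Qx using u[OF 4(2,3) ijk(6)] by simp
      qed
    qed
    then have "good ?Q (insert x F \<union> {a,b,c})" unfolding good_def Un_insert_left by blast
    then show ?case by blast
  qed
  have eq: "({..<n} - {a,b,c}) \<union> {a,b,c} = {..<n}" using abc by auto
  obtain P where "good P {..<n}"
    using ind[OF finite_Diff[OF finite_lessThan] subset_refl] unfolding eq by blast
  then have P: "\<And>i j k. i < n \<Longrightarrow> j < n \<Longrightarrow> k < n \<Longrightarrow> i \<noteq> j \<Longrightarrow> i \<noteq> k \<Longrightarrow> j \<noteq> k \<Longrightarrow>
      val (vdet (P i) (P j) (P k)) = \<nu> {i,j,k}" unfolding good_def by simp
  define A where "A = mat 3 n (\<lambda>(i,j). if i = 0 then fst (P j) else if i = 1 then fst (snd (P j)) else snd (snd (P j)))"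
  have A: "A \<in> carrier_mat 3 n" by (simp add: A_def)
  have AP: "(A $$ (0,j), A $$ (1,j), A $$ (2,j)) = P j" if "j < n" for j using that by (simp add: A_def)
  have "\<nu> I = val (minor A I) + ereal 0" if I: "I \<in> nsets {..<n} 3" for I
  proof -
    obtain i j k where ijk: "I = {i,j,k}" "i < n" "j < n" "k < n" "i \<noteq> j" "i \<noteq> k" "j \<noteq> k"
      using I by (auto simp: nsets_def card_3_iff)
    have "val (minor A (set [i,j,k])) = val (det (cols_mat A [i,j,k]))"
      using ijk by (intro val_minor_set[OF A]) auto
    also have "\<dots> = \<nu> I" unfolding det_cols_mat_3[OF A] AP[OF ijk(2)] AP[OF ijk(3)] AP[OF ijk(4)] ijk(1)
      by (rule P[OF ijk(2-7)])
    finally show ?thesis using ijk(1) by simp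
  qed
  then have "realizes A 3 n \<nu>" unfolding realizes_def using A by blast
  then show ?thesis by blast
qed

text \<open>By the Binet-Cauchy identity the left side is
  \<open>vdot (vcross x x') (vcross a b)\<close>. Hence \<open>x\<close> and \<open>x'\<close> must
  span the plane orthogonal to \<open>u\<close>, and \<open>l\<close> is the nonzero coordinate of
  \<open>u\<close> by which the basis is chosen.\<close>

lemma ex_orthogonal_pair:
  fixes u :: "'a::field vec3"
  assumes "u \<noteq> (0,0,0)"
  shows "\<exists>x x' l. l \<noteq> 0 \<and> (\<forall>a b. vdot x a * vdot x' b - vdot x b * vdot x' a = l * vdet a b u)"
proof -
  obtain p q r where u: "u = (p,q,r)" by (cases u) auto
  consider "r \<noteq> 0" | "q \<noteq> 0" | "p \<noteq> 0" using assms u by auto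
  then show ?thesis
  proof cases
    case 1
    have "vdot (r,0,-p) a * vdot (0,r,-q) b - vdot (r,0,-p) b * vdot (0,r,-q) a = r * vdet a b u" for a b
      unfolding u by (cases a; cases b) (simp add: vdet_def algebra_simps)
    then show ?thesis using 1 by blast
  next
    case 2
    have "vdot (0,-r,q) a * vdot (q,-p,0) b - vdot (0,-r,q) b * vdot (q,-p,0) a = q * vdet a b u" for a b
      unfolding u by (cases a; cases b) (simp add: vdet_def algebra_simps)
    then show ?thesis using 2 by blast
  next
    case 3
    have "vdot (-q,p,0) a * vdot (-r,0,p) b - vdot (-q,p,0) b * vdot (-r,0,p) a = p * vdet a b u" for a b
      unfolding u by (cases a; cases b) (simp add: vdet_def algebra_simps)
    then show ?thesis using 3 by blast
  qed
qed

text \<open>The functionals that vanish at a point \<open>u\<close>, evaluated at the columns of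
  \<open>B\<close>, form a rank 2 subspace of its row space, with Pluecker coordinates proportional
  to \<open>vdet (P a) (P b) u\<close>. So the subspace amounts to a further point of the
  configuration, and its condition \<open>rel4\<close> is
  \<open>incidence_plucker_2_3_dual_four_terms\<close>.\<close>

lemma realize_rank_2_below_3:
  assumes n: "n \<le> 5" and B: "realizes B 3 n \<nu>"
    and \<nu>: "\<nu> \<in> nsets {..<n} 3 \<rightarrow> TT" "\<exists>I\<in>nsets {..<n} 3. \<nu> I \<noteq> \<infinity>"
    and \<mu>: "\<mu> \<in> nsets {..<n} 2 \<rightarrow> TT" "\<exists>I\<in>nsets {..<n} 2. \<mu> I \<noteq> \<infinity>"
    and gp: "trop_grassmann_plucker n 2 \<mu>" "trop_grassmann_plucker n 3 \<nu>"
    and inc: "trop_incidence_plucker n 2 3 \<mu> \<nu>"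
  shows "\<exists>A. realizes A 2 n \<mu> \<and> (\<exists>X\<in>carrier_mat 2 3. A = X * B)"
proof -
  obtain c where Bc: "B \<in> carrier_mat 3 n" and c: "\<And>I. I \<in> nsets {..<n} 3 \<Longrightarrow> \<nu> I = val (minor B I) + ereal c"
    using B unfolding realizes_def by blast
  define P where "P j = (B $$ (0,j), B $$ (1,j), B $$ (2,j))" for j
  have br: "\<nu> {i,j,k} = val (vdet (P i) (P j) (P k)) + ereal c"
    if "i < n" "j < n" "k < n" "i \<noteq> j" "i \<noteq> k" "j \<noteq> k" for i j k
  proof -
    have "val (minor B (set [i,j,k])) = val (det (cols_mat B [i,j,k]))"
      using that by (intro val_minor_set[OF Bc]) auto
    also have "\<dots> = val (vdet (P i) (P j) (P k))" unfolding det_cols_mat_3[OF Bc] P_def ..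
    finally show ?thesis using c[of "{i,j,k}"] that by (simp add: nsets_def)
  qed
  have "\<exists>u. \<forall>a\<in>{..<n}. \<forall>b\<in>{..<n}. a \<noteq> b \<longrightarrow> val (vdet (P a) (P b) u) = \<mu> {a,b}"
  proof (rule plane_point_extension)
    obtain i j k where ijk: "i < n" "j < n" "k < n" "i \<noteq> j" "i \<noteq> k" "j \<noteq> k" "\<nu> {i,j,k} \<noteq> \<infinity>"
      using \<nu>(2) by (auto simp: nsets_def card_3_iff)
    then have "vdet (P i) (P j) (P k) \<noteq> 0" using br[OF ijk(1-6)] by auto
    then show "\<exists>a\<in>{..<n}. \<exists>b\<in>{..<n}. \<exists>c\<in>{..<n}. vdet (P a) (P b) (P c) \<noteq> 0" using ijk by blast
    show "\<mu> e \<noteq> -\<infinity>" if "e \<in> nsets {..<n} 2" for e using funcset_mem[OF \<mu>(1) that] by (simp add: TT_def)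
  next
    fix v i j k assume s: "{v,i,j,k} \<subseteq> {..<n}" "distinct [v,i,j,k]"
    have lt: "v < n" "i < n" "j < n" "k < n" using s(1) by auto
    have ne: "v \<noteq> i" "v \<noteq> j" "v \<noteq> k" "i \<noteq> j" "i \<noteq> k" "j \<noteq> k" using s(2) by auto
    have "trop_vanishes3 (\<mu> {v,i} + \<nu> {v,j,k}) (\<mu> {v,j} + \<nu> {v,i,k}) (\<mu> {v,k} + \<nu> {v,i,j})"
      by (rule incidence_plucker_2_3_three_terms[OF inc s])
    then show "trop_vanishes3 (\<mu> {v,i} + val (vdet (P v) (P j) (P k))) (\<mu> {v,j} + val (vdet (P v) (P i) (P k)))
        (\<mu> {v,k} + val (vdet (P v) (P i) (P j)))"
      unfolding br[OF lt(1,3,4) ne(2,3,6)] br[OF lt(1,2,4) ne(1,3,5)] br[OF lt(1,2,3) ne(1,2,4)]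
        add.assoc[symmetric] trop_vanishes3_add_real_iff .
  next
    fix a b c' d e assume s: "{a,b,c',d,e} \<subseteq> {..<n}" "distinct [a,b,c',d,e]"
    have lt: "a < n" "b < n" "c' < n" "d < n" "e < n" using s(1) by auto
    have ne: "a \<noteq> b" "a \<noteq> c'" "b \<noteq> c'" "a \<noteq> d" "a \<noteq> e" "d \<noteq> e" "b \<noteq> d" "b \<noteq> e" "c' \<noteq> d" "c' \<noteq> e" using s(2) by auto
    have "trop_vanishes4 (\<mu> {d,e} + \<nu> {a,b,c'}) (\<mu> {b,c'} + \<nu> {a,d,e}) (\<mu> {a,c'} + \<nu> {b,d,e}) (\<mu> {a,b} + \<nu> {c',d,e})"
      by (rule incidence_plucker_2_3_dual_four_terms[OF \<mu>(1) \<nu>(1) gp inc s])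
    then show "trop_vanishes4 (\<mu> {d,e} + val (vdet (P a) (P b) (P c'))) (\<mu> {b,c'} + val (vdet (P a) (P d) (P e)))
        (\<mu> {a,c'} + val (vdet (P b) (P d) (P e))) (\<mu> {a,b} + val (vdet (P c') (P d) (P e)))"
      unfolding br[OF lt(1,2,3) ne(1,2,3)] br[OF lt(1,4,5) ne(4,5,6)] br[OF lt(2,4,5) ne(7,8,6)] br[OF lt(3,4,5) ne(9,10,6)]
        add.assoc[symmetric] trop_vanishes4_add_real_iff .
  qed (use n in simp_all)
  then obtain u where u: "\<And>a b. a < n \<Longrightarrow> b < n \<Longrightarrow> a \<noteq> b \<Longrightarrow> val (vdet (P a) (P b) u) = \<mu> {a,b}" by blast
  have u0: "u \<noteq> (0,0,0)"
  proof
    assume 0: "u = (0,0,0)"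
    obtain i j where ij: "i < n" "j < n" "i \<noteq> j" "\<mu> {i,j} \<noteq> \<infinity>" using \<mu>(2) by (auto simp: nsets_def card_2_iff)
    have "vdet (P i) (P j) u = 0" unfolding 0 by (cases "P i"; cases "P j") (simp add: vdet_def)
    then show False using u[OF ij(1-3)] ij(4) by simp
  qed
  obtain x x' l where l: "l \<noteq> 0" "\<And>a b. vdot x a * vdot x' b - vdot x b * vdot x' a = l * vdet a b u"
    using ex_orthogonal_pair[OF u0] by blast
  obtain x0 x1 x2 y0 y1 y2 where xx: "x = (x0,x1,x2)" "x' = (y0,y1,y2)" by (cases x; cases x') auto
  define X where "X = mat 2 3 (\<lambda>(i,j). (if i = 0 then [x0,x1,x2] else [y0,y1,y2]) ! j)"
  have X: "X \<in> carrier_mat 2 3" by (simp add: X_def)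
  have XB: "X * B \<in> carrier_mat 2 n" using X Bc by simp
  have ent: "(X * B) $$ (0,j) = vdot x (P j)" "(X * B) $$ (1,j) = vdot x' (P j)" if "j < n" for j
    using that Bc unfolding xx P_def by (simp_all add: X_def scalar_prod_def numeral_3_eq_3 numeral_2_eq_2)
  obtain t where t: "val l = ereal t" using val_real[OF l(1)] by blast
  have "\<mu> I = val (minor (X * B) I) + ereal (- t)" if I: "I \<in> nsets {..<n} 2" for I
  proof -
    obtain i j where ij: "I = {i,j}" "i < n" "j < n" "i \<noteq> j" using I by (auto simp: nsets_def card_2_iff)
    have "val (minor (X * B) (set [i,j])) = val (det (cols_mat (X * B) [i,j]))"
      using ij by (intro val_minor_set[OF XB]) auto
    also have "det (cols_mat (X * B) [i,j]) = vdot x (P i) * vdot x' (P j) - vdot x (P j) * vdot x' (P i)"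
      unfolding det_cols_mat_2[OF XB] ent[OF ij(2)] ent[OF ij(3)] by (simp add: algebra_simps)
    also have "val \<dots> = \<mu> I + ereal t" unfolding l(2) val_mult t ij(1) u[OF ij(2-4)] by (rule add.commute)
    finally show ?thesis using ij(1) by (simp add: add.assoc)
  qed
  then have "realizes (X * B) 2 n \<mu>" unfolding realizes_def using XB by blast
  then show ?thesis using X by blast
qed

end

section \<open>Realization of flags\<close>

text \<open>Indexed by rank and not by position: repeated ranks are merged before this stage, and
  \<open>incident_same_rank_imp_equal\<close> restores them afterwards.\<close>

definition tropical_flag :: "nat \<Rightarrow> nat set \<Rightarrow> (nat \<Rightarrow> nat set \<Rightarrow> ereal) \<Rightarrow> bool" where
  "tropical_flag n R M \<longleftrightarrow>
     (\<forall>r\<in>R. r \<le> n \<and> M r \<in> nsets {..<n} r \<rightarrow> TT \<and> (\<exists>I\<in>nsets {..<n} r. M r I \<noteq> \<infinity>) \<and>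
        trop_grassmann_plucker n r (M r)) \<and>
     (\<forall>r\<in>R. \<forall>s\<in>R. r < s \<longrightarrow> trop_incidence_plucker n r s (M r) (M s))"

text \<open>A factorization instead of an inclusion of sets, because it composes by matrix
  multiplication; subspaces enter through \<open>row_space_le_iff\<close>.\<close>

definition row_space_le :: "'a::comm_ring_1 mat \<Rightarrow> 'a mat \<Rightarrow> bool" where
  "row_space_le A B \<longleftrightarrow> (\<exists>X\<in>carrier_mat (dim_row A) (dim_row B). A = X * B)"

lemma row_space_leI: "A = X * B \<Longrightarrow> X \<in> carrier_mat r s \<Longrightarrow> B \<in> carrier_mat s n \<Longrightarrow> row_space_le A B"
  unfolding row_space_le_def by auto

lemma row_space_le_trans:
  assumes "row_space_le A B" "row_space_le B C"
  shows "row_space_le A C"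
proof -
  obtain X Y where X: "X \<in> carrier_mat (dim_row A) (dim_row B)" "A = X * B"
    and Y: "Y \<in> carrier_mat (dim_row B) (dim_row C)" "B = Y * C"
    using assms unfolding row_space_le_def by blast
  have "X * Y * C = X * (Y * C)" by (rule assoc_mult_mat[OF X(1) Y(1), of _ "dim_col C"]) simp
  also have "\<dots> = A" by (simp only: Y(2)[symmetric] X(2)[symmetric])
  finally show ?thesis unfolding row_space_le_def
    using mult_carrier_mat[OF X(1) Y(1)] by (intro bexI[of _ "X * Y"]) simp_all
qed

lemma row_space_le_one: "A \<in> carrier_mat r n \<Longrightarrow> row_space_le A (1\<^sub>m n)"
  unfolding row_space_le_def by (intro bexI[of _ A]) auto

lemma row_space_le_zero_rows:
  assumes "A \<in> carrier_mat 0 n" "B \<in> carrier_mat s n"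
  shows "row_space_le A B"
proof -
  have "A = 0\<^sub>m 0 s * B" using assms by (intro eq_matI) auto
  then show ?thesis using assms by (intro row_space_leI[of A "0\<^sub>m 0 s" B 0 s n]) auto
qed

context alg_closed_valuation
begin

text \<open>With the identity matrix fixed at \<open>n\<close>, every later matrix lies below the
  top of the flag by \<open>row_space_le_one\<close>.\<close>

definition flag_realizes :: "nat \<Rightarrow> nat set \<Rightarrow> (nat \<Rightarrow> 'k mat) \<Rightarrow> (nat \<Rightarrow> nat set \<Rightarrow> ereal) \<Rightarrow> bool" where
  "flag_realizes n R F M \<longleftrightarrow> F n = 1\<^sub>m n \<and> (\<forall>r\<in>R. realizes (F r) r n (M r)) \<and>
     (\<forall>r\<in>R. \<forall>s\<in>R. r < s \<longrightarrow> row_space_le (F r) (F s))"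

lemma realizes_carrier: "realizes A r n \<mu> \<Longrightarrow> A \<in> carrier_mat r n"
  unfolding realizes_def by simp

lemma flag_realizes_insert:
  assumes F: "flag_realizes n R F M" and r: "r \<notin> R" "r < n" and A: "realizes A r n (M r)"
    and below: "\<And>q. q \<in> R \<Longrightarrow> q < r \<Longrightarrow> row_space_le (F q) A"
    and above: "\<And>s. s \<in> R \<Longrightarrow> r < s \<Longrightarrow> row_space_le A (F s)"
  shows "flag_realizes n (insert r R) (F(r := A)) M"
  using assms unfolding flag_realizes_def by auto

text \<open>Meant for the ranks 0 and \<open>n\<close>: a single coordinate can be adjusted by the
  additive constant.\<close>

lemma realizes_singleton:
  assumes "A \<in> carrier_mat r n" "nsets {..<n} r = {I}" "minor A I \<noteq> 0" "\<mu> I \<noteq> \<infinity>" "\<mu> I \<noteq> -\<infinity>"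
  shows "realizes A r n \<mu>"
proof -
  obtain t where t: "val (minor A I) = ereal t" using val_real[OF assms(3)] by blast
  obtain u where u: "\<mu> I = ereal u" using assms(4,5) by (cases "\<mu> I") auto
  show ?thesis unfolding realizes_def using assms(1,2) t u by (intro conjI exI[of _ "u - t"]) auto
qed

text \<open>The flag is built from the middle outwards: rank 3, rank 2 inside it, then corank 1
  above and rank 1 below everything present. A new space is compared only with its nearest
  neighbour; transitivity does the rest.\<close>

lemma realize_flag:
  assumes n: "n \<le> 5" and M: "tropical_flag n R M" and R: "0 \<in> R" "n \<in> R"
  shows "\<exists>F. flag_realizes n R F M"
proof -
  have M1: "r \<le> n" "M r \<in> nsets {..<n} r \<rightarrow> TT" "\<exists>I\<in>nsets {..<n} r. M r I \<noteq> \<infinity>"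
    "trop_grassmann_plucker n r (M r)" if "r \<in> R" for r
    using M that unfolding tropical_flag_def by auto
  have M2: "trop_incidence_plucker n r s (M r) (M s)" if "r \<in> R" "s \<in> R" "r < s" for r s
    using M that unfolding tropical_flag_def by auto
  have n0: "nsets {..<n} 0 = {{}}" by (auto simp: nsets_def)
  have nn: "nsets {..<n} n = {{..<n}}"
  proof -
    have "I = {..<n}" if "I \<subseteq> {..<n}" "card I = n" for I using card_subset_eq[OF _ that(1)] that(2) by simp
    then show ?thesis by (auto simp: nsets_def)
  qed
  have finite_val: "M r I \<noteq> \<infinity> \<and> M r I \<noteq> -\<infinity>" if "r \<in> R" "nsets {..<n} r = {I}" for r I
    using M1(2,3)[OF that(1)] that(2) by (auto simp: TT_def)
  have zero: "realizes (0\<^sub>m 0 n) 0 n (M 0)"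
  proof (rule realizes_singleton[OF _ n0])
    have "submatrix (0\<^sub>m 0 n :: 'k mat) UNIV {} \<in> carrier_mat 0 0"
      by (intro carrier_matI) (simp_all add: dim_submatrix)
    then show "minor (0\<^sub>m 0 n :: 'k mat) {} \<noteq> 0" unfolding minor_def by simp
  qed (use finite_val[OF R(1) n0] in auto)
  have one: "realizes (1\<^sub>m n) n n (M n)"
  proof (rule realizes_singleton[OF _ nn])
    have "val (minor (1\<^sub>m n) (set [0..<n])) = val (det (cols_mat (1\<^sub>m n) [0..<n]))"
      by (intro val_minor_set[of _ n n]) auto
    also have "cols_mat (1\<^sub>m n) [0..<n] = (1\<^sub>m n :: 'k mat)"
      by (intro eq_matI) (auto simp: cols_mat_def)
    finally show "minor (1\<^sub>m n :: 'k mat) {..<n} \<noteq> 0" by (auto simp: atLeast0LessThan)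
  qed (use finite_val[OF R(2) nn] in auto)
  \<comment> \<open>The ranks that are neither 0, 1 nor of corank 0, 1. For \<open>n \<le> 5\<close>
    these are at most 2 and 3, and both occur only for \<open>n = 5\<close>.\<close>
  define C where "C = {r \<in> R. 2 \<le> r \<and> r + 2 \<le> n}"
  have C: "r = 2 \<or> (r = 3 \<and> n = 5)" if "r \<in> C" for r using that n unfolding C_def by auto
  have CR: "C \<subseteq> R" unfolding C_def by blast
  let ?F0 = "\<lambda>r. if r = n then 1\<^sub>m n else 0\<^sub>m 0 n"
  have F0: "flag_realizes n {0,n} ?F0 M"
    unfolding flag_realizes_def using zero one by (auto intro!: row_space_le_one[of _ 0])
  have stage1: "\<exists>F. flag_realizes n ({0,n} \<union> (C \<inter> {3})) F M"
  proof (cases "3 \<in> C")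
    case True
    then have n5: "n = 5" and 3: "3 \<in> R" using C[of 3] CR by auto
    obtain A where A: "realizes A 3 n (M 3)" using realize_rank_3[OF n M1(2,3,4)[OF 3]] by blast
    have "flag_realizes n (insert 3 {0,n}) (?F0(3 := A)) M"
    proof (rule flag_realizes_insert[OF F0 _ _ A])
      show "row_space_le (?F0 q) A" if "q \<in> {0,n}" "q < 3" for q
        using that n5 realizes_carrier[OF A] by (auto intro!: row_space_le_zero_rows)
      show "row_space_le A (?F0 s)" if "s \<in> {0,n}" "3 < s" for s
        using that realizes_carrier[OF A] by (auto intro!: row_space_le_one)
    qed (use n5 in auto)
    moreover have "{0,n} \<union> (C \<inter> {3}) = insert 3 {0,n}" using True by auto
    ultimately show ?thesis by auto
  next
    case False
    then have "{0,n} \<union> (C \<inter> {3}) = {0,n}" by auto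
    then show ?thesis using F0 by auto
  qed
  have stage2: "\<exists>F. flag_realizes n ({0,n} \<union> C) F M"
  proof (cases "2 \<in> C")
    case True
    let ?R = "{0,n} \<union> (C \<inter> {3})"
    obtain F where F: "flag_realizes n ?R F M" using stage1 by blast
    have 2: "2 \<in> R" and n4: "4 \<le> n" using True unfolding C_def by auto
    have Fr: "realizes (F r) r n (M r)" if "r \<in> ?R" for r using F that unfolding flag_realizes_def by blast
    have Fn: "F n = 1\<^sub>m n" using F unfolding flag_realizes_def by blast
    have "\<exists>A. realizes A 2 n (M 2) \<and> (3 \<in> C \<longrightarrow> row_space_le A (F 3))"
    proof (cases "3 \<in> C")
      case C3: True
      then have 3: "3 \<in> R" using CR by blast
      have F3: "realizes (F 3) 3 n (M 3)" by (rule Fr) (use C3 in simp)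
      obtain A X where "realizes A 2 n (M 2)" "X \<in> carrier_mat 2 3" "A = X * F 3"
        using realize_rank_2_below_3[OF n F3 M1(2,3)[OF 3] M1(2,3)[OF 2] M1(4)[OF 2] M1(4)[OF 3] M2[OF 2 3]] by auto
      then show ?thesis using row_space_leI[OF _ _ realizes_carrier[OF F3]] by blast
    next
      case False
      then show ?thesis using realize_rank_2[OF M1(2,3,4)[OF 2]] by blast
    qed
    then obtain A where A: "realizes A 2 n (M 2)" "3 \<in> C \<Longrightarrow> row_space_le A (F 3)" by blast
    have "flag_realizes n (insert 2 ?R) (F(2 := A)) M"
    proof (rule flag_realizes_insert[OF F _ _ A(1)])
      show "row_space_le (F q) A" if "q \<in> ?R" "q < 2" for q
      proof -
        have "q = 0" using that n4 by auto
        then show ?thesis using realizes_carrier[OF Fr[OF that(1)]] realizes_carrier[OF A(1)]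
          by (auto intro: row_space_le_zero_rows)
      qed
      show "row_space_le A (F s)" if s: "s \<in> ?R" "2 < s" for s
      proof (cases "s = n")
        case True
        then show ?thesis using Fn realizes_carrier[OF A(1)] by (auto intro: row_space_le_one)
      next
        case False
        then have "s = 3" "3 \<in> C" using s by auto
        then show ?thesis using A(2) by simp
      qed
    qed (use n4 in auto)
    moreover have "{0,n} \<union> C = insert 2 ?R" using True C by auto
    ultimately show ?thesis by auto
  next
    case False
    then have "{0,n} \<union> C = {0,n} \<union> (C \<inter> {3})" using C by auto
    then show ?thesis using stage1 by simp
  qed
  let ?R1 = "{0,n} \<union> C"
  have R1: "?R1 \<subseteq> R" using R CR by auto
  have stage3: "\<exists>F. flag_realizes n (?R1 \<union> (R \<inter> {n - 1})) F M"
  proof (cases "n - 1 \<in> R - ?R1")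
    case True
    then obtain m where m: "n = Suc m" "m \<in> R" "m \<notin> ?R1" by (cases n) auto
    obtain F where F: "flag_realizes n ?R1 F M" using stage2 by blast
    have Fr: "realizes (F r) r n (M r)" if "r \<in> ?R1" for r using F that unfolding flag_realizes_def by blast
    have Fle: "row_space_le (F r) (F s)" if "r \<in> ?R1" "s \<in> ?R1" "r < s" for r s
      using F that unfolding flag_realizes_def by blast
    have Fn: "F n = 1\<^sub>m n" using F unfolding flag_realizes_def by blast
    have finC: "finite C" using C finite_subset[of C "{2,3}"] by auto
    \<comment> \<open>The nearest rank below corank 1; it exists since 0 is present, and the smaller
      ranks follow by transitivity.\<close>
    define p where "p = Max (?R1 - {n})"
    have fin: "finite (?R1 - {n})" "?R1 - {n} \<noteq> {}" using finC m(1) by auto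
    have p: "p \<in> ?R1 - {n}" unfolding p_def by (rule Max_in[OF fin])
    have pge: "q \<le> p" if "q \<in> ?R1 - {n}" for q unfolding p_def by (rule Max_ge[OF fin(1) that])
    have pR: "p \<in> R" using p R1 by blast
    have "p \<le> n" by (rule M1(1)[OF pR])
    then have pm: "p < m" using p m by (metis DiffE insertI1 le_SucE le_neq_implies_less)
    have Fp: "realizes (F p) p n (M p)" using Fr p by blast
    obtain B X where B: "realizes B m n (M m)" "X \<in> carrier_mat p m" "F p = X * B"
      using realize_corank_1_above[OF Fp M1(3)[OF pR] m(1) M1(2,3)[OF m(2)] M2[OF pR m(2) pm]] by blast
    have pB: "row_space_le (F p) B" by (rule row_space_leI[OF B(3,2) realizes_carrier[OF B(1)]])
    have "flag_realizes n (insert m ?R1) (F(m := B)) M"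
    proof (rule flag_realizes_insert[OF F m(3) _ B(1)])
      show "row_space_le (F q) B" if q: "q \<in> ?R1" "q < m" for q
      proof (cases "q = p")
        case False
        have "q \<in> ?R1 - {n}" using q m(1) by simp
        then have "q < p" using le_neq_implies_less[OF pge False] by blast
        then show ?thesis using Fle[of q p] q(1) p row_space_le_trans[OF _ pB] by blast
      qed (use pB in simp)
      show "row_space_le B (F s)" if s: "s \<in> ?R1" "m < s" for s
      proof -
        have "s \<le> n" using M1(1) R1 s(1) by blast
        then have "s = n" using s(2) m(1) by simp
        then show ?thesis using Fn realizes_carrier[OF B(1)] by (auto intro: row_space_le_one)
      qed
    qed (use m in simp)
    moreover have "?R1 \<union> (R \<inter> {n - 1}) = insert m ?R1" using m by auto
    ultimately show ?thesis by auto
  next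
    case False
    then have "?R1 \<union> (R \<inter> {n - 1}) = ?R1" by auto
    then show ?thesis using stage2 by simp
  qed
  let ?R2 = "?R1 \<union> (R \<inter> {n - 1})"
  have R2: "?R2 \<subseteq> R" using R1 by blast
  have all: "r \<in> ?R2 \<or> r = 1" if "r \<in> R" for r
    using M1(1)[OF that] that unfolding C_def by auto
  show ?thesis
  proof (cases "1 \<in> R - ?R2")
    case True
    have n2: "1 < n" using M1(1)[of 1] True by (cases "n = 1") auto
    obtain F where F: "flag_realizes n ?R2 F M" using stage3 by blast
    have Fr: "realizes (F r) r n (M r)" if "r \<in> ?R2" for r using F that unfolding flag_realizes_def by blast
    have Fle: "row_space_le (F r) (F s)" if "r \<in> ?R2" "s \<in> ?R2" "r < s" for r s
      using F that unfolding flag_realizes_def by blast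
    have 1: "1 \<in> R" using True by blast
    \<comment> \<open>The nearest positive rank already present; it exists since \<open>n\<close> is
      one.\<close>
    define s where "s = (LEAST s. s \<in> ?R2 \<and> s \<noteq> 0)"
    have s: "s \<in> ?R2" "s \<noteq> 0" unfolding s_def
      using LeastI[of "\<lambda>s. s \<in> ?R2 \<and> s \<noteq> 0" n] n2 by auto
    have smin: "s \<le> t" if "t \<in> ?R2" "t \<noteq> 0" for t unfolding s_def using that by (intro Least_le) blast
    have s1: "1 < s" using s True by (cases "s = 1") auto
    have sR: "s \<in> R" using s(1) R2 by blast
    have Fs: "realizes (F s) s n (M s)" by (rule Fr[OF s(1)])
    obtain A X where A: "realizes A 1 n (M 1)" "X \<in> carrier_mat 1 s" "A = X * F s"
      using realize_rank_1_below[OF Fs M1(3)[OF sR] M1(2)[OF 1] M2[OF 1 sR s1]] by blast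
    have As: "row_space_le A (F s)" by (rule row_space_leI[OF A(3,2) realizes_carrier[OF Fs]])
    have "flag_realizes n (insert 1 ?R2) (F(1 := A)) M"
    proof (rule flag_realizes_insert[OF F _ n2 A(1)])
      show "1 \<notin> ?R2" using True by blast
      show "row_space_le (F q) A" if "q \<in> ?R2" "q < 1" for q
        using that realizes_carrier[OF Fr[OF that(1)]] realizes_carrier[OF A(1)]
        by (auto intro: row_space_le_zero_rows)
      show "row_space_le A (F t)" if t: "t \<in> ?R2" "1 < t" for t
      proof (cases "t = s")
        case False
        then have "s < t" using smin[OF t(1)] t(2) by simp
        then show ?thesis using row_space_le_trans[OF As] Fle[OF s(1) t(1)] by blast
      qed (use As in simp)
    qed
    moreover have "insert 1 ?R2 = R" using all R2 1 by blast
    ultimately show ?thesis by auto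
  next
    case False
    then have "?R2 = R" using all R2 by blast
    then show ?thesis using stage3 by simp
  qed
qed

end

section \<open>Row spaces\<close>

lemma row_space_iff:
  fixes A :: "'a::field mat"
  assumes A: "A \<in> carrier_mat r n"
  shows "v \<in> vec_space.row_space n A \<longleftrightarrow>
    (\<exists>x. v = vec n (\<lambda>j. \<Sum>i<r. x i * A $$ (i,j)))"
proof -
  interpret vec_space "TYPE('a)" n .
  have eq: "A\<^sup>T *\<^sub>v y = vec n (\<lambda>j. \<Sum>i<r. y $ i * A $$ (i,j))" if "y \<in> carrier_vec r" for y
    using A that by (intro eq_vecI) (auto simp: scalar_prod_def atLeast0LessThan mult.commute intro!: sum.cong)
  have dims: "dim_row A = r" "dim_col A = n" using A by auto
  have rs: "row_space A = {w \<in> carrier_vec n. \<exists>y\<in>carrier_vec r. A\<^sup>T *\<^sub>v y = w}"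
    using row_space_eq[OF A] dims by simp
  show ?thesis
  proof
    assume "v \<in> row_space A"
    then obtain y where y: "y \<in> carrier_vec r" "A\<^sup>T *\<^sub>v y = v" unfolding rs by blast
    then show "\<exists>x. v = vec n (\<lambda>j. \<Sum>i<r. x i * A $$ (i,j))" by (intro exI[of _ "\<lambda>i. y $ i"]) (simp only: eq[OF y(1)] flip: y(2))
  next
    assume "\<exists>x. v = vec n (\<lambda>j. \<Sum>i<r. x i * A $$ (i,j))"
    then obtain x where v: "v = vec n (\<lambda>j. \<Sum>i<r. x i * A $$ (i,j))" by blast
    have "(\<Sum>i<r. vec r x $ i * A $$ (i,j)) = (\<Sum>i<r. x i * A $$ (i,j))" for j
      by (intro sum.cong) simp_all
    then have "A\<^sup>T *\<^sub>v vec r x = v" unfolding v eq[OF vec_carrier] by simp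
    moreover have "v \<in> carrier_vec n" "vec r x \<in> carrier_vec r" by (simp_all add: v)
    ultimately show "v \<in> row_space A" unfolding rs by blast
  qed
qed

lemma row_space_le_iff:
  fixes A B :: "'a::field mat"
  assumes A: "A \<in> carrier_mat r n" and B: "B \<in> carrier_mat s n"
  shows "row_space_le A B \<longleftrightarrow> vec_space.row_space n A \<subseteq> vec_space.row_space n B"
proof
  assume "row_space_le A B"
  then obtain X where X: "X \<in> carrier_mat r s" "A = X * B" using A B unfolding row_space_le_def by auto
  have ent: "A $$ (i,j) = (\<Sum>k<s. X $$ (i,k) * B $$ (k,j))" if "i < r" "j < n" for i j
    unfolding X(2) using that X(1) B by (simp add: scalar_prod_def atLeast0LessThan)
  show "vec_space.row_space n A \<subseteq> vec_space.row_space n B"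
  proof
    fix v assume "v \<in> vec_space.row_space n A"
    then obtain x where v: "v = vec n (\<lambda>j. \<Sum>i<r. x i * A $$ (i,j))" unfolding row_space_iff[OF A] by blast
    have "(\<Sum>i<r. x i * A $$ (i,j)) = (\<Sum>k<s. (\<Sum>i<r. x i * X $$ (i,k)) * B $$ (k,j))" if j: "j < n" for j
    proof -
      have "(\<Sum>i<r. x i * A $$ (i,j)) = (\<Sum>i<r. \<Sum>k<s. x i * X $$ (i,k) * B $$ (k,j))"
        using ent j by (intro sum.cong) (auto simp: sum_distrib_left mult.assoc)
      also have "\<dots> = (\<Sum>k<s. \<Sum>i<r. x i * X $$ (i,k) * B $$ (k,j))" by (rule sum.swap)
      finally show ?thesis by (simp add: sum_distrib_right)
    qed
    then have "v = vec n (\<lambda>j. \<Sum>k<s. (\<Sum>i<r. x i * X $$ (i,k)) * B $$ (k,j))" unfolding v by (intro eq_vecI) auto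
    then show "v \<in> vec_space.row_space n B" unfolding row_space_iff[OF B] by (rule exI[of _ "\<lambda>k. \<Sum>i<r. x i * X $$ (i,k)"])
  qed
next
  assume sub: "vec_space.row_space n A \<subseteq> vec_space.row_space n B"
  have "\<exists>x. \<forall>j<n. A $$ (i,j) = (\<Sum>k<s. x k * B $$ (k,j))" if i: "i < r" for i
  proof -
    have "vec n (\<lambda>j. A $$ (i,j)) \<in> vec_space.row_space n A"
      unfolding row_space_iff[OF A]
    proof (intro exI[of _ "\<lambda>l. if l = i then 1 else 0"] eq_vecI)
      fix j assume "j < dim_vec (vec n (\<lambda>j. \<Sum>l<r. (if l = i then 1 else 0) * A $$ (l,j)))"
      then have j: "j < n" by simp
      have "(\<Sum>l<r. (if l = i then 1 else 0) * A $$ (l,j)) = (\<Sum>l<r. if l = i then A $$ (l,j) else 0)"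
        by (intro sum.cong) auto
      also have "\<dots> = A $$ (i,j)" using i by simp
      finally show "vec n (\<lambda>j. A $$ (i,j)) $ j = vec n (\<lambda>j. \<Sum>l<r. (if l = i then 1 else 0) * A $$ (l,j)) $ j"
        using j by simp
    qed simp
    then have "vec n (\<lambda>j. A $$ (i,j)) \<in> vec_space.row_space n B" using sub by blast
    then obtain x where x: "vec n (\<lambda>j. A $$ (i,j)) = vec n (\<lambda>j. \<Sum>k<s. x k * B $$ (k,j))"
      unfolding row_space_iff[OF B] by blast
    have "A $$ (i,j) = (\<Sum>k<s. x k * B $$ (k,j))" if "j < n" for j
      using arg_cong[OF x, of "\<lambda>v. v $ j"] that by simp
    then show ?thesis by blast
  qed
  then obtain x where x: "\<And>i j. i < r \<Longrightarrow> j < n \<Longrightarrow> A $$ (i,j) = (\<Sum>k<s. x i k * B $$ (k,j))" by metis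
  define X where "X = mat r s (\<lambda>(i,k). x i k)"
  have "A = X * B"
    using A B x by (intro eq_matI) (auto simp: X_def scalar_prod_def atLeast0LessThan)
  then show "row_space_le A B" by (rule row_space_leI[OF _ _ B, of _ _ r]) (simp add: X_def)
qed

text \<open>Passage from matrices to the subspaces of \<open>linear_flags\<close> and the bases of
  \<open>plucker_point\<close>; independence of the rows is read off the columns of the
  transpose.\<close>

lemma minor_neq_0_imp_row_basis:
  fixes A :: "'a::field mat"
  assumes A: "A \<in> carrier_mat r n" and I: "I \<in> nsets {..<n} r" "minor A I \<noteq> 0"
  defines "L \<equiv> vec_space.row_space n A"
  shows "subspace class_ring L (module_vec TYPE('a) n)" "distinct (rows A)"
    "vectorspace.basis class_ring (subspace_vs n L) (set (rows A))"
    "vectorspace.dim class_ring (subspace_vs n L) = r"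
proof -
  interpret vec_space "TYPE('a)" n .
  have I': "I \<subseteq> {..<n}" "card I = r" using I(1) by (auto simp: nsets_def)
  have rc: "set (rows A) \<subseteq> carrier_vec n" using A by (auto simp: rows_def)
  have L: "L = span (set (rows A))" unfolding L_def row_space_def ..
  show sub: "subspace class_ring L V" unfolding L by (rule span_is_subspace) (use rc in simp)
  \<comment> \<open>The set of rows forgets repetitions, so equal rows have to be excluded
    separately; they would give a dependence with coefficients 1 and -1.\<close>
  show dist: "distinct (rows A)"
  proof (rule ccontr)
    assume "\<not> distinct (rows A)"
    then obtain i j where ij: "i < r" "j < r" "i \<noteq> j" "rows A ! i = rows A ! j"
      using A by (auto simp: distinct_conv_nth)
    define x where "x l = (if l = i then 1 else if l = j then -1 else (0::'a))" for l
    have "x i = 0"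
    proof (rule minor_neq_0_imp_rows_independent[OF A I' I(2) _ ij(1)])
      fix f assume f: "f < n"
      have eq: "A $$ (i,f) = A $$ (j,f)"
        using arg_cong[OF ij(4), of "\<lambda>v. v $ f"] ij(1,2) f A by simp
      have "(\<Sum>l<r. x l * A $$ (l,f)) = (\<Sum>l\<in>{i,j}. x l * A $$ (l,f))"
        using ij(1,2) by (intro sum.mono_neutral_right) (auto simp: x_def)
      also have "\<dots> = x i * A $$ (i,f) + x j * A $$ (j,f)" using ij(3) by simp
      also have "\<dots> = 0" unfolding eq x_def using ij(3) by simp
      finally show "(\<Sum>l<r. x l * A $$ (l,f)) = 0" .
    qed
    then show False by (simp add: x_def)
  qed
  have indpt: "lin_indpt (set (rows A))"
  proof
    assume "lin_dep (set (rows A))"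
    then have "lin_dep (set (cols A\<^sup>T))" "distinct (cols A\<^sup>T)" using dist by simp_all
    moreover have "A\<^sup>T \<in> carrier_mat n r" using A by simp
    ultimately obtain v where v: "v \<in> carrier_vec r" "v \<noteq> 0\<^sub>v r" "A\<^sup>T *\<^sub>v v = 0\<^sub>v n"
      using lin_depE by blast
    have "v $ i = 0" if i: "i < r" for i
    proof (rule minor_neq_0_imp_rows_independent[OF A I' I(2) _ i, of "\<lambda>i. v $ i"])
      fix f assume f: "f < n"
      have "(A\<^sup>T *\<^sub>v v) $ f = (\<Sum>i<r. v $ i * A $$ (i,f))"
        using f A v(1) by (simp add: scalar_prod_def atLeast0LessThan mult.commute)
      then show "(\<Sum>i<r. v $ i * A $$ (i,f)) = 0" using v(3) f by simp
    qed
    then have "v = 0\<^sub>v r" using v(1) by (intro eq_vecI) auto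
    then show False using v(2) by blast
  qed
  have subm: "submodule class_ring L V" using sub unfolding subspace_def by blast
  have inL: "set (rows A) \<subseteq> L" unfolding L by (rule in_own_span) (use rc in simp)
  interpret W: vectorspace class_ring "subspace_vs n L" by (rule subspace_is_vs[OF sub])
  show basis: "W.basis (set (rows A))"
    unfolding W.basis_def using span_li_not_depend[OF inL subm] indpt inL L by simp
  show "W.dim = r" using W.dim_basis[OF _ basis] distinct_card[OF dist] A by simp
qed

text \<open>The converse passage. In particular a basis matrix never yields the zero vector as
  Pluecker coordinates.\<close>

lemma row_basis_imp_minor_neq_0:
  fixes A :: "'a::field mat"
  assumes A: "A \<in> carrier_mat r n" and L: "subspace class_ring L (module_vec TYPE('a) n)"
    and dist: "distinct (rows A)" and basis: "vectorspace.basis class_ring (subspace_vs n L) (set (rows A))"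
  shows "L = vec_space.row_space n A" "\<exists>I\<in>nsets {..<n} r. minor A I \<noteq> 0"
proof -
  interpret vec_space "TYPE('a)" n .
  interpret W: vectorspace class_ring "subspace_vs n L" by (rule subspace_is_vs[OF L])
  have subm: "submodule class_ring L V" using L unfolding subspace_def by blast
  have b: "W.lin_indpt (set (rows A))" "W.gen_set (set (rows A))" "set (rows A) \<subseteq> L"
    using basis unfolding W.basis_def by auto
  show "L = row_space A" unfolding row_space_def
    using span_li_not_depend(1)[OF b(3) subm] b(2) by simp
  have indpt: "lin_indpt (set (rows A))" using span_li_not_depend(2)[OF b(3) subm] b(1) by simp
  show "\<exists>I\<in>nsets {..<n} r. minor A I \<noteq> 0"
  proof (rule rows_independent_imp_minor_neq_0[OF A])
    fix x :: "nat \<Rightarrow> 'a" and i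
    assume x: "\<And>f. f < n \<Longrightarrow> (\<Sum>i<r. x i * A $$ (i,f)) = 0" and i: "i < r"
    show "x i = 0"
    proof (rule ccontr)
      assume xi: "x i \<noteq> 0"
      have "A\<^sup>T *\<^sub>v vec r x = 0\<^sub>v n"
      proof (rule eq_vecI)
        fix f assume "f < dim_vec (0\<^sub>v n :: 'a vec)"
        then have f: "f < n" by simp
        show "(A\<^sup>T *\<^sub>v vec r x) $ f = 0\<^sub>v n $ f"
          using x[OF f] f A by (simp add: scalar_prod_def atLeast0LessThan mult.commute)
      qed (use A in simp)
      moreover have "vec r x \<noteq> 0\<^sub>v r" using xi i by (metis index_vec index_zero_vec(1))
      moreover have "A\<^sup>T \<in> carrier_mat n r" "distinct (cols A\<^sup>T)" using A dist by simp_all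
      ultimately have "lin_dep (set (cols A\<^sup>T))" using lin_depI[of "A\<^sup>T" r "vec r x"] by simp
      then show False using indpt by simp
    qed
  qed
qed

section \<open>Tropical Pluecker relations\<close>

text \<open>A valuated matroid is treated as incident with itself, so that facts about incidence
  cover both families of relations.\<close>

lemma trop_grassmann_plucker_iff: "trop_grassmann_plucker n r \<mu> \<longleftrightarrow> trop_incidence_plucker n r r \<mu> \<mu>"
  unfolding trop_grassmann_plucker_def trop_incidence_plucker_def ..

lemma insert_in_nsets:
  fixes n :: nat
  assumes "I \<subseteq> {..<n}" "Suc (card I) = r" "j \<in> {..<n} - I"
  shows "insert j I \<in> nsets {..<n} r"
proof -
  have "finite I" by (rule finite_subset[OF assms(1) finite_lessThan])
  moreover from this have "card (insert j I) = r" using card_insert_disjoint[of I j] assms(2,3) by simp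
  moreover have "insert j I \<subseteq> {..<n}" using assms(1,3) by blast
  ultimately show ?thesis unfolding nsets_def by blast
qed

lemma diff_in_nsets: "J \<in> nsets {..<n::nat} (Suc s) \<Longrightarrow> j \<in> J \<Longrightarrow> J - {j} \<in> nsets {..<n} s"
  by (auto simp: nsets_def)

lemma trop_incidence_plucker_shift:
  assumes inc: "trop_incidence_plucker n r s \<mu> \<nu>"
    and \<mu>': "\<And>I. I \<in> nsets {..<n} r \<Longrightarrow> \<mu>' I = \<mu> I + ereal c"
    and \<nu>': "\<And>I. I \<in> nsets {..<n} s \<Longrightarrow> \<nu>' I = \<nu> I + ereal d"
  shows "trop_incidence_plucker n r s \<mu>' \<nu>'"
  unfolding trop_incidence_plucker_def
proof (intro allI impI, elim conjE)
  fix I J assume I: "I \<subseteq> {..<n}" "Suc (card I) = r" and J: "J \<in> nsets {..<n} (Suc s)"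
  have "trop_vanishes (\<lambda>j. \<mu> (insert j I) + \<nu> (J - {j})) (J - I)"
    using inc I J unfolding trop_incidence_plucker_def by blast
  then have van: "trop_vanishes (\<lambda>j. (\<mu> (insert j I) + \<nu> (J - {j})) + ereal (c + d)) (J - I)"
    by (rule trop_vanishes_add_const)
  have eq: "\<mu>' (insert j I) + \<nu>' (J - {j}) = (\<mu> (insert j I) + \<nu> (J - {j})) + ereal (c + d)" if "j \<in> J - I" for j
  proof -
    have j: "j \<in> {..<n} - I" "j \<in> J" using that J by (auto simp: nsets_def)
    show ?thesis unfolding \<mu>'[OF insert_in_nsets[OF I j(1)]] \<nu>'[OF diff_in_nsets[OF J j(2)]]
      plus_ereal.simps(1)[symmetric] by (simp only: ac_simps)
  qed
  have "trop_vanishes (\<lambda>j. \<mu>' (insert j I) + \<nu>' (J - {j})) (J - I)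
      \<longleftrightarrow> trop_vanishes (\<lambda>j. (\<mu> (insert j I) + \<nu> (J - {j})) + ereal (c + d)) (J - I)"
    by (rule trop_vanishes_cong) (rule eq)
  then show "trop_vanishes (\<lambda>j. \<mu>' (insert j I) + \<nu>' (J - {j})) (J - I)" using van by (rule iffD2)
qed

lemma trop_incidence_plucker_cong:
  assumes "trop_incidence_plucker n r s \<mu> \<nu>"
    and "\<And>I. I \<in> nsets {..<n} r \<Longrightarrow> \<mu>' I = \<mu> I" "\<And>I. I \<in> nsets {..<n} s \<Longrightarrow> \<nu>' I = \<nu> I"
  shows "trop_incidence_plucker n r s \<mu>' \<nu>'"
  by (rule trop_incidence_plucker_shift[OF assms(1), of _ 0 _ 0]) (use assms(2,3) in simp_all)

text \<open>A finite term with index \<open>i\<close> belongs to the bases \<open>insert i I\<close>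
  and \<open>J - {i}\<close>, and \<open>i\<close> lies only in the first. The exchange axiom for
  them returns the index of a second term that is no larger.\<close>

lemma trop_incidence_plucker_of_exchange:
  assumes ex: "\<forall>I\<in>bases_of n r \<mu>. \<forall>J\<in>bases_of n s \<nu>. \<forall>i\<in>I - J. \<exists>j\<in>J - I.
      \<mu> I + \<nu> J \<ge> \<mu> (insert j (I - {i})) + \<nu> (insert i (J - {j}))"
  shows "trop_incidence_plucker n r s \<mu> \<nu>"
  unfolding trop_incidence_plucker_def
proof (intro allI impI, elim conjE)
  fix I J assume I: "I \<subseteq> {..<n}" "Suc (card I) = r" and J: "J \<in> nsets {..<n} (Suc s)"
  show "trop_vanishes (\<lambda>j. \<mu> (insert j I) + \<nu> (J - {j})) (J - I)"
  proof (rule trop_vanishesI)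
    fix i assume i: "i \<in> J - I" and fin: "\<mu> (insert i I) + \<nu> (J - {i}) \<noteq> \<infinity>"
    have i': "i \<in> {..<n} - I" "i \<in> J" "i \<notin> I" using i J by (auto simp: nsets_def)
    have "insert i I \<in> bases_of n r \<mu>" "J - {i} \<in> bases_of n s \<nu>"
      using fin insert_in_nsets[OF I i'(1)] diff_in_nsets[OF J i'(2)] unfolding bases_of_def by auto
    moreover have "i \<in> insert i I - (J - {i})" by simp
    ultimately obtain j where j: "j \<in> (J - {i}) - insert i I"
      "\<mu> (insert j (insert i I - {i})) + \<nu> (insert i (J - {i} - {j})) \<le> \<mu> (insert i I) + \<nu> (J - {i})"
      using ex by blast
    have "insert i I - {i} = I" "insert i (J - {i} - {j}) = J - {j}" using i'(2,3) j(1) by auto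
    then have "\<mu> (insert j I) + \<nu> (J - {j}) \<le> \<mu> (insert i I) + \<nu> (J - {i})" using j(2) by simp
    then show "\<exists>j\<in>J - I. j \<noteq> i \<and> \<mu> (insert j I) + \<nu> (J - {j}) \<le> \<mu> (insert i I) + \<nu> (J - {i})"
      using j(1) by blast
  qed (use J in \<open>simp add: nsets_def\<close>)
qed

text \<open>This treats repeated ranks. Exchanges move a basis of one matroid towards a basis of the
  other, so both have the same bases. For two bases that differ in one element the relation has just
  two terms, and their equality says that \<open>\<nu> - \<mu>\<close> takes the same value on both;
  exchanges connect every basis to \<open>B0\<close>.\<close>

lemma incident_same_rank_imp_equal:
  assumes \<mu>: "\<mu> \<in> nsets {..<n} r \<rightarrow> TT" "\<exists>I\<in>nsets {..<n} r. \<mu> I \<noteq> \<infinity>"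
    and \<nu>: "\<nu> \<in> nsets {..<n} r \<rightarrow> TT" "\<exists>I\<in>nsets {..<n} r. \<nu> I \<noteq> \<infinity>"
    and inc: "trop_incidence_plucker n r r \<mu> \<nu>"
  shows "\<exists>c::real. \<forall>I\<in>nsets {..<n} r. \<nu> I = \<mu> I + ereal c"
proof -
  let ?S = "nsets {..<n} r"
  have S: "B \<subseteq> {..<n}" "finite B" "card B = r" if "B \<in> ?S" for B using that by (auto simp: nsets_def)
  have MI: "\<mu> B \<noteq> -\<infinity>" "\<nu> B \<noteq> -\<infinity>" if "B \<in> ?S" for B
    using funcset_mem[OF \<mu>(1) that] funcset_mem[OF \<nu>(1) that] by (auto simp: TT_def)
  have van: "trop_vanishes (\<lambda>j. \<mu> (insert j (B - {a})) + \<nu> (insert x B' - {j})) (insert x B' - (B - {a}))"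
    if B: "B \<in> ?S" "B' \<in> ?S" "a \<in> B" "x \<in> {..<n}" "x \<notin> B'" for B B' a x
  proof -
    have "Suc (card (B - {a})) = r" using S[OF B(1)] B(3) card_Suc_Diff1 by metis
    moreover have "insert x B' \<in> nsets {..<n} (Suc r)" using S[OF B(2)] B(4,5) by (simp add: nsets_def)
    moreover have "B - {a} \<subseteq> {..<n}" using S(1)[OF B(1)] by blast
    ultimately show ?thesis using inc unfolding trop_incidence_plucker_def by blast
  qed
  have ins: "insert j (B - {a}) \<in> ?S" if "B \<in> ?S" "a \<in> B" "j \<in> {..<n}" "j \<notin> B" for B a j
  proof (rule insert_in_nsets)
    show "B - {a} \<subseteq> {..<n}" using S(1)[OF that(1)] by blast
    show "Suc (card (B - {a})) = r" using S[OF that(1)] that(2) card_Suc_Diff1 by metis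
  qed (use that in simp)
  have closer: "card (B - insert a (B' - {j})) < card (B - B')" if "finite B" "a \<in> B" "a \<notin> B'" "j \<notin> B" for a j and B B' :: "nat set"
    using that by (intro psubset_card_mono) auto
  have sub_eq: "B = B'" if "B \<in> ?S" "B' \<in> ?S" "B \<subseteq> B'" for B B'
    using card_subset_eq[OF S(2)[OF that(2)] that(3)] S(3)[OF that(1)] S(3)[OF that(2)] by simp
  have exch: "\<exists>j. j \<in> B' - B \<and> \<mu> (insert j (B - {a})) \<noteq> \<infinity> \<and> \<nu> (insert a (B' - {j})) \<noteq> \<infinity>"
    if B: "B \<in> ?S" "\<mu> B \<noteq> \<infinity>" "B' \<in> ?S" "\<nu> B' \<noteq> \<infinity>" "a \<in> B" "a \<notin> B'" for B B' a
  proof -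
    have an: "a \<in> {..<n}" using S(1)[OF B(1)] B(5) by blast
    have eqs: "insert a (B - {a}) = B" "insert a B' - {a} = B'" using B(5,6) by auto
    have mem: "a \<in> insert a B' - (B - {a})" by simp
    have fin: "\<mu> (insert a (B - {a})) + \<nu> (insert a B' - {a}) \<noteq> \<infinity>" unfolding eqs using B(2,4) by simp
    obtain j where j: "j \<in> insert a B' - (B - {a})" "j \<noteq> a"
      "\<mu> (insert j (B - {a})) + \<nu> (insert a B' - {j}) \<le> \<mu> (insert a (B - {a})) + \<nu> (insert a B' - {a})"
      using trop_vanishesD[OF van[OF B(1,3,5) an B(6)] mem fin] by blast
    have eq2: "insert a B' - {j} = insert a (B' - {j})" using j(2) by auto
    have "\<mu> (insert j (B - {a})) + \<nu> (insert a (B' - {j})) \<noteq> \<infinity>" using j(3) fin unfolding eq2 by auto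
    then show ?thesis using j(1,2) by (intro exI[of _ j]) auto
  qed
  have \<nu>fin: "\<nu> B \<noteq> \<infinity>" if B: "B \<in> ?S" "\<mu> B \<noteq> \<infinity>" for B
  proof -
    have "\<nu> B \<noteq> \<infinity>" if "B' \<in> ?S" "\<nu> B' \<noteq> \<infinity>" for B'
      using that
    proof (induction "card (B - B')" arbitrary: B' rule: less_induct)
      case less
      show ?case
      proof (cases "B \<subseteq> B'")
        case True
        then show ?thesis using sub_eq[OF B(1) less.prems(1)] less.prems(2) by simp
      next
        case False
        then obtain a where a: "a \<in> B" "a \<notin> B'" by blast
        obtain j where j: "j \<in> B' - B" "\<nu> (insert a (B' - {j})) \<noteq> \<infinity>"
          using exch[OF B less.prems a] by blast
        have "a \<in> {..<n}" using S(1)[OF B(1)] a(1) by blast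
        then have "insert a (B' - {j}) \<in> ?S" using ins[OF less.prems(1), of j a] j(1) a(2) by blast
        then show ?thesis using less.hyps[OF closer[OF S(2)[OF B(1)] a] _ j(2)] j(1) by blast
      qed
    qed
    then show ?thesis using \<nu>(2) by blast
  qed
  have \<mu>fin: "\<mu> B' \<noteq> \<infinity>" if B': "B' \<in> ?S" "\<nu> B' \<noteq> \<infinity>" for B'
  proof -
    have "\<mu> B' \<noteq> \<infinity>" if "B \<in> ?S" "\<mu> B \<noteq> \<infinity>" for B
      using that
    proof (induction "card (B' - B)" arbitrary: B rule: less_induct)
      case less
      show ?case
      proof (cases "B \<subseteq> B'")
        case True
        then show ?thesis using sub_eq[OF less.prems(1) B'(1)] less.prems(2) by simp
      next
        case False
        then obtain a where a: "a \<in> B" "a \<notin> B'" by blast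
        obtain j where j: "j \<in> B' - B" "\<mu> (insert j (B - {a})) \<noteq> \<infinity>"
          using exch[OF less.prems B' a] by blast
        have j': "j \<in> B'" "j \<notin> B" using j(1) by auto
        then have "j \<in> {..<n}" using S(1)[OF B'(1)] by blast
        then have "insert j (B - {a}) \<in> ?S" using ins[OF less.prems(1) a(1), of j] j'(2) by blast
        then show ?thesis using less.hyps[OF closer[OF S(2)[OF B'(1)] j' a(2)] _ j(2)] by blast
      qed
    qed
    then show ?thesis using \<mu>(2) by blast
  qed
  obtain B0 where B0: "B0 \<in> ?S" "\<mu> B0 \<noteq> \<infinity>" using \<mu>(2) by blast
  define c where "c = real_of_ereal (\<nu> B0) - real_of_ereal (\<mu> B0)"
  have real: "\<mu> B = ereal (real_of_ereal (\<mu> B))" "\<nu> B = ereal (real_of_ereal (\<nu> B))" if "B \<in> ?S" "\<mu> B \<noteq> \<infinity>" for B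
    using MI[OF that(1)] \<nu>fin[OF that] that(2) by (cases "\<mu> B"; cases "\<nu> B"; simp)+
  have const: "real_of_ereal (\<nu> B) = real_of_ereal (\<mu> B) + c" if "B \<in> ?S" "\<mu> B \<noteq> \<infinity>" for B
    using that
  proof (induction "card (B0 - B)" arbitrary: B rule: less_induct)
    case less
    show ?case
    proof (cases "B0 \<subseteq> B")
      case True
      then show ?thesis using sub_eq[OF B0(1) less.prems(1)] unfolding c_def by simp
    next
      case False
      then obtain a where a: "a \<in> B0" "a \<notin> B" by blast
      obtain j where j: "j \<in> B - B0" "\<nu> (insert a (B - {j})) \<noteq> \<infinity>"
        using exch[OF B0 less.prems(1) \<nu>fin[OF less.prems] a] by blast
      have j': "j \<in> B" "j \<notin> B0" using j(1) by auto
      define B' where "B' = insert a (B - {j})"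
      have an: "a \<in> {..<n}" using S(1)[OF B0(1)] a(1) by blast
      have B'S: "B' \<in> ?S" unfolding B'_def by (rule ins[OF less.prems(1) j'(1) an a(2)])
      have B'fin: "\<mu> B' \<noteq> \<infinity>" using \<mu>fin[OF B'S] j(2) unfolding B'_def by blast
      have IH: "real_of_ereal (\<nu> B') = real_of_ereal (\<mu> B') + c"
        using less.hyps[OF closer[OF S(2)[OF B0(1)] a j'(2)]] B'S B'fin unfolding B'_def by blast
      \<comment> \<open>With \<open>I = B - {j}\<close> and \<open>J = insert a B\<close> only the
        indices \<open>a\<close> and \<open>j\<close> remain, so the relation is an equality of two
        terms.\<close>
      define h where "h l = \<mu> (insert l (B - {j})) + \<nu> (insert a B - {l})" for l
      have aj: "a \<noteq> j" using a(2) j'(1) by blast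
      have eqs: "insert a B - (B - {j}) = {a,j}" "insert j (B - {j}) = B" "insert a B - {a} = B" "insert a B - {j} = B'"
        using a(2) j'(1) aj unfolding B'_def by auto
      have "trop_vanishes h {a,j}"
        using van[OF less.prems(1,1) j'(1) an a(2)] unfolding eqs(1) h_def .
      moreover have "trop_vanishes h {a,j} \<longleftrightarrow> (\<forall>i\<in>{a,j}. \<exists>l\<in>{a,j}. l \<noteq> i \<and> h l \<le> h i)"
        by (rule trop_vanishes_iff) (use aj in simp_all)
      ultimately have "h j \<le> h a" "h a \<le> h j" by blast+
      moreover have "h j = \<mu> B + \<nu> B'" unfolding h_def eqs(2,4) ..
      moreover have "h a = \<mu> B' + \<nu> B" unfolding h_def eqs(3) B'_def ..
      ultimately have "\<mu> B + \<nu> B' \<le> \<mu> B' + \<nu> B" "\<mu> B' + \<nu> B \<le> \<mu> B + \<nu> B'" by simp_all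
      then have "\<mu> B + \<nu> B' = \<mu> B' + \<nu> B" by (rule antisym)
      then have "real_of_ereal (\<mu> B) + real_of_ereal (\<nu> B') = real_of_ereal (\<mu> B') + real_of_ereal (\<nu> B)"
        using real[OF less.prems] real[OF B'S B'fin] by (metis ereal.inject plus_ereal.simps(1))
      then show ?thesis using IH by simp
    qed
  qed
  have "\<nu> I = \<mu> I + ereal c" if I: "I \<in> ?S" for I
  proof (cases "\<mu> I = \<infinity>")
    case True
    then show ?thesis using \<mu>fin[OF I] by auto
  next
    case False
    then show ?thesis using const[OF I False] real[OF I False] by (metis plus_ereal.simps(1))
  qed
  then show ?thesis by blast
qed

section \<open>Incidence relations of nested row spaces\<close>

context valuation
begin

text \<open>A circuit vector of \<open>B\<close> on \<open>J\<close> is annihilated by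
  \<open>B\<close> and hence by \<open>A\<close>, so it is orthogonal to the cocircuit vector of
  \<open>A\<close> for \<open>I\<close>. The latter vanishes on \<open>I\<close>, and the products
  left over on \<open>J - I\<close> are the terms of the relation up to sign.\<close>

lemma row_space_le_imp_incidence:
  assumes A: "A \<in> carrier_mat r n" and B: "B \<in> carrier_mat s n" and le: "row_space_le A B"
  shows "trop_incidence_plucker n r s (\<lambda>I. val (minor A I)) (\<lambda>I. val (minor B I))"
  unfolding trop_incidence_plucker_def
proof (intro allI impI, elim conjE)
  fix I J assume I: "I \<subseteq> {..<n}" "Suc (card I) = r" and J: "J \<in> nsets {..<n} (Suc s)"
  have J': "J \<subseteq> {..<n}" "card J = Suc s" "finite J" using J by (auto simp: nsets_def)
  obtain X where X: "X \<in> carrier_mat r s" "A = X * B" using le A B unfolding row_space_le_def by auto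
  obtain y where y: "\<And>i. i < s \<Longrightarrow> (\<Sum>j\<in>J. B $$ (i,j) * y j) = 0"
    "\<And>j. j \<in> J \<Longrightarrow> y j = minor B (J - {j}) \<or> y j = - minor B (J - {j})"
    using ex_circuit_vector[OF B J'(1,2)] by blast
  have Ay: "(\<Sum>j\<in>J. A $$ (i,j) * y j) = 0" if i: "i < r" for i
  proof -
    have "(\<Sum>j\<in>J. A $$ (i,j) * y j) = (\<Sum>j\<in>J. \<Sum>k<s. X $$ (i,k) * (B $$ (k,j) * y j))"
    proof (rule sum.cong[OF refl])
      fix j assume "j \<in> J"
      then have "A $$ (i,j) = (\<Sum>k<s. X $$ (i,k) * B $$ (k,j))"
        unfolding X(2) using i J'(1) X(1) B by (auto simp: scalar_prod_def atLeast0LessThan)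
      then show "A $$ (i,j) * y j = (\<Sum>k<s. X $$ (i,k) * (B $$ (k,j) * y j))"
        by (simp only: sum_distrib_right mult.assoc)
    qed
    also have "\<dots> = (\<Sum>k<s. X $$ (i,k) * (\<Sum>j\<in>J. B $$ (k,j) * y j))"
      by (subst sum.swap) (simp only: sum_distrib_left)
    also have "\<dots> = 0" using y(1) by simp
    finally show ?thesis .
  qed
  obtain t where t: "r = Suc t" using I(2) by auto
  then have ct: "card I = t" using I(2) by simp
  define g where "g x f = (\<Sum>i<r. x i * A $$ (i,f))" for x f
  obtain x where x: "\<And>f. f \<in> I \<Longrightarrow> g x f = 0"
    "\<And>f. f \<in> {..<n} - I \<Longrightarrow> g x f = minor A (insert f I) \<or> g x f = - minor A (insert f I)"
    using ex_cocircuit_vector[OF A[unfolded t] I(1) ct] unfolding g_def t by blast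
  have "(\<Sum>j\<in>J. g x j * y j) = (\<Sum>j\<in>J. \<Sum>i<r. x i * (A $$ (i,j) * y j))"
    unfolding g_def by (simp only: sum_distrib_right mult.assoc)
  also have "\<dots> = (\<Sum>i<r. x i * (\<Sum>j\<in>J. A $$ (i,j) * y j))"
    by (subst sum.swap) (simp only: sum_distrib_left)
  also have "\<dots> = 0" using Ay by simp
  finally have "(\<Sum>j\<in>J. g x j * y j) = 0" .
  moreover have "(\<Sum>j\<in>J. g x j * y j) = (\<Sum>j\<in>J - I. g x j * y j)"
    using J'(3) x(1) by (intro sum.mono_neutral_right) auto
  ultimately have van: "trop_vanishes (\<lambda>j. val (g x j * y j)) (J - I)"
    using J'(3) by (intro trop_vanishes_sum) auto
  have eq: "val (g x j * y j) = val (minor A (insert j I)) + val (minor B (J - {j}))" if j: "j \<in> J - I" for j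
  proof -
    have j': "j \<in> {..<n} - I" "j \<in> J" using j J'(1) by auto
    have "val (g x j) = val (minor A (insert j I))" using x(2)[OF j'(1)] by (elim disjE) simp_all
    moreover have "val (y j) = val (minor B (J - {j}))" using y(2)[OF j'(2)] by (elim disjE) simp_all
    ultimately show ?thesis by (simp only: val_mult)
  qed
  have "trop_vanishes (\<lambda>j. val (g x j * y j)) (J - I)
      \<longleftrightarrow> trop_vanishes (\<lambda>j. val (minor A (insert j I)) + val (minor B (J - {j}))) (J - I)"
    by (rule trop_vanishes_cong) (rule eq)
  then show "trop_vanishes (\<lambda>j. val (minor A (insert j I)) + val (minor B (J - {j}))) (J - I)"
    using van by (rule iffD1)
qed

end

section \<open>Flags of subspaces and points of the flag Dressian\<close>

lemma in_listset_iff: "xs \<in> listset As \<longleftrightarrow> length xs = length As \<and> (\<forall>i<length As. xs ! i \<in> As ! i)"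
proof (induction As arbitrary: xs)
  case (Cons A As)
  show ?case
  proof (cases xs)
    case Nil
    then show ?thesis by (simp add: set_Cons_def)
  next
    case (Cons y ys)
    have "xs \<in> listset (A # As) \<longleftrightarrow> y \<in> A \<and> ys \<in> listset As" unfolding Cons by (simp add: set_Cons_def)
    also have "\<dots> \<longleftrightarrow> y \<in> A \<and> length ys = length As \<and> (\<forall>i<length As. ys ! i \<in> As ! i)" using Cons.IH by blast
    also have "\<dots> \<longleftrightarrow> length xs = length (A # As) \<and> (\<forall>i<length (A # As). xs ! i \<in> (A # As) ! i)"
      unfolding Cons by (auto simp: less_Suc_eq_0_disj)
    finally show ?thesis .
  qed
qed simp

lemma equiv_trop_rel: "equiv (trop_coords n r) (trop_rel n r)"
proof (rule equivI)
  show "trop_rel n r \<subseteq> trop_coords n r \<times> trop_coords n r" unfolding trop_rel_def by auto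
  show "refl_on (trop_coords n r) (trop_rel n r)"
    unfolding refl_on_def trop_rel_def by (auto intro: exI[of _ 0])
  show "sym (trop_rel n r)"
  proof (rule symI)
    fix \<mu> \<nu> assume "(\<mu>, \<nu>) \<in> trop_rel n r"
    then obtain c where c: "\<mu> \<in> trop_coords n r" "\<nu> \<in> trop_coords n r" "\<And>I. I \<in> nsets {..<n} r \<Longrightarrow> \<nu> I = \<mu> I + ereal c"
      unfolding trop_rel_def by auto
    have "\<mu> I = \<nu> I + ereal (- c)" if "I \<in> nsets {..<n} r" for I unfolding c(3)[OF that] by (simp add: add.assoc)
    then show "(\<nu>, \<mu>) \<in> trop_rel n r" unfolding trop_rel_def using c(1,2) by blast
  qed
  show "trans (trop_rel n r)"
  proof (rule transI)
    fix \<mu> \<nu> \<eta> assume "(\<mu>, \<nu>) \<in> trop_rel n r" "(\<nu>, \<eta>) \<in> trop_rel n r"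
    then obtain c d where c: "\<mu> \<in> trop_coords n r" "\<eta> \<in> trop_coords n r"
      "\<And>I. I \<in> nsets {..<n} r \<Longrightarrow> \<nu> I = \<mu> I + ereal c" "\<And>I. I \<in> nsets {..<n} r \<Longrightarrow> \<eta> I = \<nu> I + ereal d"
      unfolding trop_rel_def by auto
    have "\<eta> I = \<mu> I + ereal (c + d)" if "I \<in> nsets {..<n} r" for I
      unfolding c(4)[OF that] c(3)[OF that] by (simp add: add.assoc)
    then show "(\<mu>, \<eta>) \<in> trop_rel n r" unfolding trop_rel_def using c(1,2) by blast
  qed
qed

lemma valuated_flag_matroid_imp_relations:
  assumes "valuated_flag_matroid n rs \<mu>s"
  shows "length \<mu>s = length rs"
    and "i < length rs \<Longrightarrow> \<mu>s ! i \<in> nsets {..<n} (rs ! i) \<rightarrow> TT"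
    and "i < length rs \<Longrightarrow> \<exists>I\<in>nsets {..<n} (rs ! i). (\<mu>s ! i) I \<noteq> \<infinity>"
    and "i < length rs \<Longrightarrow> trop_grassmann_plucker n (rs ! i) (\<mu>s ! i)"
    and "i < j \<Longrightarrow> j < length rs \<Longrightarrow> trop_incidence_plucker n (rs ! i) (rs ! j) (\<mu>s ! i) (\<mu>s ! j)"
proof -
  note fm = assms[unfolded valuated_flag_matroid_def]
  note vm = fm[THEN conjunct2, THEN conjunct1, rule_format, unfolded valuated_matroid_def]
  show "length \<mu>s = length rs" by (rule conjunct1[OF fm])
  show "\<mu>s ! i \<in> nsets {..<n} (rs ! i) \<rightarrow> TT" if "i < length rs"
    by (rule conjunct1[OF vm[OF that]])
  show "\<exists>I\<in>nsets {..<n} (rs ! i). (\<mu>s ! i) I \<noteq> \<infinity>" if "i < length rs"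
  proof -
    have "bases_of n (rs ! i) (\<mu>s ! i) \<noteq> {}"
      using conjunct1[OF conjunct2[OF vm[OF that]]] unfolding matroid_bases_def by (elim conjE)
    then show ?thesis unfolding bases_of_def by auto
  qed
  show "trop_grassmann_plucker n (rs ! i) (\<mu>s ! i)" if "i < length rs"
    unfolding trop_grassmann_plucker_iff
    by (rule trop_incidence_plucker_of_exchange[OF conjunct2[OF conjunct2[OF vm[OF that]]]])
  show "trop_incidence_plucker n (rs ! i) (rs ! j) (\<mu>s ! i) (\<mu>s ! j)" if "i < j" "j < length rs"
    by (rule trop_incidence_plucker_of_exchange[OF fm[THEN conjunct2, THEN conjunct2, rule_format,
          OF that(2,1), unfolded valuated_quotient_def]])
qed

section \<open>From flags to relations and back\<close>

context alg_closed_valuation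
begin

text \<open>The case \<open>i = j\<close> is included because it gives the Grassmann-Pluecker
  relations of a single subspace.\<close>

lemma plucker_points_imp_relations:
  assumes Ls: "Ls \<in> linear_flags n rs"
    and P: "\<And>i. i < length rs \<Longrightarrow> P i \<in> plucker_point n (rs ! i) (Ls ! i)"
  shows "i < length rs \<Longrightarrow> \<exists>I\<in>nsets {..<n} (rs ! i). P i I \<noteq> 0"
    and "i \<le> j \<Longrightarrow> j < length rs \<Longrightarrow>
      trop_incidence_plucker n (rs ! i) (rs ! j) (\<lambda>I. val (P i I)) (\<lambda>I. val (P j I))"
proof -
  have "\<exists>c A. c \<noteq> 0 \<and> A \<in> carrier_mat (rs ! i) n \<and> Ls ! i = vec_space.row_space n A \<and>
      (\<exists>I\<in>nsets {..<n} (rs ! i). minor A I \<noteq> 0) \<and> (\<forall>I\<in>nsets {..<n} (rs ! i). P i I = c * minor A I)"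
    if i: "i < length rs" for i
  proof -
    obtain c A where cA: "P i = (\<lambda>I\<in>nsets {..<n} (rs ! i). c * det (submatrix A UNIV I))" "c \<noteq> 0"
      "A \<in> carrier_mat (rs ! i) n" "distinct (rows A)"
      "vectorspace.basis class_ring (subspace_vs n (Ls ! i)) (set (rows A))"
      using P[OF i] unfolding plucker_point_def by blast
    have sub: "subspace class_ring (Ls ! i) (module_vec TYPE('k) n)" using Ls i unfolding linear_flags_def by blast
    have "\<forall>I\<in>nsets {..<n} (rs ! i). P i I = c * minor A I" unfolding cA(1) minor_def by simp
    then show ?thesis using cA(2,3) row_basis_imp_minor_neq_0[OF cA(3) sub cA(4,5)] by blast
  qed
  then obtain c A where cA: "\<And>i. i < length rs \<Longrightarrow> c i \<noteq> 0"
    "\<And>i. i < length rs \<Longrightarrow> A i \<in> carrier_mat (rs ! i) n" "\<And>i. i < length rs \<Longrightarrow> Ls ! i = vec_space.row_space n (A i)"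
    "\<And>i. i < length rs \<Longrightarrow> \<exists>I\<in>nsets {..<n} (rs ! i). minor (A i) I \<noteq> 0"
    "\<And>i I. i < length rs \<Longrightarrow> I \<in> nsets {..<n} (rs ! i) \<Longrightarrow> P i I = c i * minor (A i) I"
    by metis
  show "\<exists>I\<in>nsets {..<n} (rs ! i). P i I \<noteq> 0" if i: "i < length rs"
    using cA(4)[OF i] cA(1,5)[OF i] by auto
  show "trop_incidence_plucker n (rs ! i) (rs ! j) (\<lambda>I. val (P i I)) (\<lambda>I. val (P j I))" if ij: "i \<le> j" "j < length rs"
  proof -
    have i: "i < length rs" using ij by simp
    have "Ls ! i \<subseteq> Ls ! j"
    proof (cases "i = j")
      case False
      have "sorted_wrt (\<subseteq>) Ls" "length Ls = length rs" using Ls unfolding linear_flags_def by blast+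
      then show ?thesis using sorted_wrt_nth_less[of "(\<subseteq>)" Ls i j] ij False by simp
    qed simp
    then have le: "row_space_le (A i) (A j)"
      unfolding cA(3)[OF i] cA(3)[OF ij(2)] by (rule iffD2[OF row_space_le_iff[OF cA(2)[OF i] cA(2)[OF ij(2)]]])
    obtain u where u: "val (c i) = ereal u" using val_real[OF cA(1)[OF i]] by blast
    obtain v where v: "val (c j) = ereal v" using val_real[OF cA(1)[OF ij(2)]] by blast
    show ?thesis
    proof (rule trop_incidence_plucker_shift[OF row_space_le_imp_incidence[OF cA(2)[OF i] cA(2)[OF ij(2)] le]])
      show "val (P i I) = val (minor (A i) I) + ereal u" if "I \<in> nsets {..<n} (rs ! i)" for I
        unfolding cA(5)[OF i that] val_mult u by (rule add.commute)
      show "val (P j I) = val (minor (A j) I) + ereal v" if "I \<in> nsets {..<n} (rs ! j)" for I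
        unfolding cA(5)[OF ij(2) that] val_mult v by (rule add.commute)
    qed
  qed
qed

text \<open>Assumes just relations and finiteness, and thereby covers valuated flag matroids as well
  as points of the flag Dressian.\<close>

lemma relations_imp_realizable:
  assumes n: "n \<le> 5" and rs: "sorted rs" "\<forall>r\<in>set rs. r \<le> n" and len: "length \<mu>s = length rs"
    and TT: "\<And>i. i < length rs \<Longrightarrow> \<mu>s ! i \<in> nsets {..<n} (rs ! i) \<rightarrow> TT"
    and fin: "\<And>i. i < length rs \<Longrightarrow> \<exists>I\<in>nsets {..<n} (rs ! i). (\<mu>s ! i) I \<noteq> \<infinity>"
    and gp: "\<And>i. i < length rs \<Longrightarrow> trop_grassmann_plucker n (rs ! i) (\<mu>s ! i)"
    and inc: "\<And>i j. i < j \<Longrightarrow> j < length rs \<Longrightarrow> trop_incidence_plucker n (rs ! i) (rs ! j) (\<mu>s ! i) (\<mu>s ! j)"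
  shows "realizable val n rs \<mu>s"
proof -
  \<comment> \<open>A rank may occur several times in the list; its first position represents
    it.\<close>
  define k where "k r = (LEAST i. i < length rs \<and> rs ! i = r)" for r
  have k: "k r < length rs" "rs ! k r = r" if "r \<in> set rs" for r
  proof -
    have "\<exists>i. i < length rs \<and> rs ! i = r" using that by (simp add: in_set_conv_nth)
    from LeastI_ex[OF this] show "k r < length rs" "rs ! k r = r" unfolding k_def by blast+
  qed
  have kle: "k (rs ! i) \<le> i" if "i < length rs" for i unfolding k_def using that by (intro Least_le) simp
  \<comment> \<open>The constant 0 stands in for the ranks 0 and \<open>n\<close> when the list
    lacks them. \<open>realize_flag\<close> wants both, and the relations from rank 0 or into rank
    \<open>n\<close> hold vacuously.\<close>
  define M where "M r = (if r \<in> set rs then \<mu>s ! k r else (\<lambda>_. 0))" for r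
  have Mrs: "M r = \<mu>s ! k r" if "r \<in> set rs" for r using that by (simp add: M_def)
  have vac0: "trop_incidence_plucker n 0 s \<mu> \<nu>" for s \<mu> \<nu> unfolding trop_incidence_plucker_def by simp
  have vacn: "trop_incidence_plucker n r n \<mu> \<nu>" for r \<mu> \<nu>
  proof -
    have "J \<notin> nsets {..<n} (Suc n)" for J
    proof
      assume "J \<in> nsets {..<n} (Suc n)"
      then have "J \<subseteq> {..<n}" "card J = Suc n" by (auto simp: nsets_def)
      then show False using card_mono[of "{..<n}" J] by simp
    qed
    then show ?thesis unfolding trop_incidence_plucker_def by blast
  qed
  let ?R = "insert 0 (insert n (set rs))"
  have "tropical_flag n ?R M"
    unfolding tropical_flag_def
  proof (intro conjI ballI impI)
    fix r assume r: "r \<in> ?R"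
    show "r \<le> n" using r rs(2) by auto
    show "M r \<in> nsets {..<n} r \<rightarrow> TT"
    proof (cases "r \<in> set rs")
      case True
      then show ?thesis using TT[OF k(1)[OF True]] k(2)[OF True] Mrs[OF True] by simp
    next
      case False
      then show ?thesis by (simp add: M_def TT_def)
    qed
    show "\<exists>I\<in>nsets {..<n} r. M r I \<noteq> \<infinity>"
    proof (cases "r \<in> set rs")
      case True
      then show ?thesis using fin[OF k(1)[OF True]] k(2)[OF True] Mrs[OF True] by simp
    next
      case False
      have "{..<r} \<in> nsets {..<n} r" using \<open>r \<le> n\<close> by (auto simp: nsets_def)
      moreover have "M r {..<r} \<noteq> \<infinity>" using False by (simp add: M_def)
      ultimately show ?thesis by blast
    qed
    show "trop_grassmann_plucker n r (M r)"
    proof (cases "r \<in> set rs")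
      case True
      then show ?thesis using gp[OF k(1)[OF True]] k(2)[OF True] Mrs[OF True] by simp
    next
      case False
      then have "r = 0 \<or> r = n" using r by blast
      then show ?thesis unfolding trop_grassmann_plucker_iff using vac0 vacn by blast
    qed
  next
    fix r s assume r: "r \<in> ?R" and s: "s \<in> ?R" and less: "r < s"
    have "s \<le> n" using s rs(2) by auto
    show "trop_incidence_plucker n r s (M r) (M s)"
    proof (cases "r = 0 \<or> s = n")
      case True
      then show ?thesis using vac0 vacn by blast
    next
      case False
      then have mem: "r \<in> set rs" "s \<in> set rs" using r s less \<open>s \<le> n\<close> by auto
      have "k r < k s"
      proof (rule ccontr)
        assume "\<not> k r < k s"
        then have "rs ! k s \<le> rs ! k r" using sorted_nth_mono[OF rs(1)] k(1)[OF mem(1)] by simp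
        then show False using less unfolding k(2)[OF mem(1)] k(2)[OF mem(2)] by simp
      qed
      from inc[OF this k(1)[OF mem(2)]] show ?thesis
        unfolding k(2)[OF mem(1)] k(2)[OF mem(2)] Mrs[OF mem(1)] Mrs[OF mem(2)] .
    qed
  qed
  then obtain F where F: "flag_realizes n ?R F M" using realize_flag[OF n] by blast
  have Fr: "realizes (F r) r n (M r)" if "r \<in> set rs" for r using F that unfolding flag_realizes_def by blast
  have Fle: "row_space_le (F r) (F s)" if "r \<in> set rs" "s \<in> set rs" "r < s" for r s
    using F that unfolding flag_realizes_def by blast
  define L where "L r = vec_space.row_space n (F r)" for r
  have basis: "subspace class_ring (L r) (module_vec TYPE('k) n)" "distinct (rows (F r))"
    "vectorspace.basis class_ring (subspace_vs n (L r)) (set (rows (F r)))"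
    "vectorspace.dim class_ring (subspace_vs n (L r)) = r" if r: "r \<in> set rs" for r
  proof -
    obtain I where I: "I \<in> nsets {..<n} r" "M r I \<noteq> \<infinity>" using fin[OF k(1)[OF r]] unfolding k(2)[OF r] Mrs[OF r] by blast
    note minor_neq_0_imp_row_basis[OF realizes_carrier[OF Fr[OF r]] I(1) realizes_imp_minor_neq_0[OF Fr[OF r] I], folded L_def]
    then show "subspace class_ring (L r) (module_vec TYPE('k) n)" "distinct (rows (F r))"
      "vectorspace.basis class_ring (subspace_vs n (L r)) (set (rows (F r)))"
      "vectorspace.dim class_ring (subspace_vs n (L r)) = r" by blast+
  qed
  have Lmono: "L r \<subseteq> L s" if "r \<in> set rs" "s \<in> set rs" "r \<le> s" for r s
  proof (cases "r = s")
    case False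
    then have "row_space_le (F r) (F s)" using Fle that by simp
    then show ?thesis unfolding L_def
      using row_space_le_iff[OF realizes_carrier[OF Fr[OF that(1)]] realizes_carrier[OF Fr[OF that(2)]]] by blast
  qed simp
  have "map L rs \<in> linear_flags n rs"
    unfolding linear_flags_def
  proof (intro CollectI conjI allI impI)
    show "sorted_wrt (\<subseteq>) (map L rs)"
      unfolding sorted_wrt_map
      by (rule sorted_wrt_mono_rel[OF _ rs(1)[unfolded sorted_wrt_iff_nth_less, folded sorted_wrt_iff_nth_less]]) (rule Lmono)
  qed (use basis in simp_all)
  moreover have "\<exists>P\<in>plucker_point n (rs ! i) (map L rs ! i). \<exists>c::real.
      \<forall>I\<in>nsets {..<n} (rs ! i). (\<mu>s ! i) I = val (P I) + ereal c" if i: "i < length rs" for i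
  proof -
    define r where "r = rs ! i"
    have r: "r \<in> set rs" using i by (simp add: r_def)
    define P where "P = (\<lambda>I\<in>nsets {..<n} r. 1 * det (submatrix (F r) UNIV I))"
    have "P \<in> plucker_point n r (L r)"
      unfolding plucker_point_def P_def
      using basis(2,3)[OF r] realizes_carrier[OF Fr[OF r]] by (intro CollectI exI[of _ 1] exI[of _ "F r"]) simp
    moreover obtain c where c: "\<And>I. I \<in> nsets {..<n} r \<Longrightarrow> M r I = val (minor (F r) I) + ereal c"
      using Fr[OF r] unfolding realizes_def by blast
    \<comment> \<open>A later occurrence of a rank differs from the first by a constant, which is
      absorbed into the constant of \<open>realizable\<close>.\<close>
    moreover have "\<exists>d::real. \<forall>I\<in>nsets {..<n} r. (\<mu>s ! i) I = M r I + ereal d"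
    proof (cases "k r = i")
      case True
      then show ?thesis unfolding Mrs[OF r] by (intro exI[of _ 0]) simp
    next
      case False
      then have ki: "k r < i" using kle[OF i] by (simp add: r_def)
      have "trop_incidence_plucker n r r (M r) (\<mu>s ! i)"
        using inc[OF ki i] unfolding k(2)[OF r] Mrs[OF r] r_def[symmetric] .
      then show ?thesis
        using TT[OF k(1)[OF r]] fin[OF k(1)[OF r]] TT[OF i] fin[OF i]
        unfolding k(2)[OF r] Mrs[OF r, symmetric] r_def[symmetric] by (rule incident_same_rank_imp_equal[rotated 4])
    qed
    then obtain d where d: "\<And>I. I \<in> nsets {..<n} r \<Longrightarrow> (\<mu>s ! i) I = M r I + ereal d" by blast
    moreover have "(\<mu>s ! i) I = val (P I) + ereal (c + d)" if I: "I \<in> nsets {..<n} r" for I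
      unfolding d[OF I] c[OF I] P_def using I by (simp add: minor_def add.assoc)
    moreover have "map L rs ! i = L r" using i by (simp add: r_def)
    ultimately show ?thesis unfolding r_def[symmetric] by metis
  qed
  ultimately show ?thesis unfolding realizable_def by blast
qed

lemma val_plucker_in_trop_coords:
  assumes "\<exists>I\<in>nsets {..<n} r. P I \<noteq> 0"
  shows "restrict (\<lambda>I. val (P I)) (nsets {..<n} r) \<in> trop_coords n r"
  unfolding trop_coords_def using assms by (auto simp: TT_def)

text \<open>Valuations of actual flags satisfy the relations by
  \<open>plucker_points_imp_relations\<close>; conversely \<open>relations_imp_realizable\<close>
  realizes the representatives of a point of the Dressian.\<close>

lemma tropicalization_eq_flag_dressian:
  assumes n: "n \<le> 5" and rs: "sorted rs" "\<forall>r\<in>set rs. r \<le> n"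
  shows "projective_tropicalization val n rs (flag_variety n rs) = flag_dressian n rs"
proof (intro equalityI subsetI)
  fix p assume "p \<in> projective_tropicalization val n rs (flag_variety n rs)"
  then obtain Ps Ls where p: "p = map2 (\<lambda>r P. trop_point n r (\<lambda>I. val (P I))) rs Ps"
    and Ps: "Ps \<in> listset (map2 (plucker_point n) rs Ls)" and Ls: "Ls \<in> linear_flags n rs"
    unfolding projective_tropicalization_def flag_variety_def by blast
  have lenL: "length Ls = length rs" using Ls unfolding linear_flags_def by blast
  have lenP: "length Ps = length rs" using Ps lenL unfolding in_listset_iff by simp
  have P: "Ps ! i \<in> plucker_point n (rs ! i) (Ls ! i)" if "i < length rs" for i
    using Ps lenL that unfolding in_listset_iff by simp
  note rel = plucker_points_imp_relations[OF Ls, of "\<lambda>i. Ps ! i", OF P]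
  define \<mu>s where "\<mu>s = map2 (\<lambda>r P. restrict (\<lambda>I. val (P I)) (nsets {..<n} r)) rs Ps"
  have \<mu>s: "\<mu>s ! i = restrict (\<lambda>I. val ((Ps ! i) I)) (nsets {..<n} (rs ! i))" "p ! i = trop_rel n (rs ! i) `` {\<mu>s ! i}"
    if "i < length rs" for i
    unfolding \<mu>s_def p using that lenP by (simp_all add: trop_point_def)
  have coords: "\<mu>s ! i \<in> trop_coords n (rs ! i)" if "i < length rs" for i
    unfolding \<mu>s(1)[OF that] by (rule val_plucker_in_trop_coords[OF rel(1)[OF _ that]])
  have lenp: "length p = length rs" "length \<mu>s = length rs" unfolding p \<mu>s_def using lenP by simp_all
  have "p \<in> listset (map (trop_proj n) rs)"
    unfolding in_listset_iff using lenp coords by (auto simp: \<mu>s(2) trop_proj_def intro: quotientI)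
  moreover have "\<mu>s \<in> listset p"
    unfolding in_listset_iff using lenp equiv_class_self[OF equiv_trop_rel coords] by (auto simp: \<mu>s(2))
  moreover have inc: "trop_incidence_plucker n (rs ! i) (rs ! j) (\<mu>s ! i) (\<mu>s ! j)" if ij: "i \<le> j" "j < length rs" for i j
  proof -
    have i: "i < length rs" using ij by simp
    show ?thesis unfolding \<mu>s(1)[OF i] \<mu>s(1)[OF ij(2)]
      by (rule trop_incidence_plucker_cong[OF rel(2)[OF _ ij]]) simp_all
  qed
  ultimately show "p \<in> flag_dressian n rs"
    unfolding flag_dressian_def trop_grassmann_plucker_iff
    by (intro CollectI conjI bexI[of _ \<mu>s] allI impI inc) simp_all
next
  fix p assume "p \<in> flag_dressian n rs"
  then obtain \<mu>s where p: "p \<in> listset (map (trop_proj n) rs)" and \<mu>s: "\<mu>s \<in> listset p"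
    and gp: "\<And>i. i < length rs \<Longrightarrow> trop_grassmann_plucker n (rs ! i) (\<mu>s ! i)"
    and inc: "\<And>i j. i < j \<Longrightarrow> j < length rs \<Longrightarrow> trop_incidence_plucker n (rs ! i) (rs ! j) (\<mu>s ! i) (\<mu>s ! j)"
    unfolding flag_dressian_def by blast
  have len: "length p = length rs" "length \<mu>s = length rs" using p \<mu>s unfolding in_listset_iff by simp_all
  \<comment> \<open>Each factor of \<open>p\<close> is the full class of its representative, so a
    realization of the representatives determines \<open>p\<close>.\<close>
  have cls: "p ! i = trop_rel n (rs ! i) `` {\<mu>s ! i}" "\<mu>s ! i \<in> trop_coords n (rs ! i)" if i: "i < length rs" for i
  proof -
    have pi: "p ! i \<in> trop_coords n (rs ! i) // trop_rel n (rs ! i)" "\<mu>s ! i \<in> p ! i"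
      using p \<mu>s i len unfolding in_listset_iff trop_proj_def by simp_all
    then obtain a where a: "p ! i = trop_rel n (rs ! i) `` {a}" by (auto elim: quotientE)
    then have am: "(a, \<mu>s ! i) \<in> trop_rel n (rs ! i)" using pi(2) by simp
    show "p ! i = trop_rel n (rs ! i) `` {\<mu>s ! i}" unfolding a by (rule equiv_class_eq[OF equiv_trop_rel am])
    show "\<mu>s ! i \<in> trop_coords n (rs ! i)" using am unfolding trop_rel_def by blast
  qed
  have "realizable val n rs \<mu>s"
  proof (rule relations_imp_realizable[OF n rs len(2)])
    show "\<mu>s ! i \<in> nsets {..<n} (rs ! i) \<rightarrow> TT" "\<exists>I\<in>nsets {..<n} (rs ! i). (\<mu>s ! i) I \<noteq> \<infinity>" if "i < length rs" for i
      using cls(2)[OF that] unfolding trop_coords_def by (blast dest: PiE_mem)+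
  qed (rule gp inc; assumption)+
  then obtain Ls where Ls: "Ls \<in> linear_flags n rs" and "\<And>i. i < length rs \<Longrightarrow>
      \<exists>P\<in>plucker_point n (rs ! i) (Ls ! i). \<exists>c::real. \<forall>I\<in>nsets {..<n} (rs ! i). (\<mu>s ! i) I = val (P I) + ereal c"
    unfolding realizable_def by blast
  then obtain P c where P: "\<And>i. i < length rs \<Longrightarrow> P i \<in> plucker_point n (rs ! i) (Ls ! i)"
    and c: "\<And>i I. i < length rs \<Longrightarrow> I \<in> nsets {..<n} (rs ! i) \<Longrightarrow> (\<mu>s ! i) I = val (P i I) + ereal (c i)"
    by metis
  have lenL: "length Ls = length rs" using Ls unfolding linear_flags_def by blast
  define Ps where "Ps = map P [0..<length rs]"
  have lenP: "length Ps = length rs" by (simp add: Ps_def)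
  have "Ps \<in> listset (map2 (plucker_point n) rs Ls)"
    unfolding in_listset_iff using lenL P by (simp add: Ps_def)
  moreover have "p = map2 (\<lambda>r P. trop_point n r (\<lambda>I. val (P I))) rs Ps"
  proof (rule nth_equalityI)
    fix i assume "i < length p"
    then have i: "i < length rs" using len by simp
    let ?v = "restrict (\<lambda>I. val (P i I)) (nsets {..<n} (rs ! i))"
    have "?v \<in> trop_coords n (rs ! i)"
      by (rule val_plucker_in_trop_coords[OF plucker_points_imp_relations(1)[OF Ls P i]])
    then have "(?v, \<mu>s ! i) \<in> trop_rel n (rs ! i)"
      unfolding trop_rel_def using cls(2)[OF i] c[OF i] by auto
    then have "trop_rel n (rs ! i) `` {?v} = p ! i"
      unfolding cls(1)[OF i] by (rule equiv_class_eq[OF equiv_trop_rel])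
    then show "p ! i = map2 (\<lambda>r P. trop_point n r (\<lambda>I. val (P I))) rs Ps ! i"
      using i lenP by (simp add: trop_point_def Ps_def)
  qed (use len lenP in simp)
  ultimately show "p \<in> projective_tropicalization val n rs (flag_variety n rs)"
    unfolding projective_tropicalization_def flag_variety_def using Ls by blast
qed

end

theorem theorem5p6:
  fixes val :: "'k::alg_closed_field \<Rightarrow> ereal"
    and n :: nat and rs :: "nat list"
  assumes "is_valuation val"
    and "range val = TT"
    and "n \<le> 5"
    and "sorted rs"
    and "\<forall>r\<in>set rs. r \<le> n"
  shows "(\<forall>\<mu>s. valuated_flag_matroid n rs \<mu>s \<longrightarrow> realizable val n rs \<mu>s) \<and>
    projective_tropicalization val n rs (flag_variety n rs) = flag_dressian n rs"
proof -
  interpret alg_closed_valuation val by unfold_locales (rule assms(1,2))+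
  have "realizable val n rs \<mu>s" if "valuated_flag_matroid n rs \<mu>s" for \<mu>s
    by (rule relations_imp_realizable[OF assms(3-5)]) (rule valuated_flag_matroid_imp_relations[OF that]; assumption)+
  then show ?thesis using tropicalization_eq_flag_dressian[OF assms(3-5)] by blast
qed

end
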